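(* Let $0<\alpha<\beta<\infty$ and $w\in\mathcal W_{\alpha,\beta}$, and define the probability measure \[ \widehat{\mathsf P}_w^{0,!}(\mathrm dy,\mathrm d\xi)=\nu_w(\mathrm dy)\,\mathsf P_{w,y}^{!}(\mathrm d\xi) \] on $(0,\infty)\times\mathcal N_{\mathbb H}$. Let $Y(y,\xi)=y$, and let $X^{!}(y,\xi)=p_\#\xi$ if $p_\#\xi\in\mathcal N_{\mathbb R}$ (which holds $\widehat{\mathsf P}_w^{0,!}$-almost surely) and $X^{!}(y,\xi)=$ the zero configuration otherwise. Then, under $\widehat{\mathsf P}_w^{0,!}$: $Y$ has distribution \[ \nu_w(\mathrm dy)=\frac{w(y)y^{-2}\,\mathrm dy}{\int_0^\infty w(u)u^{-2}\,\mathrm du}; \] the kernel $y\mapsto\mathsf P_{w,y}^{!}$ is a version of the conditional law of $\xi$ given $Y=y$; and $X^{!}$ has distribution $\mathbb P_w^{0,!}$, the reduced Palm distribution of $X_w$ at the origin.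
   Context: $\mathbb H=\{x+iy:x\in\mathbb R,\ y>0\}$ with planar Lebesgue measure $\mathrm dA$. $\mathcal N_{\mathbb R}$, $\mathcal N_{\mathbb H}$ denote the spaces of locally finite simple counting measures on $\mathbb R$, $\mathbb H$, with the Borel $\sigma$-fields of the vague topology. A point process (or its law) is determinantal with kernel $K$ relative to $\mathrm dA$ if for every $k\ge1$ its $k$-th factorial moment measure has density $\det[K(z_i,z_j)]_{i,j=1}^k$ with respect to $\mathrm dA^{\otimes k}$. $Z_{\mathbb H}$ is the determinantal point process on $\mathbb H$ with kernel $K_{\mathbb H}(z,\zeta)=-\frac{1}{\pi(z-\overline\zeta)^2}$. $\mathcal W_{\alpha,\beta}$ is the set of Borel functions $w:(0,\infty)\to[0,1]$ with $w(y)=0$ for $y\notin[\alpha,\beta]$ and $\int_\alpha^\beta w(y)\,\mathrm dy>0$. $M_w$ is obtained from $Z_{\mathbb H}$ by independently retaining each point $z=x+iy$ with probability $w(y)$. $p(x+iy)=x$ and $X_w=p_\#M_w=\sum_{z\in M_w}\delta_{\operatorname{Re}z}$, a stationary, locally finite, simple point process on $\mathbb R$ with intensity $\lambda_w=\frac1{4\pi}\int_0^\infty w(y)y^{-2}\,\mathrm dy$. With $\theta_x$ denoting translation by $-x$, the reduced Palm distribution $\mathbb P_w^{0,!}$ of $X_w$ at the origin (a probability measure on $\mathcal N_{\mathbb R}$, with expectation $\mathbb E_w^{0,!}$) is characterized by $\mathbb E\sum_{x\in X_w}\mathbf 1_B(x)F(\theta_x(X_w-\delta_x))=|B|\lambda_w\,\mathbb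 E_w^{0,!}[F(X_w)]$ for all bounded Borel $B\subset\mathbb R$ with $|B|>0$ and bounded measurable $F:\mathcal N_{\mathbb R}\to\mathbb R$. For $y>0$, $\mathsf P_{w,y}^{!}$ is the determinantal law on $\mathcal N_{\mathbb H}$ with kernel $\sqrt{w(\operatorname{Im}z)}\,K_{\mathbb H}^{iy,!}(z,\zeta)\sqrt{w(\operatorname{Im}\zeta)}$, where $K_{\mathbb H}^{iy,!}(z,\zeta)=K_{\mathbb H}(z,\zeta)-\frac{K_{\mathbb H}(z,iy)K_{\mathbb H}(iy,\zeta)}{K_{\mathbb H}(iy,iy)}$; the map $y\mapsto\mathsf P_{w,y}^{!}$ is a weakly continuous probability kernel. *)

theory Defs
  imports
    "HOL-Probability.Probability"
    "Jordan_Normal_Form.Determinant"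
begin

section \<open>Simple point configurations and the vague topology\<close>

text \<open>The simple counting measure \<open>\<Sum>x\<in>D. \<delta>\<^sub>x\<close> on the Borel sets of \<open>E\<close>, as the push-forward of
  counting measure on \<open>D \<subseteq> E\<close> under the inclusion.\<close>

definition dirac_sum :: "'a::topological_space set \<Rightarrow> 'a set \<Rightarrow> 'a measure" where
  "dirac_sum E D = distr (count_space D) (restrict_space borel E) (\<lambda>x. x)"

definition configs :: "'a::topological_space set \<Rightarrow> 'a measure set" where
  "configs E = {dirac_sum E D | D. D \<subseteq> E \<and> (\<forall>K. compact K \<and> K \<subseteq> E \<longrightarrow> finite (D \<inter> K))}"

definition test_function :: "'a::topological_space set \<Rightarrow> ('a \<Rightarrow> real) \<Rightarrow> bool" where
  "test_function E f \<longleftrightarrow>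
     continuous_on E f \<and> (\<exists>K. compact K \<and> K \<subseteq> E \<and> (\<forall>x\<in>E - K. f x = 0))"

definition vague_topology :: "'a::topological_space set \<Rightarrow> 'a measure topology" where
  "vague_topology E = topology_generated_by
     {{\<mu> \<in> configs E. (\<integral>x. f x \<partial>\<mu>) \<in> U} | f U. test_function E f \<and> open U}"

definition config_space :: "'a::topological_space set \<Rightarrow> 'a measure measure" where
  "config_space E = sigma (configs E) {U. openin (vague_topology E) U}"

definition points :: "'a measure \<Rightarrow> 'a set" where
  "points \<mu> = {x \<in> space \<mu>. emeasure \<mu> {x} \<noteq> 0}"

lemma emeasure_dirac_sum:
  assumes "D \<subseteq> E" "A \<in> sets (restrict_space borel E)"
  shows "emeasure (dirac_sum E D) A = emeasure (count_space UNIV) (A \<inter> D)"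
proof -
  have "(\<lambda>x. x) \<in> count_space D \<rightarrow>\<^sub>M restrict_space borel E"
    using assms by (auto simp: space_restrict_space)
  then show ?thesis
    using assms
    by (simp add: dirac_sum_def emeasure_distr emeasure_count_space)
qed

lemma points_dirac_sum:
  fixes E :: "'a::t1_space set"
  assumes "D \<subseteq> E"
  shows "points (dirac_sum E D) = D"
proof -
  have sp: "space (dirac_sum E D) = E"
    by (simp add: dirac_sum_def space_restrict_space)
  have "{x} \<in> sets (restrict_space borel E)" if "x \<in> E" for x
    using that by (auto simp: sets_restrict_space intro!: image_eqI[of _ _ "{x}"])
  then have "emeasure (dirac_sum E D) {x} = emeasure (count_space UNIV) ({x} \<inter> D)"
    if "x \<in> E" for x
    using that assms by (intro emeasure_dirac_sum)
  then show ?thesis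
    using assms by (auto simp: points_def sp)
qed


section \<open>Determinantal laws\<close>

text \<open>The \<open>k\<close>-th factorial moment measure: the expected number of \<open>k\<close>-tuples of pairwise distinct
  points of the configuration that lie in \<open>A \<subseteq> E\<^sup>k\<close>. Tuples are indexed by \<open>{..<k}\<close>.\<close>

definition factorial_moment :: "'a measure measure \<Rightarrow> nat \<Rightarrow> (nat \<Rightarrow> 'a) set \<Rightarrow> ennreal" where
  "factorial_moment Q k A =
     (\<integral>\<^sup>+\<mu>. emeasure (count_space UNIV) {x \<in> A. inj_on x {..<k} \<and> x ` {..<k} \<subseteq> points \<mu>} \<partial>Q)"

definition kernel_det :: "('a \<Rightarrow> 'a \<Rightarrow> complex) \<Rightarrow> nat \<Rightarrow> (nat \<Rightarrow> 'a) \<Rightarrow> complex" where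
  "kernel_det K k x = Determinant.det (mat k k (\<lambda>(i, j). K (x i) (x j)))"

text \<open>The reference measure is Lebesgue measure restricted to \<open>E\<close>. For the kernel to have
  densities in the stated sense, its determinants must be real and nonnegative almost
  everywhere.\<close>

definition determinantal ::
  "'a::euclidean_space set \<Rightarrow> ('a \<Rightarrow> 'a \<Rightarrow> complex) \<Rightarrow> 'a measure measure \<Rightarrow> bool" where
  "determinantal E K Q \<longleftrightarrow>
     prob_space Q \<and> sets Q = sets (config_space E) \<and>
     (\<forall>k\<ge>1.
        let \<Lambda> = (\<Pi>\<^sub>M i\<in>{..<k}. restrict_space lborel E) in
        (AE x in \<Lambda>. kernel_det K k x \<in> \<real> \<and> 0 \<le> Re (kernel_det K k x)) \<and>
        (\<forall>A\<in>sets \<Lambda>. factorial_moment Q k A =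
           (\<integral>\<^sup>+x\<in>A. ennreal (Re (kernel_det K k x)) \<partial>\<Lambda>)))"

definition upper_half_plane :: "complex set" where
  "upper_half_plane = {z. 0 < Im z}"

definition K_H :: "complex \<Rightarrow> complex \<Rightarrow> complex" where
  "K_H z \<zeta> = - 1 / (complex_of_real pi * (z - cnj \<zeta>)\<^sup>2)"

definition K_H_palm :: "complex \<Rightarrow> complex \<Rightarrow> complex \<Rightarrow> complex" where
  "K_H_palm a z \<zeta> = K_H z \<zeta> - K_H z a * K_H a \<zeta> / K_H a a"

definition thinned_palm_kernel :: "(real \<Rightarrow> real) \<Rightarrow> real \<Rightarrow> complex \<Rightarrow> complex \<Rightarrow> complex" where
  "thinned_palm_kernel w y z \<zeta> =
     complex_of_real (sqrt (w (Im z))) * K_H_palm (\<i> * complex_of_real y) z \<zeta> *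
     complex_of_real (sqrt (w (Im \<zeta>)))"


section \<open>Weights, independent thinning, projection\<close>

text \<open>Functions on the open half-line are total functions whose values off it are never used.\<close>

definition weights :: "real \<Rightarrow> real \<Rightarrow> (real \<Rightarrow> real) set" where
  "weights \<alpha> \<beta> = {w. w \<in> borel_measurable (restrict_space borel {0<..}) \<and>
     (\<forall>y>0. 0 \<le> w y \<and> w y \<le> 1) \<and>
     (\<forall>y>0. y \<notin> {\<alpha>..\<beta>} \<longrightarrow> w y = 0) \<and>
     0 < (LBINT y:{\<alpha>..\<beta>}. w y)}"

text \<open>Law of the configuration obtained from \<open>\<mu>\<close> by keeping each of its points \<open>z\<close>
  independently with probability \<open>q z\<close>.\<close>

definition thinning_kernel ::
  "'a::topological_space set \<Rightarrow> ('a \<Rightarrow> real) \<Rightarrow> 'a measure \<Rightarrow> 'a measure measure" where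
  "thinning_kernel E q \<mu> =
     distr (\<Pi>\<^sub>M z\<in>points \<mu>. measure_pmf (bernoulli_pmf (q z))) (config_space E)
       (\<lambda>keep. dirac_sum E {z \<in> points \<mu>. keep z})"

definition thinning ::
  "'a::topological_space set \<Rightarrow> ('a \<Rightarrow> real) \<Rightarrow> 'a measure measure \<Rightarrow> 'a measure measure" where
  "thinning E q Q = Giry_Monad.bind Q (thinning_kernel E q)"

text \<open>Projection to the real axis; the value is the zero configuration when the push-forward
  fails to be locally finite or simple.\<close>

definition proj :: "complex measure \<Rightarrow> real measure" where
  "proj \<xi> = (if distr \<xi> borel Re \<in> configs UNIV then distr \<xi> borel Re else null_measure borel)"

text \<open>Law of \<open>X\<^sub>w\<close>, given the law \<open>Q\<close> of the half-plane process.\<close>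

definition X_law :: "(real \<Rightarrow> real) \<Rightarrow> complex measure measure \<Rightarrow> real measure measure" where
  "X_law w Q = distr (thinning upper_half_plane (\<lambda>z. w (Im z)) Q) (config_space UNIV) proj"

definition intensity :: "(real \<Rightarrow> real) \<Rightarrow> real" where
  "intensity w = 1 / (4 * pi) * (LBINT y:{0<..}. w y / y\<^sup>2)"


section \<open>Reduced Palm distribution at the origin\<close>

definition translate :: "real \<Rightarrow> real measure \<Rightarrow> real measure" where
  "translate x \<mu> = distr \<mu> borel (\<lambda>u. u - x)"

definition remove_point :: "real \<Rightarrow> real measure \<Rightarrow> real measure" where
  "remove_point x \<mu> = diff_measure \<mu> (return borel x)"

text \<open>\<open>P\<close> is the reduced Palm distribution at the origin of a stationary simple point process
  on the line with law \<open>Q\<close> and intensity \<open>c\<close>.\<close>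

definition is_reduced_palm ::
  "real measure measure \<Rightarrow> real \<Rightarrow> real measure measure \<Rightarrow> bool" where
  "is_reduced_palm Q c P \<longleftrightarrow>
     prob_space P \<and> sets P = sets (config_space UNIV) \<and>
     (\<forall>B F. B \<in> sets borel \<and> bounded B \<and> 0 < measure lborel B \<and>
        F \<in> borel_measurable (config_space UNIV) \<and> bounded (F ` configs UNIV) \<longrightarrow>
        has_bochner_integral Q
          (\<lambda>\<mu>. \<Sum>x\<in>points \<mu> \<inter> B. F (translate x (remove_point x \<mu>)))
          (measure lborel B * c * (\<integral>\<mu>. F \<mu> \<partial>P)))"


section \<open>The mixture over the height\<close>

abbreviation height_space :: "real measure" where
  "height_space \<equiv> restrict_space borel {0<..}"

definition \<nu> :: "(real \<Rightarrow> real) \<Rightarrow> real measure" where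
  "\<nu> w = density (restrict_space lborel {0<..})
     (\<lambda>y. ennreal (w y / y\<^sup>2 / (LBINT u:{0<..}. w u / u\<^sup>2)))"

text \<open>The measure \<open>\<nu> w (dy) P y (d\<xi>)\<close> on pairs \<open>(y, \<xi>)\<close>.\<close>

definition palm_mixture ::
  "(real \<Rightarrow> real) \<Rightarrow> (real \<Rightarrow> complex measure measure) \<Rightarrow> (real \<times> complex measure) measure" where
  "palm_mixture w P = Giry_Monad.bind (\<nu> w)
     (\<lambda>y. distr (P y) (height_space \<Otimes>\<^sub>M config_space upper_half_plane) (\<lambda>\<xi>. (y, \<xi>)))"

definition conditional_law ::
  "'w measure \<Rightarrow> ('w \<Rightarrow> 'x) \<Rightarrow> 'x measure \<Rightarrow> ('w \<Rightarrow> 'y) \<Rightarrow> 'y measure \<Rightarrow> ('y \<Rightarrow> 'x measure) \<Rightarrow> bool"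
  where
  "conditional_law M X N Y S \<kappa> \<longleftrightarrow>
     X \<in> M \<rightarrow>\<^sub>M N \<and> Y \<in> M \<rightarrow>\<^sub>M S \<and> \<kappa> \<in> S \<rightarrow>\<^sub>M prob_algebra N \<and>
     (\<forall>A\<in>sets N. AE \<omega> in M.
        real_cond_exp M (vimage_algebra (space M) Y S) (indicator (X -` A \<inter> space M)) \<omega> =
        measure (\<kappa> (Y \<omega>)) A)"

end

theory Submission
  imports Defs
begin

text \<open>
  A locally finite simple configuration is determined by its void events, so a finite measure on
  configurations is determined by its void probabilities. The void probability of a bounded set \<open>C\<close>
  is the alternating series of \<open>m\<^sub>k / k!\<close>, where \<open>m\<^sub>k\<close> is the \<open>k\<close>-th factorial moment of the number
  of points in \<open>C\<close>; for a determinantal law \<open>m\<^sub>k \<le> (c \<surd>k)\<^sup>k\<close> by Hadamard's inequality, so the series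
  converges. Hence factorial moments determine the law, and laws whose moments depend measurably on
  a parameter depend measurably on it themselves.

  To identify the Palm distribution, compare factorial moments of the Campbell measure of \<open>X\<^sub>w\<close> over
  \<open>B\<close> with those of the projected mixture. The former are integrals of the \<open>(k + 1)\<close>-point
  determinants of \<open>K_H\<close>. Pivoting on the last point \<open>z = x + iy\<close> (Schur complement) splits off
  \<open>K_H z z = 1 / (4 \<pi> y\<^sup>2)\<close> and leaves the \<open>k\<close>-point determinant of the reduced kernel at \<open>z\<close>. By
  translation invariance \<open>x\<close> integrates to \<open>|B|\<close>, and what remains is the integral of the moments of
  \<open>P y\<close> against the intensity times \<open>\<nu> w\<close>.
\<close>

section \<open>Counting the points of a configuration\<close>

text \<open>The sigma-field is generated by all vaguely open sets, and these are uncountable unions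
  of basic ones; before void events can act as a generator, every vaguely open set has to be
  exhausted by countably many events built from them. Estimating a \<open>k\<close>-point
  determinant by its Leibniz sum gives k! c^k, which divided by k! need not tend to 0; the square
  root saved by Hadamard's inequality is what makes the series converge for every size of c. The
  projected process is not handled through a kernel on the line: its moments are integrals over
  slabs of the half-plane above sets of reals. Such a slab reaches the real axis, where the kernels
  blow up, and its area can be infinite. The weight confines everything to the strip between
  \<alpha> and \<beta>; there the bounds are uniform in the height y and therefore survive mixing.
  Each \<open>P y\<close> is given only through its factorial moments, separately for each y, so
  even forming the mixture presupposes a proof that y \<mapsto> \<open>P y\<close> is
  measurable.\<close>

definition bounded_sets :: "'a::topological_space set \<Rightarrow> 'a set set" where
  "bounded_sets E = {C \<in> sets borel. \<exists>K. compact K \<and> C \<subseteq> K \<and> K \<subseteq> E}"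

definition locally_finite :: "'a::topological_space set \<Rightarrow> 'a set \<Rightarrow> bool" where
  "locally_finite E D \<longleftrightarrow> D \<subseteq> E \<and> (\<forall>K. compact K \<and> K \<subseteq> E \<longrightarrow> finite (D \<inter> K))"

lemma configs_eq: "configs E = dirac_sum E ` Collect (locally_finite E)"
  by (auto simp: configs_def locally_finite_def)

lemma dirac_sum_in_configs: "locally_finite E D \<Longrightarrow> dirac_sum E D \<in> configs E"
  by (auto simp: configs_eq)

lemma locally_finite_subset: "locally_finite E D \<Longrightarrow> D' \<subseteq> D \<Longrightarrow> locally_finite E D'"
  unfolding locally_finite_def by (meson Int_mono finite_subset order_refl subset_trans)

lemma space_dirac_sum [simp]: "space (dirac_sum E D) = E"
  and sets_dirac_sum: "sets (dirac_sum E D) = sets (restrict_space borel E)"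
  by (simp_all add: dirac_sum_def space_restrict_space)

lemma nn_integral_dirac_sum:
  assumes "D \<subseteq> E" "f \<in> borel_measurable (restrict_space borel E)"
  shows "(\<integral>\<^sup>+x. f x \<partial>dirac_sum E D) = (\<integral>\<^sup>+x. f x \<partial>count_space D)"
  unfolding dirac_sum_def using assms
  by (subst nn_integral_distr) (auto simp: space_restrict_space)

lemma integral_dirac_sum:
  fixes f :: "'a::topological_space \<Rightarrow> real"
  assumes "D \<subseteq> E" "f \<in> borel_measurable (restrict_space borel E)"
  shows "(\<integral>x. f x \<partial>dirac_sum E D) = (\<integral>x. f x \<partial>count_space D)"
  unfolding dirac_sum_def using assms
  by (subst integral_distr) (auto simp: space_restrict_space)

locale configuration =
  fixes E :: "'a::t1_space set" and \<mu> :: "'a measure"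
  assumes configs: "\<mu> \<in> configs E"
begin

lemma locally_finite_points: "locally_finite E (points \<mu>)"
  and dirac_sum_points: "dirac_sum E (points \<mu>) = \<mu>"
proof -
  obtain D where D: "locally_finite E D" "\<mu> = dirac_sum E D"
    using configs by (auto simp: configs_eq)
  then have "points \<mu> = D"
    by (simp add: locally_finite_def points_dirac_sum)
  with D show "locally_finite E (points \<mu>)" "dirac_sum E (points \<mu>) = \<mu>"
    by simp_all
qed

lemma points_subset: "points \<mu> \<subseteq> E"
  using locally_finite_points by (auto simp: locally_finite_def)

lemma space_config: "space \<mu> = E"
  and sets_config: "sets \<mu> = sets (restrict_space borel E)"
  by (metis space_dirac_sum dirac_sum_points) (metis sets_dirac_sum dirac_sum_points)

lemma finite_points_bounded: "C \<in> bounded_sets E \<Longrightarrow> finite (points \<mu> \<inter> C)"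
  using locally_finite_points unfolding locally_finite_def bounded_sets_def
  by (auto elim!: allE impE intro: finite_subset[OF Int_mono[OF order_refl]])

lemma emeasure_config:
  assumes "A \<in> sets (restrict_space borel E)"
  shows "emeasure \<mu> A = emeasure (count_space UNIV) (A \<inter> points \<mu>)"
  using emeasure_dirac_sum[OF points_subset assms] by (simp add: dirac_sum_points)

lemma nn_integral_config:
  assumes "f \<in> borel_measurable (restrict_space borel E)"
  shows "(\<integral>\<^sup>+x. f x \<partial>\<mu>) = (\<integral>\<^sup>+x. f x \<partial>count_space (points \<mu>))"
  using nn_integral_dirac_sum[OF points_subset assms] by (simp add: dirac_sum_points)

text \<open>\<open>K\<close> may be any set that catches finitely many points and carries
  \<open>f\<close>; later it is a compact set enlarged by cells that stick out of it.\<close>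

lemma integral_config:
  fixes f :: "'a \<Rightarrow> real"
  assumes "f \<in> borel_measurable (restrict_space borel E)"
    and K: "finite (points \<mu> \<inter> K)" "\<And>x. x \<in> E - K \<Longrightarrow> f x = 0"
  shows "(\<integral>x. f x \<partial>\<mu>) = (\<Sum>x\<in>points \<mu> \<inter> K. f x)"
proof -
  have "(\<integral>x. f x \<partial>\<mu>) = (\<integral>x. f x \<partial>count_space (points \<mu>))"
    using integral_dirac_sum[OF points_subset assms(1)] by (simp add: dirac_sum_points)
  also have "\<dots> = (\<integral>x. f x * indicator K x \<partial>count_space (points \<mu>))"
    using points_subset K(2) by (intro Bochner_Integration.integral_cong) (auto simp: indicator_def)
  also have "\<dots> = (\<integral>x. f x \<partial>count_space (points \<mu> \<inter> K))"
  proof -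
    have "(\<integral>x. f x \<partial>count_space (points \<mu> \<inter> K)) =
        (\<integral>x. indicator (points \<mu> \<inter> K) x *\<^sub>R f x \<partial>count_space UNIV)"
      by (subst integral_restrict_space[symmetric]) (auto simp: restrict_count_space)
    also have "\<dots> = (\<integral>x. indicator (points \<mu>) x *\<^sub>R (f x * indicator K x) \<partial>count_space UNIV)"
      by (intro Bochner_Integration.integral_cong) (auto simp: indicator_def)
    also have "\<dots> = (\<integral>x. f x * indicator K x \<partial>count_space (points \<mu>))"
      by (subst integral_restrict_space[symmetric]) (auto simp: restrict_count_space)
    finally show ?thesis by simp
  qed
  also have "\<dots> = (\<Sum>x\<in>points \<mu> \<inter> K. f x)"
    using K(1) by (rule lebesgue_integral_count_space_finite)
  finally show ?thesis .
qed

end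

lemma space_config_space [simp]: "space (config_space E) = configs E"
  by (simp add: config_space_def space_measure_of_conv)

lemma topspace_vague_topology: "topspace (vague_topology E) = configs E"
proof -
  have "test_function E (\<lambda>x. 0)"
    by (auto simp: test_function_def intro!: exI[of _ "{}"])
  then have "configs E \<in> {{\<mu> \<in> configs E. (\<integral>x. f x \<partial>\<mu>) \<in> U} | f U. test_function E f \<and> open U}"
    by (intro CollectI exI[of _ "\<lambda>x. 0"] exI[of _ "UNIV :: real set"]) auto
  then show ?thesis
    unfolding vague_topology_def topology_generated_by_topspace by blast
qed

lemma sets_config_space: "sets (config_space E) = sigma_sets (configs E) {U. openin (vague_topology E) U}"
proof -
  have "{U. openin (vague_topology E) U} \<subseteq> Pow (configs E)"
    using openin_subset[of "vague_topology E"] topspace_vague_topology[of E] by auto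
  then show ?thesis
    by (simp add: config_space_def sets_measure_of)
qed

section \<open>Open regions: compact exhaustion and measurability of counts\<close>

locale open_region =
  fixes E :: "'a::euclidean_space set"
  assumes open_region: "open E"
begin

lemma E_borel [measurable]: "E \<in> sets borel"
  using open_region by simp

lemma sets_E_iff: "A \<in> sets (restrict_space borel E) \<longleftrightarrow> A \<in> sets borel \<and> A \<subseteq> E"
  by (subst sets_restrict_space_iff) auto

lemma exhaustion_ex:
  "\<exists>L :: nat \<Rightarrow> 'a set. (\<forall>n. compact (L n) \<and> L n \<subseteq> E) \<and> incseq L \<and> (\<Union>n. L n) = E \<and>
     (\<forall>K. compact K \<and> K \<subseteq> E \<longrightarrow> (\<exists>n. K \<subseteq> L n))"
proof -
  obtain C where C: "\<And>n. compact(C n)" "\<And>n. C n \<subseteq> E" "\<And>n. C n \<subseteq> interior(C(Suc n))"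
    "\<Union>(range C) = E" "\<And>K. \<lbrakk>compact K; K \<subseteq> E\<rbrakk> \<Longrightarrow> \<exists>N. \<forall>n\<ge>N. K \<subseteq> (C n)"
    using open_Union_compact_subsets[OF open_region] by metis
  have "incseq C"
    by (intro incseq_SucI subset_trans[OF C(3) interior_subset])
  moreover have "\<exists>n. K \<subseteq> C n" if "compact K" "K \<subseteq> E" for K
    using C(5)[OF that] by blast
  ultimately show ?thesis
    using C(1,2,4) by (intro exI[of _ C]) simp
qed

definition exhaustion :: "nat \<Rightarrow> 'a set" where
  "exhaustion = (SOME L. (\<forall>n. compact (L n) \<and> L n \<subseteq> E) \<and> incseq L \<and> (\<Union>n. L n) = E \<and>
     (\<forall>K. compact K \<and> K \<subseteq> E \<longrightarrow> (\<exists>n. K \<subseteq> L n)))"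

lemma
  shows compact_exhaustion: "compact (exhaustion n)"
    and exhaustion_subset: "exhaustion n \<subseteq> E"
    and incseq_exhaustion: "incseq exhaustion"
    and UN_exhaustion: "(\<Union>n. exhaustion n) = E"
    and exhaustion_covers: "compact K \<Longrightarrow> K \<subseteq> E \<Longrightarrow> \<exists>n. K \<subseteq> exhaustion n"
proof -
  note * = someI_ex[OF exhaustion_ex, folded exhaustion_def]
  show "compact (exhaustion n)" "exhaustion n \<subseteq> E" "incseq exhaustion" "(\<Union>n. exhaustion n) = E"
    using * by blast+
  show "compact K \<Longrightarrow> K \<subseteq> E \<Longrightarrow> \<exists>n. K \<subseteq> exhaustion n"
    using *[THEN conjunct2, THEN conjunct2, THEN conjunct2] by (elim allE[of _ K]) simp
qed

lemma exhaustion_borel [measurable]: "exhaustion n \<in> sets borel"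
  by (intro borel_closed compact_imp_closed compact_exhaustion)

lemma bounded_setsI_exhaustion: "C \<in> sets borel \<Longrightarrow> C \<subseteq> exhaustion n \<Longrightarrow> C \<in> bounded_sets E"
  unfolding bounded_sets_def using compact_exhaustion[of n] exhaustion_subset[of n] by auto

lemma bounded_sets_in_E: "C \<in> bounded_sets E \<Longrightarrow> C \<in> sets (restrict_space borel E)"
  by (auto simp: sets_E_iff bounded_sets_def)

lemma bounded_sets_borel: "C \<in> bounded_sets E \<Longrightarrow> C \<in> sets borel"
  by (auto simp: bounded_sets_def)

lemma bounded_sets_Un:
  assumes "C \<in> bounded_sets E" "D \<in> bounded_sets E" shows "C \<union> D \<in> bounded_sets E"
proof -
  obtain K L where "compact K" "C \<subseteq> K" "K \<subseteq> E" "compact L" "D \<subseteq> L" "L \<subseteq> E" "C \<in> sets borel" "D \<in> sets borel"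
    using assms by (auto simp: bounded_sets_def)
  then show ?thesis
    by (auto simp: bounded_sets_def intro!: exI[of _ "K \<union> L"])
qed

lemma bounded_sets_subset: "C \<in> bounded_sets E \<Longrightarrow> D \<subseteq> C \<Longrightarrow> D \<in> sets borel \<Longrightarrow> D \<in> bounded_sets E"
  unfolding bounded_sets_def by (auto intro: subset_trans)

lemma countable_points:
  assumes "\<mu> \<in> configs E" shows "countable (points \<mu>)"
proof -
  interpret configuration E \<mu> by unfold_locales fact
  have "points \<mu> = (\<Union>n. points \<mu> \<inter> exhaustion n)"
    using points_subset UN_exhaustion by auto
  moreover have "countable (points \<mu> \<inter> exhaustion n)" for n
    by (intro countable_finite finite_points_bounded bounded_setsI_exhaustion[of _ n]) auto
  ultimately show ?thesis
    by (metis countable_UN countableI_type)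
qed

lemma measurable_integral_test_function:
  assumes "test_function E f"
  shows "(\<lambda>\<mu>. \<integral>x. f x \<partial>\<mu>) \<in> borel_measurable (config_space E)"
proof (rule borel_measurableI)
  fix S :: "real set" assume "open S"
  have "{\<mu> \<in> configs E. (\<integral>x. f x \<partial>\<mu>) \<in> S}
      \<in> {{\<mu> \<in> configs E. (\<integral>x. f x \<partial>\<mu>) \<in> U} | f U. test_function E f \<and> open U}"
    using assms \<open>open S\<close> by blast
  then have "openin (vague_topology E) {\<mu> \<in> configs E. (\<integral>x. f x \<partial>\<mu>) \<in> S}"
    unfolding vague_topology_def openin_topology_generated_by_iff
    by (rule generate_topology_on.Basis)
  moreover have "(\<lambda>\<mu>. \<integral>x. f x \<partial>\<mu>) -` S \<inter> space (config_space E) = {\<mu> \<in> configs E. (\<integral>x. f x \<partial>\<mu>) \<in> S}"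
    by auto
  ultimately show "(\<lambda>\<mu>. \<integral>x. f x \<partial>\<mu>) -` S \<inter> space (config_space E) \<in> sets (config_space E)"
    unfolding sets_config_space by auto
qed

text \<open>The indicator of \<open>K\<close> is a pointwise limit of continuous functions of the
  distance to \<open>K\<close>, all supported in one compact neighbourhood \<open>L\<close>; on a
  configuration the limit passes through a finite sum over the points in \<open>L\<close>.\<close>

lemma measurable_card_compact:
  assumes K: "compact K" "K \<subseteq> E"
  shows "(\<lambda>\<mu>. real (card (points \<mu> \<inter> K))) \<in> borel_measurable (config_space E)"
\<comment> \<open>\<open>infdist\<close> to the empty set is 0 by convention, so the cut-off
  functions below would not vanish away from \<open>K\<close>.\<close>
proof (cases "K = {}")
  case False
  obtain e where e: "e > 0" "(\<Union>x\<in>K. ball x e) \<subseteq> E"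
    using compact_subset_open_imp_ball_epsilon_subset[OF K(1) open_region K(2)] by blast
  define L where "L = {x. infdist x K \<le> e / 2}"
  have L: "compact L" "L \<subseteq> E"
  proof -
    show "compact L"
      unfolding L_def using False K e by (intro compact_infdist_le) auto
    show "L \<subseteq> E"
    proof
      fix x assume "x \<in> L"
      moreover obtain y where "y \<in> K" "infdist x K = dist x y"
        using infdist_attains_inf[OF compact_imp_closed[OF K(1)] False] by blast
      ultimately have "x \<in> ball y e"
        using e by (auto simp: L_def dist_commute)
      then show "x \<in> E"
        using e \<open>y \<in> K\<close> by blast
    qed
  qed
  have "K \<subseteq> L"
    using e by (auto simp: L_def)
  \<comment> \<open>Equal to 1 on \<open>K\<close>; already the flattest one, \<open>j = 0\<close>,
    has dropped to 0 at distance \<open>e / 2\<close>, so that \<open>L\<close> serves for all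
    \<open>j\<close>.\<close>
  define f where "f j x = max 0 (1 - real (Suc j) * (infdist x K / (e / 2)))" for j x
  have f_cont: "continuous_on S (f j)" for j S
    unfolding f_def using e by (intro continuous_intros) auto
  have f_out: "f j x = 0" if "x \<notin> L" for j x
  proof -
    have "1 \<le> infdist x K / (e / 2)"
      using that e by (simp add: L_def field_simps)
    then have "1 * 1 \<le> real (Suc j) * (infdist x K / (e / 2))"
      by (intro mult_mono) auto
    then show ?thesis by (simp add: f_def)
  qed
  have f_test: "test_function E (f j)" for j
    unfolding test_function_def using f_cont f_out L by blast
  have f_meas: "f j \<in> borel_measurable (restrict_space borel E)" for j
    by (intro measurable_restrict_space1 borel_measurable_continuous_onI f_cont)
  have f_lim: "(\<lambda>j. f j x) \<longlonglongrightarrow> (if x \<in> K then 1 else 0)" for x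
  proof (cases "x \<in> K")
    case False
    have pos: "0 < infdist x K / (e / 2)"
      using infdist_pos_not_in_closed[of K x] False \<open>K \<noteq> {}\<close> e compact_imp_closed[OF K(1)] by simp
    obtain N :: nat where "1 < real N * (infdist x K / (e / 2))"
      using reals_Archimedean3[OF pos] by blast
    have "f j x = 0" if "j \<ge> N" for j
    proof -
      have "real N * (infdist x K / (e / 2)) \<le> real (Suc j) * (infdist x K / (e / 2))"
        using that pos by (intro mult_right_mono) auto
      with \<open>1 < _\<close> show ?thesis by (simp add: f_def)
    qed
    then have "\<forall>\<^sub>F j in sequentially. f j x = 0"
      using eventually_sequentially by blast
    with False show ?thesis by (simp add: tendsto_eventually)
  qed (simp add: f_def)
  have lim: "(\<lambda>j. \<integral>x. f j x \<partial>\<mu>) \<longlonglongrightarrow> real (card (points \<mu> \<inter> K))" if "\<mu> \<in> configs E" for \<mu>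
  proof -
    interpret configuration E \<mu> by unfold_locales fact
    have fin: "finite (points \<mu> \<inter> L)"
      using L locally_finite_points by (auto simp: locally_finite_def)
    have "(\<lambda>j. \<Sum>x\<in>points \<mu> \<inter> L. f j x) \<longlonglongrightarrow> (\<Sum>x\<in>points \<mu> \<inter> L. if x \<in> K then 1 else 0)"
      by (intro tendsto_sum f_lim)
    also have "(\<Sum>x\<in>points \<mu> \<inter> L. if x \<in> K then 1 else 0) = real (card (points \<mu> \<inter> K))"
    proof -
      have "points \<mu> \<inter> L \<inter> K = points \<mu> \<inter> K" using \<open>K \<subseteq> L\<close> by auto
      with fin show ?thesis by (simp add: sum.If_cases)
    qed
    finally show ?thesis
      by (subst integral_config[OF f_meas fin]) (auto simp: f_out)
  qed
  show ?thesis
    by (rule borel_measurable_LIMSEQ_real[OF _ measurable_integral_test_function[OF f_test]])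
       (use lim in auto)
qed simp

lemma emeasure_eq_card:
  assumes "\<mu> \<in> configs E" "C \<in> bounded_sets E"
  shows "emeasure \<mu> C = ennreal (real (card (points \<mu> \<inter> C)))"
proof -
  interpret configuration E \<mu> by unfold_locales fact
  show ?thesis
    using finite_points_bounded[OF assms(2)] bounded_sets_in_E[OF assms(2)]
    by (simp add: emeasure_config Int_commute ennreal_of_nat_eq_real_of_nat)
qed

text \<open>Dynkin's argument, started from closed sets. Intersecting with one member of the
  exhaustion keeps the counts finite, so that complements can be handled by subtraction.\<close>

lemma measurable_emeasure_config_bounded:
  assumes "A \<in> sets borel"
  shows "(\<lambda>\<mu>. emeasure \<mu> (A \<inter> exhaustion n)) \<in> borel_measurable (config_space E)"
proof -
  have bdd: "A \<inter> exhaustion n \<in> bounded_sets E" if "A \<in> sets borel" for A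
    using that by (intro bounded_setsI_exhaustion[of _ n]) auto
  have closed: "(\<lambda>\<mu>. emeasure \<mu> (A \<inter> exhaustion n)) \<in> borel_measurable (config_space E)" if "closed A" for A
  proof -
    have "compact (A \<inter> exhaustion n)" "A \<inter> exhaustion n \<subseteq> E"
      using that compact_exhaustion exhaustion_subset by (auto intro: closed_Int_compact)
    from measurable_card_compact[OF this] show ?thesis
      using that bdd[of A]
      by (subst measurable_cong[where g="\<lambda>\<mu>. ennreal (real (card (points \<mu> \<inter> (A \<inter> exhaustion n))))"])
         (auto simp: emeasure_eq_card)
  qed
  have sb: "sets borel = sigma_sets UNIV {A :: 'a set. closed A}"
    by (subst borel_eq_closed) (simp add: sets_measure_of)
  have "Int_stable {A :: 'a set. closed A}" "{A :: 'a set. closed A} \<subseteq> Pow UNIV" "A \<in> sigma_sets UNIV {A.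
      closed A}"
    using assms sb by (auto simp: Int_stable_def)
  then show ?thesis
  proof (induction rule: sigma_sets_induct_disjoint)
    case (compl A)
    have A: "A \<in> sets borel" using compl sb by simp
    have "(\<lambda>\<mu>. emeasure \<mu> (UNIV \<inter> exhaustion n) - emeasure \<mu> (A \<inter> exhaustion n))
        \<in> borel_measurable (config_space E)"
      using compl closed[of UNIV] by auto
    moreover have "emeasure \<mu> ((UNIV - A) \<inter> exhaustion n) =
        emeasure \<mu> (UNIV \<inter> exhaustion n) - emeasure \<mu> (A \<inter> exhaustion n)"
      if "\<mu> \<in> configs E" for \<mu>
    proof -
      interpret configuration E \<mu> by unfold_locales fact
      have "emeasure \<mu> ((UNIV \<inter> exhaustion n) - (A \<inter> exhaustion n)) =
          emeasure \<mu> (UNIV \<inter> exhaustion n) - emeasure \<mu> (A \<inter> exhaustion n)"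
        using A bdd[OF A] bdd[of UNIV] that
        by (intro emeasure_Diff) (auto simp: sets_config bounded_sets_in_E emeasure_eq_card)
      also have "(UNIV \<inter> exhaustion n) - (A \<inter> exhaustion n) = (UNIV - A) \<inter> exhaustion n" by auto
      finally show ?thesis .
    qed
    ultimately show ?case
      by (subst measurable_cong) auto
  next
    case (union A)
    then have A: "A i \<in> sets borel" for i using sb by auto
    have "emeasure \<mu> ((\<Union>i. A i) \<inter> exhaustion n) = (\<Sum>i. emeasure \<mu> (A i \<inter> exhaustion n))"
      if "\<mu> \<in> configs E" for \<mu>
    proof -
      interpret configuration E \<mu> by unfold_locales fact
      have "(\<Sum>i. emeasure \<mu> (A i \<inter> exhaustion n)) = emeasure \<mu> (\<Union>i. A i \<inter> exhaustion n)"
        using bdd[OF A] union(1)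
        by (intro suminf_emeasure) (auto simp: sets_config bounded_sets_in_E disjoint_family_on_def)
      then show ?thesis by simp
    qed
    with union(3) show ?case
      by (subst measurable_cong) auto
  qed (use closed in auto)
qed

lemma measurable_emeasure_config:
  assumes "A \<in> sets (restrict_space borel E)"
  shows "(\<lambda>\<mu>. emeasure \<mu> A) \<in> borel_measurable (config_space E)"
proof -
  have A: "A \<in> sets borel" "A \<subseteq> E" using assms by (auto simp: sets_E_iff)
  have "(\<lambda>\<mu>. SUP n. emeasure \<mu> (A \<inter> exhaustion n)) \<in> borel_measurable (config_space E)"
    using A by (intro borel_measurable_SUP measurable_emeasure_config_bounded) auto
  moreover have "(SUP n. emeasure \<mu> (A \<inter> exhaustion n)) = emeasure \<mu> A" if "\<mu> \<in> configs E" for \<mu>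
  proof -
    interpret configuration E \<mu> by unfold_locales fact
    have "(SUP n. emeasure \<mu> (A \<inter> exhaustion n)) = emeasure \<mu> (\<Union>n. A \<inter> exhaustion n)"
      using A incseq_exhaustion exhaustion_subset
      by (intro SUP_emeasure_incseq) (auto simp: sets_config sets_E_iff incseq_def)
    also have "(\<Union>n. A \<inter> exhaustion n) = A"
      using A UN_exhaustion by auto
    finally show ?thesis .
  qed
  ultimately show ?thesis
    by (subst measurable_cong[where g="\<lambda>\<mu>. SUP n. emeasure \<mu> (A \<inter> exhaustion n)"]) auto
qed

end

section \<open>The Borel sigma-field of the vague topology\<close>

context open_region begin

section \<open>The Borel sigma-field of the vague topology\<close>

definition void :: "'a set \<Rightarrow> 'a measure set" where
  "void C = {\<mu> \<in> configs E. points \<mu> \<inter> C = {}}"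

lemma void_in_sets_config_space:
  assumes C: "C \<in> bounded_sets E"
  shows "void C \<in> sets (config_space E)"
proof -
  have "void C = {\<mu> \<in> space (config_space E). emeasure \<mu> C = 0}"
  proof -
    have "points \<mu> \<inter> C = {} \<longleftrightarrow> emeasure \<mu> C = 0" if "\<mu> \<in> configs E" for \<mu>
    proof -
      interpret configuration E \<mu> by unfold_locales fact
      show ?thesis
        using finite_points_bounded[OF C] by (simp add: emeasure_eq_card[OF that C])
    qed
    then show ?thesis by (auto simp: void_def)
  qed
  then show ?thesis
    using measurable_sets[OF measurable_emeasure_config[OF bounded_sets_in_E[OF C]], of "{0}"]
    by (simp add: vimage_def Int_def conj_commute)
qed

lemma void_Int: "void C \<inter> void D = void (C \<union> D)"
  by (auto simp: void_def)

lemma Int_stable_voids: "Int_stable (void ` bounded_sets E)"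
  unfolding Int_stable_def by (auto simp: void_Int intro!: imageI bounded_sets_Un)

lemma voids_Pow: "void ` bounded_sets E \<subseteq> Pow (configs E)"
  by (auto simp: void_def)

text \<open>Induction over the generation of the topology from its subbase: an intersection unites
  the two finite families of test functions and keeps the smaller radius.\<close>

lemma vague_neighbourhood:
  assumes "openin (vague_topology E) W" "\<mu>\<^sub>0 \<in> W"
  shows "\<exists>F \<epsilon>. finite F \<and> (\<forall>f\<in>F. test_function E f) \<and> 0 < \<epsilon> \<and>
    {\<mu> \<in> configs E. \<forall>f\<in>F. \<bar>(\<integral>x. f x \<partial>\<mu>) - (\<integral>x. f x \<partial>\<mu>\<^sub>0)\<bar> < \<epsilon>} \<subseteq> W"
  using assms unfolding vague_topology_def openin_topology_generated_by_iff
proof (induction arbitrary: \<mu>\<^sub>0 rule: generate_topology_on.induct)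
  case (Int a b)
  obtain F \<epsilon> where 1: "finite F" "\<forall>f\<in>F. test_function E f" "0 < \<epsilon>"
    "{\<mu> \<in> configs E. \<forall>f\<in>F. \<bar>(\<integral>x. f x \<partial>\<mu>) - (\<integral>x. f x \<partial>\<mu>\<^sub>0)\<bar> < \<epsilon>} \<subseteq> a"
    using Int.IH(1)[of \<mu>\<^sub>0] Int.prems by auto
  obtain G \<delta> where 2: "finite G" "\<forall>f\<in>G. test_function E f" "0 < \<delta>"
    "{\<mu> \<in> configs E. \<forall>f\<in>G. \<bar>(\<integral>x. f x \<partial>\<mu>) - (\<integral>x. f x \<partial>\<mu>\<^sub>0)\<bar> < \<delta>} \<subseteq> b"
    using Int.IH(2)[of \<mu>\<^sub>0] Int.prems by auto
  from 1 2 show ?case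
    by (intro exI[of _ "F \<union> G"] exI[of _ "min \<epsilon> \<delta>"]) (auto simp: subset_eq)
next
  case (UN K)
  then obtain k where "k \<in> K" "\<mu>\<^sub>0 \<in> k" by auto
  with UN.IH[of k \<mu>\<^sub>0] show ?case by blast
next
  case (Basis s)
  then obtain f U where fU: "s = {\<mu> \<in> configs E. (\<integral>x. f x \<partial>\<mu>) \<in> U}" "test_function E f" "open U"
    by auto
  with Basis.prems obtain e where "e > 0" "ball (\<integral>x. f x \<partial>\<mu>\<^sub>0) e \<subseteq> U"
    by (auto simp: open_contains_ball)
  with fU show ?case
    by (intro exI[of _ "{f}"] exI[of _ e]) (auto simp: dist_real_def subset_eq abs_minus_commute)
qed auto

section \<open>Cells around the points of a configuration\<close>

lemma test_function_measurable:
  assumes "test_function E f" shows "f \<in> borel_measurable (restrict_space borel E)"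
  using assms by (auto simp: test_function_def intro: borel_measurable_continuous_on_restrict)

text \<open>Two configurations that occupy the same cells once each thereby get integrals indexed by
  the same set \<open>P\<close>, so that they can be compared term by term.\<close>

lemma integral_one_point_cells:
  assumes "\<mu> \<in> configs E" "test_function E f" "L \<in> bounded_sets E" "\<And>x. x \<in> E - L \<Longrightarrow> f x = 0"
    and P: "finite P" "disjoint_family_on b P" "\<And>p. p \<in> P \<Longrightarrow> points \<mu> \<inter> b p = {x p}"
    "points \<mu> \<inter> (L - (\<Union>p\<in>P. b p)) = {}"
  shows "(\<integral>u. f u \<partial>\<mu>) = (\<Sum>p\<in>P. f (x p))"
proof -
  interpret configuration E \<mu> by unfold_locales fact
  \<comment> \<open>Cells may leave \<open>L\<close>, but \<open>f\<close> vanishes there; including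
    them makes the points in \<open>K\<close> exactly the chosen ones.\<close>
  define K where "K = L \<union> (\<Union>p\<in>P. b p)"
  have K: "points \<mu> \<inter> K = x ` P"
  proof -
    have "points \<mu> \<inter> K = points \<mu> \<inter> (\<Union>p\<in>P. b p)"
      using P(4) by (auto simp: K_def)
    also have "\<dots> = (\<Union>p\<in>P. points \<mu> \<inter> b p)" by blast
    also have "\<dots> = x ` P" using P(3) by auto
    finally show ?thesis .
  qed
  have "inj_on x P"
  proof (rule inj_onI)
    fix p q assume "p \<in> P" "q \<in> P" "x p = x q"
    moreover from this have "x p \<in> b p \<inter> b q"
      using P(3)[of p] P(3)[of q] by blast
    ultimately show "p = q"
      using P(2) by (auto simp: disjoint_family_on_def)
  qed
  have "(\<integral>u. f u \<partial>\<mu>) = (\<Sum>u\<in>points \<mu> \<inter> K. f u)"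
    using assms(4) P(1) K
    by (intro integral_config test_function_measurable[OF assms(2)]) (auto simp: K_def)
  also have "\<dots> = (\<Sum>p\<in>P. f (x p))"
    unfolding K using \<open>inj_on x P\<close> by (simp add: sum.reindex)
  finally show ?thesis .
qed

text \<open>Discarding the base sets that lie in no member of the exhaustion keeps a base of the
  region, because every point has a closed ball inside it, and makes every cell a bounded set, whose
  void event is then available.\<close>

definition cells :: "'a set set" where
  "cells = {b \<in> (SOME B. countable B \<and> topological_basis B). \<exists>n. b \<subseteq> exhaustion n}"

lemma countable_cells: "countable cells"
  and open_cells: "b \<in> cells \<Longrightarrow> open b"
  and cells_bounded: "b \<in> cells \<Longrightarrow> b \<in> bounded_sets E"
  and cells_basis: "open U \<Longrightarrow> p \<in> U \<Longrightarrow> U \<subseteq> E \<Longrightarrow> \<exists>b\<in>cells. p \<in> b \<and> b \<subseteq> U"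
proof -
  define B :: "'a set set" where "B = (SOME B. countable B \<and> topological_basis B)"
  have B: "countable B" "topological_basis B"
    unfolding B_def using someI_ex[OF ex_countable_basis] by blast+
  have cells: "cells = {b \<in> B. \<exists>n. b \<subseteq> exhaustion n}"
    by (simp add: cells_def B_def)
  show "countable cells"
    unfolding cells using B(1) by simp
  show op: "open b" if "b \<in> cells" for b
    using that B(2) topological_basis_open unfolding cells by blast
  show "b \<in> bounded_sets E" if "b \<in> cells"
    using that op[OF that] bounded_setsI_exhaustion unfolding cells by auto
  show "\<exists>b\<in>cells. p \<in> b \<and> b \<subseteq> U" if U: "open U" "p \<in> U" "U \<subseteq> E"
  proof -
    obtain r where r: "r > 0" "cball p r \<subseteq> U"
      using U(1,2) open_contains_cball by blast
    obtain n where n: "cball p r \<subseteq> exhaustion n"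
      using exhaustion_covers[of "cball p r"] r U(3) by auto
    obtain b where "b \<in> B" "p \<in> b" "b \<subseteq> ball p r"
      using topological_basisE[OF B(2), of "ball p r" p] r by auto
    moreover from this have "b \<subseteq> exhaustion n" "b \<subseteq> U"
      using n r ball_subset_cball[of p r] by blast+
    ultimately show ?thesis
      unfolding cells by (intro bexI[of _ b]) auto
  qed
qed

abbreviation (input) void_algebra :: "'a measure set set" where
  "void_algebra \<equiv> sigma_sets (configs E) (void ` bounded_sets E)"

lemma sigma_algebra_voids: "sigma_algebra (configs E) void_algebra"
  using voids_Pow by (rule sigma_algebra_sigma_sets)

text \<open>
  In a second countable Hausdorff space, \<open>b\<close> contains two points of a configuration iff two disjoint
  members of \<open>cells\<close> both meet the configuration inside \<open>b\<close>.
\<close>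

lemma unique_point_in_void_algebra:
  assumes b: "b \<in> bounded_sets E"
  shows "{\<mu> \<in> configs E. \<exists>x. points \<mu> \<inter> b = {x}} \<in> void_algebra"
proof -
  interpret sigma_algebra "configs E" void_algebra by (rule sigma_algebra_voids)
  have v: "void C \<in> void_algebra" if "C \<in> bounded_sets E" for C
    using that by auto
  define J where "J = {(b', b''). b' \<in> cells \<and> b'' \<in> cells \<and> b' \<inter> b'' = {}}"
  have "countable J"
    by (rule countable_subset[OF _ countable_SIGMA[OF countable_cells countable_cells]]) (auto simp: J_def)
  define T where "T = (\<Union>(b', b'')\<in>J. (configs E - void (b \<inter> b')) \<inter> (configs E - void (b \<inter> b'')))"
  have bb: "b \<inter> b' \<in> bounded_sets E" if "b' \<in> cells" for b'
    using that b open_cells by (intro bounded_sets_subset[OF b]) (auto simp: bounded_sets_borel)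
  have "T \<in> void_algebra"
    unfolding T_def using \<open>countable J\<close> by (intro countable_UN'') (auto simp: J_def intro!: v bb)
  then have "(configs E - void b) - T \<in> void_algebra"
    using v[OF b] by auto
  also have "(configs E - void b) - T = {\<mu> \<in> configs E. \<exists>x. points \<mu> \<inter> b = {x}}" (is "?l = ?r")
  proof (intro equalityI subsetI)
    fix \<mu> assume "\<mu> \<in> ?l"
    then have \<mu>: "\<mu> \<in> configs E" "points \<mu> \<inter> b \<noteq> {}" "\<mu> \<notin> T" by (auto simp: void_def)
    interpret configuration E \<mu> by unfold_locales fact
    obtain x where x: "x \<in> points \<mu> \<inter> b" using \<mu> by auto
    have "y = x" if y: "y \<in> points \<mu> \<inter> b" for y
    proof (rule ccontr)
      assume "y \<noteq> x"
      then obtain U V where UV: "open U" "open V" "x \<in> U" "y \<in> V" "U \<inter> V = {}"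
        using hausdorff[of x y] by metis
      obtain b' where b': "b' \<in> cells" "x \<in> b'" "b' \<subseteq> U \<inter> E"
        using cells_basis[of "U \<inter> E" x] UV x points_subset open_region by auto
      obtain b'' where b'': "b'' \<in> cells" "y \<in> b''" "b'' \<subseteq> V \<inter> E"
        using cells_basis[of "V \<inter> E" y] UV y points_subset open_region by auto
      have "(b', b'') \<in> J" using b' b'' UV(5) by (auto simp: J_def)
      moreover have "\<mu> \<in> (configs E - void (b \<inter> b')) \<inter> (configs E - void (b \<inter> b''))"
        using \<mu> x y b' b'' by (auto simp: void_def)
      ultimately show False using \<mu>(3) by (auto simp: T_def)
    qed
    then have "points \<mu> \<inter> b = {x}" using x by blast
    then show "\<mu> \<in> ?r" using \<mu> by auto
  next
    fix \<mu> assume "\<mu> \<in> ?r"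
    then obtain x where x: "\<mu> \<in> configs E" "points \<mu> \<inter> b = {x}" by auto
    have "\<mu> \<notin> T"
    proof
      assume "\<mu> \<in> T"
      then obtain b' b'' where *: "b' \<inter> b'' = {}" "points \<mu> \<inter> (b \<inter> b') \<noteq> {}" "points \<mu> \<inter> (b \<inter> b'') \<noteq> {}"
        using x(1) by (auto simp: T_def J_def void_def)
      then obtain u v where "u \<in> points \<mu> \<inter> b" "u \<in> b'" "v \<in> points \<mu> \<inter> b" "v \<in> b''" by auto
      with x(2) *(1) show False by auto
    qed
    with x show "\<mu> \<in> ?l" by (auto simp: void_def)
  qed
  finally show ?thesis .
qed

text \<open>
  The events \<open>cyl n F\<close>, that every cell in the finite set \<open>F\<close> holds exactly one point and the rest of
  \<open>exhaustion n\<close> none, are countable in number, and every vague neighbourhood of a configuration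
  contains one of them: shrink the cells around its points until the test functions barely vary.
\<close>

lemma vague_open_in_void_algebra:
  assumes W: "openin (vague_topology E) W"
  shows "W \<in> void_algebra"
proof -
  interpret sigma_algebra "configs E" void_algebra by (rule sigma_algebra_voids)
  define cyl where "cyl n F = {\<mu> \<in> configs E. \<forall>b\<in>F. \<exists>x. points \<mu> \<inter> b = {x}} \<inter> void (exhaustion n - \<Union>F)"
    for n :: nat and F :: "'a set set"
  have cyl: "cyl n F \<in> void_algebra" if "finite F" "F \<subseteq> cells" for n F
  proof -
    have "{\<mu> \<in> configs E. \<forall>b\<in>F. \<exists>x. points \<mu> \<inter> b = {x}} \<in> void_algebra"
      using that cells_bounded by (intro sets_Collect_finite_All' sets_Collect_finite_All
          unique_point_in_void_algebra) auto
    moreover have "exhaustion n - \<Union>F \<in> bounded_sets E"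
      using that open_cells by (intro bounded_setsI_exhaustion[of _ n] sets.Diff) (auto intro!: borel_open)
    ultimately show ?thesis
      unfolding cyl_def by auto
  qed
  define J where "J = {(n, F). finite F \<and> F \<subseteq> cells \<and> cyl n F \<subseteq> W}"
  have "countable J"
    by (rule countable_subset[OF _ countable_SIGMA[OF countableI_type[of UNIV]
        countable_Collect_finite_subset[OF countable_cells]]])
       (auto simp: J_def)
  have "W = (\<Union>(n, F)\<in>J. cyl n F)"
  proof (intro equalityI subsetI)
    fix \<mu>\<^sub>0 assume "\<mu>\<^sub>0 \<in> W"
    have "\<mu>\<^sub>0 \<in> configs E"
      using openin_subset[OF W] \<open>\<mu>\<^sub>0 \<in> W\<close> by (auto simp: topspace_vague_topology)
    then interpret configuration E \<mu>\<^sub>0 by unfold_locales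
    obtain Fs \<epsilon> where Fs: "finite Fs" "\<And>f. f \<in> Fs \<Longrightarrow> test_function E f" "0 < \<epsilon>"
      and sub: "{\<mu> \<in> configs E. \<forall>f\<in>Fs. \<bar>(\<integral>x. f x \<partial>\<mu>) - (\<integral>x. f x \<partial>\<mu>\<^sub>0)\<bar> < \<epsilon>} \<subseteq> W"
      using vague_neighbourhood[OF W \<open>\<mu>\<^sub>0 \<in> W\<close>] by auto
    have "\<exists>n. \<forall>f\<in>Fs. \<forall>x\<in>E - exhaustion n. f x = 0"
    proof -
      have "\<exists>n. \<forall>x\<in>E - exhaustion n. f x = 0" if "f \<in> Fs" for f
      proof -
        from Fs(2)[OF that] obtain K where "compact K" "K \<subseteq> E" "\<forall>x\<in>E - K. f x = 0"
          by (auto simp: test_function_def)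
        then obtain n where "K \<subseteq> exhaustion n" using exhaustion_covers[of K] by auto
        with \<open>\<forall>x\<in>E - K. f x = 0\<close> show ?thesis by (intro exI[of _ n]) auto
      qed
      then obtain N where N: "\<And>f x. f \<in> Fs \<Longrightarrow> x \<in> E - exhaustion (N f) \<Longrightarrow> f x = 0"
        by metis
      have "exhaustion (N f) \<subseteq> exhaustion (Max (N ` Fs))" if "f \<in> Fs" for f
        using incseq_exhaustion that Fs(1) by (auto simp: incseq_def)
      with N show ?thesis by blast
    qed
    then obtain n where n: "\<And>f x. f \<in> Fs \<Longrightarrow> x \<in> E - exhaustion n \<Longrightarrow> f x = 0" by blast
    define P where "P = points \<mu>\<^sub>0 \<inter> exhaustion n"
    have "finite P"
      unfolding P_def by (intro finite_points_bounded bounded_setsI_exhaustion[of _ n]) auto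
    \<comment> \<open>The added 1 keeps the total deviation \<open>card P * \<eta>\<close> strictly
      below \<epsilon> and covers the case of no points.\<close>
    define \<eta> where "\<eta> = \<epsilon> / (real (card P) + 1)"
    have "\<eta> > 0" using Fs(3) by (simp add: \<eta>_def)
    \<comment> \<open>The factor 2 makes balls around distinct points disjoint. The distance is
      controlled to all points of the configuration, also to those outside
      \<open>exhaustion n\<close>, since a cell may reach beyond it.\<close>
    have "\<exists>d>0. ball p d \<subseteq> E \<and> (\<forall>x\<in>ball p d. \<forall>f\<in>Fs. \<bar>f x - f p\<bar> < \<eta>) \<and> (\<forall>q\<in>points \<mu>\<^sub>0. q \<noteq> p \<longrightarrow> 2 * d \<le>
        dist p q)"
      if "p \<in> P" for p
    proof -
      have pE: "p \<in> E" using that points_subset by (auto simp: P_def)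
      obtain r where r: "r > 0" "cball p r \<subseteq> E"
        using open_region pE open_contains_cball by blast
      have "finite (points \<mu>\<^sub>0 \<inter> cball p r)"
        using r locally_finite_points by (auto simp: locally_finite_def)
      from finite_set_avoid[OF this, of p] obtain d1 where
        d1: "d1 > 0" "\<forall>x\<in>points \<mu>\<^sub>0 \<inter> cball p r. x \<noteq> p \<longrightarrow> d1 \<le> dist p x" by auto
      have "\<forall>f\<in>Fs. \<forall>\<^sub>F x in nhds p. \<bar>f x - f p\<bar> < \<eta>"
      proof
        fix f assume "f \<in> Fs"
        then have "isCont f p"
          using Fs(2) open_region pE by (auto simp: test_function_def continuous_on_eq_continuous_at)
        then have "(f \<longlongrightarrow> f p) (nhds p)"
          by (simp add: isCont_def tendsto_at_iff_tendsto_nhds)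
        from tendstoD[OF this \<open>\<eta> > 0\<close>] show "\<forall>\<^sub>F x in nhds p. \<bar>f x - f p\<bar> < \<eta>"
          by (simp add: dist_real_def)
      qed
      then have "\<forall>\<^sub>F x in nhds p. \<forall>f\<in>Fs. \<bar>f x - f p\<bar> < \<eta>"
        using Fs(1) by (simp add: eventually_ball_finite)
      then obtain d2 where d2: "d2 > 0" "\<And>x. dist x p < d2 \<Longrightarrow> \<forall>f\<in>Fs. \<bar>f x - f p\<bar> < \<eta>"
        by (auto simp: eventually_nhds_metric)
      define d where "d = min (min r d1 / 2) d2"
      have d: "d > 0" "d \<le> r / 2" "d \<le> d1 / 2" "d \<le> d2" using r d1 d2 by (auto simp: d_def)
      show ?thesis
      proof (intro exI[of _ d] conjI ballI impI)
        show "ball p d \<subseteq> E" using r d by (auto simp: subset_eq)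
        fix x f assume "x \<in> ball p d" "f \<in> Fs"
        then show "\<bar>f x - f p\<bar> < \<eta>" using d2(2)[of x] d by (auto simp: dist_commute)
      next
        \<comment> \<open>Points within distance \<open>r\<close> are governed by \<open>d1\<close>,
          the others by \<open>d \<le> r / 2\<close>.\<close>
        fix q assume "q \<in> points \<mu>\<^sub>0" "q \<noteq> p"
        then show "2 * d \<le> dist p q"
          using d d1(2) by (cases "dist p q \<le> r") auto
      qed (use d in auto)
    qed
    then have "\<forall>p\<in>P. \<exists>d. d > 0 \<and> ball p d \<subseteq> E \<and> (\<forall>x\<in>ball p d. \<forall>f\<in>Fs. \<bar>f x - f p\<bar> < \<eta>) \<and>
        (\<forall>q\<in>points \<mu>\<^sub>0. q \<noteq> p \<longrightarrow> 2 * d \<le> dist p q)" ..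
    from bchoice[OF this] obtain d where
      dd: "\<forall>p\<in>P. d p > 0 \<and> ball p (d p) \<subseteq> E \<and> (\<forall>x\<in>ball p (d p). \<forall>f\<in>Fs. \<bar>f x - f p\<bar> < \<eta>) \<and>
        (\<forall>q\<in>points \<mu>\<^sub>0. q \<noteq> p \<longrightarrow> 2 * d p \<le> dist p q)" ..
    have d: "d p > 0" "ball p (d p) \<subseteq> E"
      "\<And>x f. x \<in> ball p (d p) \<Longrightarrow> f \<in> Fs \<Longrightarrow> \<bar>f x - f p\<bar> < \<eta>"
      "\<And>q. q \<in> points \<mu>\<^sub>0 \<Longrightarrow> q \<noteq> p \<Longrightarrow> 2 * d p \<le> dist p q" if "p \<in> P" for p
      using dd[rule_format, OF that] by simp_all
    have "\<exists>b\<in>cells. p \<in> b \<and> b \<subseteq> ball p (d p)" if "p \<in> P" for p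
      using cells_basis[of "ball p (d p)" p] d(1,2)[OF that] by auto
    then obtain b where b: "\<And>p. p \<in> P \<Longrightarrow> b p \<in> cells" "\<And>p. p \<in> P \<Longrightarrow> p \<in> b p"
      "\<And>p. p \<in> P \<Longrightarrow> b p \<subseteq> ball p (d p)" by metis
    have disj: "disjoint_family_on b P"
      unfolding disjoint_family_on_def
    proof (intro ballI impI equals0I)
      fix p q u assume "p \<in> P" "q \<in> P" "p \<noteq> q" "u \<in> b p \<inter> b q"
      then have "dist p u < d p" "dist q u < d q" "2 * d p \<le> dist p q" "2 * d q \<le> dist p q"
        using b(3)[of p] b(3)[of q] d(4)[of p q] d(4)[of q p] by (auto simp: P_def dist_commute)
      then show False using dist_triangle[of p q u] by (simp add: dist_commute)
    qed
    have pts: "points \<mu>\<^sub>0 \<inter> b p = {p}" if "p \<in> P" for p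
    proof -
      have "q = p" if "q \<in> points \<mu>\<^sub>0 \<inter> b p" for q
        using d(1)[OF \<open>p \<in> P\<close>] d(4)[OF \<open>p \<in> P\<close>, of q] b(3)[OF \<open>p \<in> P\<close>] that by force
      then show ?thesis using b(2)[OF that] that by (auto simp: P_def)
    qed
    have mem: "\<mu>\<^sub>0 \<in> cyl n (b ` P)"
      using \<open>\<mu>\<^sub>0 \<in> configs E\<close> pts b(2) by (auto simp: cyl_def void_def P_def)
    have "cyl n (b ` P) \<subseteq> W"
    proof (rule subset_trans[OF _ sub], rule subsetI, rule CollectI, intro conjI ballI)
      fix \<mu> assume \<mu>: "\<mu> \<in> cyl n (b ` P)"
      then show \<mu>E: "\<mu> \<in> configs E" by (auto simp: cyl_def)
      fix f assume f: "f \<in> Fs"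
      from \<mu> have "\<forall>p\<in>P. \<exists>x. points \<mu> \<inter> b p = {x}" by (simp add: cyl_def)
      from bchoice[OF this] obtain x where "\<forall>p\<in>P. points \<mu> \<inter> b p = {x p}" ..
      then have x: "\<And>p. p \<in> P \<Longrightarrow> points \<mu> \<inter> b p = {x p}" by simp
      have L: "exhaustion n \<in> bounded_sets E" by (intro bounded_setsI_exhaustion[of _ n]) auto
      have "(\<integral>u. f u \<partial>\<mu>) = (\<Sum>p\<in>P. f (x p))"
        using \<mu> by (intro integral_one_point_cells[OF \<mu>E Fs(2)[OF f] L n[OF f] \<open>finite P\<close> disj x])
          (auto simp: cyl_def void_def)
      moreover have "(\<integral>u. f u \<partial>\<mu>\<^sub>0) = (\<Sum>p\<in>P. f p)"
        using mem by (intro integral_one_point_cells[OF \<open>\<mu>\<^sub>0 \<in> configs E\<close> Fs(2)[OF f] L n[OF f] \<open>finite P\<close>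
            disj pts])
          (auto simp: cyl_def void_def)
      ultimately have "\<bar>(\<integral>u. f u \<partial>\<mu>) - (\<integral>u. f u \<partial>\<mu>\<^sub>0)\<bar> = \<bar>\<Sum>p\<in>P. f (x p) - f p\<bar>"
        by (simp add: sum_subtractf)
      also have "\<dots> \<le> (\<Sum>p\<in>P. \<bar>f (x p) - f p\<bar>)" by (rule sum_abs)
      also have "\<dots> \<le> (\<Sum>p\<in>P. \<eta>)"
      proof (rule sum_mono)
        fix p assume "p \<in> P"
        then have "x p \<in> ball p (d p)" using x[of p] b(3)[of p] by blast
        from d(3)[OF \<open>p \<in> P\<close> this f] show "\<bar>f (x p) - f p\<bar> \<le> \<eta>" by simp
      qed
      also have "\<dots> < \<epsilon>" using Fs(3) by (simp add: \<eta>_def field_simps)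
      finally show "\<bar>(\<integral>u. f u \<partial>\<mu>) - (\<integral>u. f u \<partial>\<mu>\<^sub>0)\<bar> < \<epsilon>" .
    qed
    then have "(n, b ` P) \<in> J" using b(1) \<open>finite P\<close> by (auto simp: J_def)
    with mem show "\<mu>\<^sub>0 \<in> (\<Union>(n, F)\<in>J. cyl n F)" by blast
  qed (auto simp: J_def)
  also have "\<dots> \<in> void_algebra"
    using \<open>countable J\<close> by (intro countable_UN'') (auto simp: J_def intro: cyl)
  finally show ?thesis .
qed

text \<open>Void events are stable under intersection, so they are fit for the uniqueness theorem
  for measures; from here on the topology itself no longer occurs.\<close>

theorem sets_config_space_voids: "sets (config_space E) = sigma_sets (configs E) (void ` bounded_sets E)"
proof
  interpret sigma_algebra "configs E" void_algebra by (rule sigma_algebra_voids)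
  show "sets (config_space E) \<subseteq> void_algebra"
    unfolding sets_config_space by (intro sigma_sets_subset) (auto intro: vague_open_in_void_algebra)
  have "void ` bounded_sets E \<subseteq> sets (config_space E)"
    using void_in_sets_config_space by auto
  from sets.sigma_sets_subset[OF this] show "void_algebra \<subseteq> sets (config_space E)"
    by simp
qed

section \<open>Measurability and equality of measures tested on void events\<close>

lemma measurable_config_spaceI:
  assumes "\<And>s. s \<in> space S \<Longrightarrow> \<Phi> s \<in> configs E"
    and "\<And>C. C \<in> bounded_sets E \<Longrightarrow> {s \<in> space S. points (\<Phi> s) \<inter> C = {}} \<in> sets S"
  shows "\<Phi> \<in> S \<rightarrow>\<^sub>M config_space E"
proof (rule measurable_sigma_sets[OF sets_config_space_voids voids_Pow])
  fix A assume "A \<in> void ` bounded_sets E"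
  then obtain C where C: "C \<in> bounded_sets E" "A = void C" by auto
  have "\<Phi> -` A \<inter> space S = {s \<in> space S. points (\<Phi> s) \<inter> C = {}}"
    using assms(1) C by (auto simp: void_def)
  then show "\<Phi> -` A \<inter> space S \<in> sets S" using assms(2)[OF C(1)] by simp
qed (use assms(1) in auto)

lemma config_measure_eqI:
  assumes "finite_measure M" "sets M = sets (config_space E)" "sets N = sets (config_space E)"
    and eq: "\<And>C. C \<in> bounded_sets E \<Longrightarrow> emeasure M (void C) = emeasure N (void C)"
  shows "M = N"
proof (rule measure_eqI_generator_eq[OF Int_stable_voids voids_Pow])
  interpret finite_measure M by fact
  \<comment> \<open>\<open>void {}\<close> is the whole space, so a constant sequence exhausts
    it.\<close>
  show "range (\<lambda>i::nat. void {}) \<subseteq> void ` bounded_sets E"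
    by (auto simp: bounded_sets_def intro!: imageI exI[of _ "{}"])
  show "(\<Union>i::nat. void {}) = configs E" by (auto simp: void_def)
  show "emeasure M (void {}) \<noteq> \<infinity>" by simp
qed (use assms sets_config_space_voids in auto)

end

section \<open>Sums over tuples of distinct points\<close>

text \<open>Extensional functions, like the elements of the product spaces over
  \<open>{..<k}\<close>, so that the same function of a tuple can be summed here and integrated
  there.\<close>

definition tuples :: "nat \<Rightarrow> 'a set \<Rightarrow> (nat \<Rightarrow> 'a) set" where
  "tuples k D = {x \<in> {..<k} \<rightarrow>\<^sub>E D. inj_on x {..<k}}"

definition tuple_sum :: "nat \<Rightarrow> ((nat \<Rightarrow> 'a) \<Rightarrow> ennreal) \<Rightarrow> 'a set \<Rightarrow> ennreal" where
  "tuple_sum k f D = (\<integral>\<^sup>+x. f x \<partial>count_space (tuples k D))"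

lemma tuple_sum_cong: "(\<And>x. x \<in> tuples k D \<Longrightarrow> f x = g x) \<Longrightarrow> tuple_sum k f D = tuple_sum k g D"
  unfolding tuple_sum_def by (intro nn_integral_cong) simp

lemma tuple_sum_0: "tuple_sum 0 f D = f (\<lambda>_. undefined)"
proof -
  have "tuples 0 D = {\<lambda>_. undefined}" by (auto simp: tuples_def)
  then show ?thesis by (simp add: tuple_sum_def nn_integral_count_space_finite)
qed

lemma nn_integral_count_space_inter:
  "(\<integral>\<^sup>+x. f x \<partial>count_space (A \<inter> B)) = (\<integral>\<^sup>+x. f x * indicator B x \<partial>count_space A)"
proof -
  have "(\<integral>\<^sup>+x. f x \<partial>count_space (A \<inter> B)) = (\<integral>\<^sup>+x. f x * indicator (A \<inter> B) x \<partial>count_space UNIV)"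
    by (rule nn_integral_count_space_indicator) simp
  also have "\<dots> = (\<integral>\<^sup>+x. f x * indicator B x * indicator A x \<partial>count_space UNIV)"
    by (intro nn_integral_cong) (auto simp: indicator_def)
  also have "\<dots> = (\<integral>\<^sup>+x. f x * indicator B x \<partial>count_space A)"
    by (rule nn_integral_count_space_indicator[symmetric]) simp
  finally show ?thesis .
qed

lemma nn_integral_count_space_Sigma:
  "(\<integral>\<^sup>+u. \<integral>\<^sup>+x. f (u, x) \<partial>count_space (B u) \<partial>count_space A) = (\<integral>\<^sup>+p. f p \<partial>count_space (Sigma A B))"
proof -
  have "(\<integral>\<^sup>+u. \<integral>\<^sup>+x. f (u, x) \<partial>count_space (B u) \<partial>count_space A) =
    (\<integral>\<^sup>+u. (\<integral>\<^sup>+x. f (u, x) * indicator (B u) x \<partial>count_space UNIV) * indicator A u \<partial>count_space UNIV)"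
    by (simp add: nn_integral_count_space_indicator)
  also have "\<dots> = (\<integral>\<^sup>+u. \<integral>\<^sup>+x. (\<lambda>p. f p * indicator (Sigma A B) p) (u, x) \<partial>count_space UNIV
      \<partial>count_space UNIV)"
    by (intro nn_integral_cong) (auto simp: indicator_def nn_integral_multc[symmetric] intro!:
        nn_integral_cong)
  also have "\<dots> = (\<integral>\<^sup>+p. f p * indicator (Sigma A B) p \<partial>count_space UNIV)"
    by (rule nn_integral_fst_count_space)
  finally show ?thesis
    by (simp add: nn_integral_count_space_indicator)
qed

text \<open>The point in the last slot is chosen first and the others come from what remains. This
  is the form that meets the reduced Palm sum, where exactly that point is removed.\<close>

lemma tuple_sum_Suc:
  "tuple_sum (Suc k) f D = (\<integral>\<^sup>+u. tuple_sum k (\<lambda>x. f (x(k := u))) (D - {u}) \<partial>count_space D)"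
proof -
  have "bij_betw (\<lambda>(u, x). x(k := u)) (Sigma D (\<lambda>u. tuples k (D - {u}))) (tuples (Suc k) D)"
  proof (rule bij_betwI[where g="\<lambda>x. (x k, restrict x {..<k})"])
    show "(\<lambda>(u, x). x(k := u)) \<in> Sigma D (\<lambda>u. tuples k (D - {u})) \<rightarrow> tuples (Suc k) D"
      by (auto simp: tuples_def PiE_iff inj_on_def extensional_def less_Suc_eq) (metis lessThan_iff)
    show "(\<lambda>x. (x k, restrict x {..<k})) \<in> tuples (Suc k) D \<rightarrow> Sigma D (\<lambda>u. tuples k (D - {u}))"
      by (force simp: tuples_def PiE_iff inj_on_def)
  qed (auto simp: tuples_def PiE_iff extensional_def fun_eq_iff)
  from nn_integral_bij_count_space[OF this, of f] show ?thesis
    by (simp add: tuple_sum_def nn_integral_count_space_Sigma[symmetric, where A=D] split_beta)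
qed

text \<open>
  Summing over the last coordinate innermost; in this form the induction that proves measurability
  in a parameter keeps the type of the parameter fixed.
\<close>

lemma tuple_sum_Suc':
  "tuple_sum (Suc k) f D =
    tuple_sum k (\<lambda>x. \<integral>\<^sup>+u. f (x(k := u)) * indicator {u. \<forall>i<k. x i \<noteq> u} u \<partial>count_space D) D"
proof -
  have "bij_betw (\<lambda>(x, u). x(k := u)) (Sigma (tuples k D) (\<lambda>x. D \<inter> {u. \<forall>i<k. x i \<noteq> u})) (tuples (Suc k) D)"
  proof (rule bij_betwI[where g="\<lambda>x. (restrict x {..<k}, x k)"])
    show "(\<lambda>(x, u). x(k := u)) \<in> Sigma (tuples k D) (\<lambda>x. D \<inter> {u. \<forall>i<k. x i \<noteq> u}) \<rightarrow> tuples (Suc k) D"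
      by (auto simp: tuples_def PiE_iff inj_on_def extensional_def less_Suc_eq) (metis lessThan_iff)
    show "(\<lambda>x. (restrict x {..<k}, x k)) \<in> tuples (Suc k) D \<rightarrow> Sigma (tuples k D) (\<lambda>x. D \<inter> {u. \<forall>i<k. x i \<noteq>
        u})"
      by (force simp: tuples_def PiE_iff inj_on_def)
  qed (auto simp: tuples_def PiE_iff extensional_def fun_eq_iff)
  from nn_integral_bij_count_space[OF this, of f] show ?thesis
    by (simp add: tuple_sum_def nn_integral_count_space_Sigma[symmetric, where A="tuples k D"] split_beta
        nn_integral_count_space_inter)
qed

lemma tuple_sum_inter: "tuple_sum k f (D \<inter> C) = tuple_sum k (\<lambda>x. f x * indicator ({..<k} \<rightarrow>\<^sub>E C) x) D"
proof -
  have "tuples k (D \<inter> C) = tuples k D \<inter> ({..<k} \<rightarrow>\<^sub>E C)"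
    by (auto simp: tuples_def PiE_iff extensional_def)
  then show ?thesis
    by (simp add: tuple_sum_def nn_integral_count_space_inter)
qed

lemma tuple_sum_image:
  assumes "inj_on \<phi> D"
  shows "tuple_sum k f (\<phi> ` D) = tuple_sum k (\<lambda>x. f (\<lambda>i\<in>{..<k}. \<phi> (x i))) D"
proof -
  have "bij_betw (\<lambda>x. \<lambda>i\<in>{..<k}. \<phi> (x i)) (tuples k D) (tuples k (\<phi> ` D))"
  proof (rule bij_betwI[where g="\<lambda>x. \<lambda>i\<in>{..<k}. the_inv_into D \<phi> (x i)"])
    have in_tuples: "(\<lambda>i\<in>{..<k}. \<psi> (x i)) \<in> tuples k (\<psi> ` B)"
      if x: "x \<in> tuples k B" and \<psi>: "inj_on \<psi> B" for x and \<psi> :: "'c \<Rightarrow> 'd" and B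
    proof -
      have "inj_on (\<psi> \<circ> x) {..<k}"
        using x by (intro comp_inj_on inj_on_subset[OF \<psi>]) (auto simp: tuples_def)
      then have "inj_on (\<lambda>i\<in>{..<k}. \<psi> (x i)) {..<k}"
        by (simp add: inj_on_def)
      then show ?thesis using x by (auto simp: tuples_def PiE_iff)
    qed
    show "(\<lambda>x. \<lambda>i\<in>{..<k}. \<phi> (x i)) \<in> tuples k D \<rightarrow> tuples k (\<phi> ` D)"
      using in_tuples[OF _ assms] by blast
    have "the_inv_into D \<phi> ` \<phi> ` D = D"
      using the_inv_into_f_f[OF assms] by (auto simp: image_image)
    with in_tuples[OF _ inj_on_the_inv_into[OF assms]]
    show "(\<lambda>x. \<lambda>i\<in>{..<k}. the_inv_into D \<phi> (x i)) \<in> tuples k (\<phi> ` D) \<rightarrow> tuples k D"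
      by auto
    show "(\<lambda>i\<in>{..<k}. the_inv_into D \<phi> ((\<lambda>i\<in>{..<k}. \<phi> (x i)) i)) = x" if "x \<in> tuples k D" for x
      using that the_inv_into_f_f[OF assms] by (auto simp: tuples_def PiE_iff extensional_def fun_eq_iff)
    show "(\<lambda>i\<in>{..<k}. \<phi> ((\<lambda>i\<in>{..<k}. the_inv_into D \<phi> (y i)) i)) = y" if "y \<in> tuples k (\<phi> ` D)" for y
      using that f_the_inv_into_f[OF assms] by (auto simp: tuples_def PiE_iff extensional_def fun_eq_iff)
  qed
  from nn_integral_bij_count_space[OF this, of f] show ?thesis
    by (simp add: tuple_sum_def)
qed

text \<open>The right-hand side is the falling factorial, the number of injections of
  \<open>{..<k}\<close> into \<open>D\<close>; the induction is the absorption identity for binomial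
  coefficients.\<close>

lemma tuple_sum_one:
  assumes "finite D"
  shows "tuple_sum k (\<lambda>_. 1) D = of_nat (fact k * (card D choose k))"
  using assms
proof (induction k arbitrary: D)
  case (Suc k)
  have "tuple_sum (Suc k) (\<lambda>_. 1) D = (\<integral>\<^sup>+u. of_nat (fact k * ((card D - 1) choose k)) \<partial>count_space D)"
    unfolding tuple_sum_Suc using Suc by (intro nn_integral_cong) (simp add: Suc.IH)
  also have "\<dots> = of_nat (card D * (fact k * ((card D - 1) choose k)))"
    using Suc.prems by (simp add: nn_integral_count_space_finite mult_ac)
  also have "card D * (fact k * ((card D - 1) choose k)) = fact (Suc k) * (card D choose Suc k)"
    using arg_cong[OF binomial_absorption[of k "card D"], of "\<lambda>x. fact k * x"] by (simp add: algebra_simps)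
  finally show ?case .
qed (simp add: tuple_sum_0)

lemma tuple_sum_indicator:
  assumes "finite (D \<inter> C)"
  shows "tuple_sum k (indicator ({..<k} \<rightarrow>\<^sub>E C)) D = of_nat (fact k * (card (D \<inter> C) choose k))"
  using tuple_sum_inter[of k "\<lambda>_. 1" D C] tuple_sum_one[OF assms, of k] by simp

lemma tuple_sum_mult: "tuple_sum k (\<lambda>x. c * f x) D = c * tuple_sum k f D"
  and tuple_sum_add: "tuple_sum k (\<lambda>x. f x + g x) D = tuple_sum k f D + tuple_sum k g D"
  unfolding tuple_sum_def by (simp_all add: nn_integral_cmult nn_integral_add)

lemma tuple_sum_SUP: "incseq U \<Longrightarrow> tuple_sum k (\<lambda>x. SUP i. U i x) D = (SUP i. tuple_sum k (U i) D)"
  unfolding tuple_sum_def by (rule nn_integral_monotone_convergence_SUP) auto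

lemma tuple_sum_eq_0_iff: "tuple_sum k f D = 0 \<longleftrightarrow> (\<forall>x\<in>tuples k D. f x = 0)"
  unfolding tuple_sum_def by (subst nn_integral_0_iff_AE) (auto simp: AE_count_space)

text \<open>Functions that differ only beyond index \<open>k\<close> would count as different tuples
  in \<open>factorial_moment\<close>; an extensional \<open>A\<close> contains each tuple
  once.\<close>

lemma factorial_moment_eq:
  assumes "\<And>\<mu>. \<mu> \<in> space Q \<Longrightarrow> A \<subseteq> extensional {..<k}"
  shows "factorial_moment Q k A = (\<integral>\<^sup>+\<mu>. tuple_sum k (indicator A) (points \<mu>) \<partial>Q)"
  unfolding factorial_moment_def
proof (rule nn_integral_cong)
  fix \<mu> assume "\<mu> \<in> space Q"
  then have "{x \<in> A. inj_on x {..<k} \<and> x ` {..<k} \<subseteq> points \<mu>} = UNIV \<inter> (tuples k (points \<mu>) \<inter> A)"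
    using assms by (auto simp: tuples_def PiE_iff subset_eq)
  then show "emeasure (count_space UNIV) {x \<in> A. inj_on x {..<k} \<and> x ` {..<k} \<subseteq> points \<mu>} =
      tuple_sum k (indicator A) (points \<mu>)"
    using nn_integral_count_space_inter[where f="\<lambda>_. 1" and A="tuples k (points \<mu>)" and B=A]
    by (simp add: tuple_sum_def emeasure_count_space)
qed

text \<open>Telescopes by Pascal's rule. It supplies the explicit remainder of inclusion-exclusion
  when at least one point is present.\<close>

lemma alternating_sum_choose_Suc:
  "(\<Sum>k\<le>n. (-1) ^ k * real (Suc N choose k)) = (-1) ^ n * real (N choose n)"
  by (induction n) (auto simp: algebra_simps)

section \<open>Measurability and expectation of tuple sums\<close>

context open_region begin

lemma sets_PiM_lborel:
  "sets (\<Pi>\<^sub>M i\<in>I. restrict_space lborel E) = sets (\<Pi>\<^sub>M i\<in>I. restrict_space borel E)"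
  by (intro sets_PiM_cong refl sets_restrict_space_cong sets_lborel)

text \<open>A configuration can be an infinite measure, so the Dynkin argument over rectangles is
  run inside a fixed member of the exhaustion; a monotone limit removes the cut-off, and
  approximation by simple functions does the rest.\<close>

lemma measurable_nn_integral_config:
  assumes m: "m \<in> S \<rightarrow>\<^sub>M config_space E"
    and g: "g \<in> borel_measurable (S \<Otimes>\<^sub>M restrict_space borel E)"
  shows "(\<lambda>s. \<integral>\<^sup>+u. g (s, u) \<partial>m s) \<in> borel_measurable S"
proof -
  have mE: "m s \<in> configs E" if "s \<in> space S" for s
    using measurable_space[OF m that] by simp
  have sm: "sets (m s) = sets (restrict_space borel E)" if "s \<in> space S" for s
    using configuration.sets_config[OF configuration.intro[OF mE[OF that]]] .
  let ?R = "S \<Otimes>\<^sub>M restrict_space borel E"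
  have sect: "Pair s -` A \<in> sets (restrict_space borel E)" if "A \<in> sets ?R" for A s
    using that by (rule sets_Pair1)
  have bdd: "(\<lambda>s. emeasure (m s) (Pair s -` A \<inter> exhaustion n)) \<in> borel_measurable S" if "A
      \<in> sets ?R" for A n
  proof -
    have nE: "exhaustion n \<in> bounded_sets E" by (intro bounded_setsI_exhaustion[of _ n]) auto
    have sR: "sets ?R = sigma_sets (space S \<times> E) {a \<times> b | a b. a \<in> sets S \<and> b
        \<in> sets (restrict_space borel E)}"
      by (simp add: sets_pair_measure space_restrict_space)
    have "Int_stable {a \<times> b | a b. a \<in> sets S \<and> b \<in> sets (restrict_space borel E)}"
      by (rule Int_stable_pair_measure_generator)
    moreover have "{a \<times> b | a b. a \<in> sets S \<and> b \<in> sets (restrict_space borel E)} \<subseteq> Pow (space S \<times> E)"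
      by (auto dest!: sets.sets_into_space simp: space_restrict_space)
    moreover note that[unfolded sR]
    ultimately show ?thesis
    proof (induction rule: sigma_sets_induct_disjoint)
      case (basic A)
      then obtain a b where ab: "A = a \<times> b" "a \<in> sets S" "b \<in> sets (restrict_space borel E)" by auto
      have "b \<inter> exhaustion n \<in> sets (restrict_space borel E)"
        using ab(3) bounded_sets_in_E[OF nE] by (rule sets.Int)
      from measurable_compose[OF m measurable_emeasure_config[OF this]]
      have "(\<lambda>s. indicator a s * emeasure (m s) (b \<inter> exhaustion n)) \<in> borel_measurable S"
        using ab(2) by measurable
      moreover have "indicator a s * emeasure (m s) (b \<inter> exhaustion n) =
          emeasure (m s) (Pair s -` A \<inter> exhaustion n)" for s
        by (auto simp: ab(1) indicator_def)
      ultimately show ?case by simp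
    next
      case empty
      show ?case by simp
    next
      case (compl A)
      then have A: "A \<in> sets ?R" by (simp add: sR)
      from measurable_compose[OF m measurable_emeasure_config[OF bounded_sets_in_E[OF nE]]]
      have "(\<lambda>s. emeasure (m s) (exhaustion n) - emeasure (m s) (Pair s -` A \<inter> exhaustion n))
          \<in> borel_measurable S"
        using compl(2) by measurable
      moreover have "emeasure (m s) (Pair s -` (space S \<times> E - A) \<inter> exhaustion n) =
        emeasure (m s) (exhaustion n) - emeasure (m s) (Pair s -` A \<inter> exhaustion n)" if "s \<in> space S" for s
      proof -
        have "Pair s -` (space S \<times> E - A) \<inter> exhaustion n = exhaustion n - (Pair s -` A \<inter> exhaustion n)"
          using that exhaustion_subset by auto
        moreover have "Pair s -` A \<inter> exhaustion n \<in> bounded_sets E"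
          using sect[OF A, of s] by (intro bounded_sets_subset[OF nE]) (auto simp: sets_E_iff)
        ultimately show ?thesis
          using bounded_sets_in_E nE that by (simp, intro emeasure_Diff) (auto simp: sm emeasure_eq_card mE)
      qed
      ultimately show ?case by (subst measurable_cong) auto
    next
      case (union A)
      then have A: "A i \<in> sets ?R" for i using sR by auto
      have "emeasure (m s) (Pair s -` (\<Union>i. A i) \<inter> exhaustion n) =
          (\<Sum>i. emeasure (m s) (Pair s -` A i \<inter> exhaustion n))"
        if "s \<in> space S" for s
      proof -
        have "(\<Sum>i. emeasure (m s) (Pair s -` A i \<inter> exhaustion n)) =
            emeasure (m s) (\<Union>i. Pair s -` A i \<inter> exhaustion n)"
          using sect[OF A] bounded_sets_in_E[OF nE] union(1)
          by (intro suminf_emeasure) (fastforce simp: sm[OF that] disjoint_family_on_def intro!: sets.Int)+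
        then show ?thesis by (simp add: vimage_UN)
      qed
      with union(3) show ?case by (subst measurable_cong) auto
    qed
  qed
  have sets: "(\<lambda>s. emeasure (m s) (Pair s -` A)) \<in> borel_measurable S" if A: "A \<in> sets ?R" for A
  proof -
    have "(SUP n. emeasure (m s) (Pair s -` A \<inter> exhaustion n)) =
        emeasure (m s) (Pair s -` A)" if "s \<in> space S" for s
    proof -
      have "(SUP n. emeasure (m s) (Pair s -` A \<inter> exhaustion n)) =
          emeasure (m s) (\<Union>n. Pair s -` A \<inter> exhaustion n)"
        using sect[OF A] exhaustion_subset incseq_exhaustion
        by (intro SUP_emeasure_incseq) (fastforce simp: sm[OF that] incseq_def sets_E_iff)+
      also have "(\<Union>n. Pair s -` A \<inter> exhaustion n) = Pair s -` A"
        using sect[OF A, of s] UN_exhaustion by (auto simp: sets_E_iff)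
      finally show ?thesis .
    qed
    moreover have "(\<lambda>s. SUP n. emeasure (m s) (Pair s -` A \<inter> exhaustion n)) \<in> borel_measurable S"
      using bdd[OF A] by measurable
    ultimately show ?thesis by (subst measurable_cong[symmetric]) auto
  qed
  have gs: "(\<lambda>u. g (s, u)) \<in> borel_measurable (m s)" if "g
      \<in> borel_measurable ?R" "s \<in> space S" for g :: "_ \<Rightarrow> ennreal" and s
    using measurable_compose[OF measurable_Pair1'[OF that(2)] that(1)]
      by (simp add: sm[OF that(2)] cong: measurable_cong_sets)
  from g show ?thesis
  proof (induction rule: borel_measurable_induct)
    case (cong f g)
    have "(\<integral>\<^sup>+u. f (s, u) \<partial>m s) = (\<integral>\<^sup>+u. g (s, u) \<partial>m s)" if "s \<in> space S" for s
    proof (intro nn_integral_cong)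
      fix u assume "u \<in> space (m s)"
      then have "(s, u) \<in> space ?R"
        using that sets_eq_imp_space_eq[OF sm[OF that]] by (auto simp: space_pair_measure)
      then show "f (s, u) = g (s, u)" using cong(3) by simp
    qed
    with cong(4) show ?case by (subst measurable_cong) auto
  next
    case (set A)
    have "(\<integral>\<^sup>+u. indicator A (s, u) \<partial>m s) = emeasure (m s) (Pair s -` A)" if "s \<in> space S" for s
    proof -
      have "(\<integral>\<^sup>+u. indicator A (s, u) \<partial>m s) = (\<integral>\<^sup>+u. indicator (Pair s -` A) u \<partial>m s)"
        by (intro nn_integral_cong) (auto simp: indicator_def)
      then show ?thesis using sect[OF set, of s] by (simp add: sm[OF that])
    qed
    with sets[OF set] show ?case by (subst measurable_cong) auto
  next
    case (mult u c)
    then have "(\<integral>\<^sup>+v. c * u (s, v) \<partial>m s) = c * (\<integral>\<^sup>+v. u (s, v) \<partial>m s)" if "s \<in> space S" for s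
      using gs that by (intro nn_integral_cmult) auto
    with mult show ?case
      by (subst measurable_cong[where g="\<lambda>s. c * (\<integral>\<^sup>+v. u (s, v) \<partial>m s)"]) auto
  next
    case (add u v)
    then have "(\<integral>\<^sup>+x. v (s, x) + u (s, x) \<partial>m s) =
        (\<integral>\<^sup>+x. v (s, x) \<partial>m s) + (\<integral>\<^sup>+x. u (s, x) \<partial>m s)" if "s \<in> space S" for s
      using gs that by (intro nn_integral_add) auto
    moreover have "(\<lambda>s. (\<integral>\<^sup>+x. v (s, x) \<partial>m s) + (\<integral>\<^sup>+x. u (s, x) \<partial>m s)) \<in> borel_measurable S"
      using add by (intro borel_measurable_add) auto
    ultimately show ?case
      by (subst measurable_cong[where g="\<lambda>s. (\<integral>\<^sup>+x. v (s, x) \<partial>m s) + (\<integral>\<^sup>+x. u (s, x) \<partial>m s)"])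
  next
    case (seq U)
    have "(SUP i. U i) = (\<lambda>p. SUP i. U i p)" by (simp add: fun_eq_iff image_comp)
    then have "(\<integral>\<^sup>+x. (SUP i. U i) (s, x) \<partial>m s) = (SUP i. \<integral>\<^sup>+x. U i (s, x) \<partial>m s)" if "s \<in> space S" for s
      using seq gs[OF _ that]
      by (simp only:, intro nn_integral_monotone_convergence_SUP) (auto simp: incseq_def le_fun_def)
    moreover have "(\<lambda>s. SUP i. \<integral>\<^sup>+x. U i (s, x) \<partial>m s) \<in> borel_measurable S"
      using seq by (intro borel_measurable_SUP) auto
    ultimately show ?case
      by (subst measurable_cong[where g="\<lambda>s. SUP i. \<integral>\<^sup>+x. U i (s, x) \<partial>m s"])
  qed
qed

lemma measurable_tuple_sum:
  assumes m: "m \<in> S \<rightarrow>\<^sub>M config_space E"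
    and "g \<in> borel_measurable (S \<Otimes>\<^sub>M (\<Pi>\<^sub>M i\<in>{..<k}. restrict_space borel E))"
  shows "(\<lambda>s. tuple_sum k (\<lambda>x. g (s, x)) (points (m s))) \<in> borel_measurable S"
  using assms(2)
proof (induction k arbitrary: g)
  case 0
  have "(\<lambda>s. (s, \<lambda>_. undefined)) \<in> S \<rightarrow>\<^sub>M S \<Otimes>\<^sub>M (\<Pi>\<^sub>M i\<in>{}. restrict_space borel E)"
    by (intro measurable_Pair measurable_ident_sets measurable_const) (auto simp: space_PiM)
  from measurable_compose[OF this] 0 show ?case by (simp add: tuple_sum_0)
next
  case (Suc k)
  let ?R = "restrict_space borel E"
  let ?P = "S \<Otimes>\<^sub>M (\<Pi>\<^sub>M i\<in>{..<k}. ?R)"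
  define g' where "g' = (\<lambda>p. g (fst (fst p), (snd (fst p))(k := snd p)) *
      indicator {u. \<forall>i<k. snd (fst p) i \<noteq> u} (snd p))"
  have R: "(\<lambda>x. x) \<in> ?R \<rightarrow>\<^sub>M borel" by (rule measurable_restrict_space1) simp
  have comp: "(\<lambda>p. snd (fst p) i) \<in> ?P \<Otimes>\<^sub>M ?R \<rightarrow>\<^sub>M borel" if "i < k" for i
    using that by (intro measurable_compose[OF _ R]) measurable
  have last: "(\<lambda>p. snd p) \<in> ?P \<Otimes>\<^sub>M ?R \<rightarrow>\<^sub>M borel"
    by (intro measurable_compose[OF _ R]) measurable
  have 1: "(\<lambda>p. indicator {u. \<forall>i<k. snd (fst p) i \<noteq> u} (snd p) :: ennreal) \<in> borel_measurable (?P \<Otimes>\<^sub>M ?R)"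
  proof -
    \<comment> \<open>Distinctness from all earlier coordinates as a finite product of factors 0 or
      1, each of them measurable because the diagonal is Borel.\<close>
    have "(\<lambda>p. \<Prod>i<k. if snd (fst p) i = snd p then 0 else 1 :: ennreal) \<in> borel_measurable (?P \<Otimes>\<^sub>M ?R)"
      by (rule borel_measurable_prod_ennreal, rule measurable_If, simp, simp, rule measurable_equality_set)
         (auto intro: comp last)
    also have "(\<lambda>p. \<Prod>i<k. if snd (fst p) i = snd p then 0 else 1 :: ennreal) =
        (\<lambda>p. indicator {u. \<forall>i<k. snd (fst p) i \<noteq> u} (snd p))"
      by (auto simp: indicator_def fun_eq_iff)
    finally show ?thesis .
  qed
  have 2: "(\<lambda>p. (fst (fst p), (snd (fst p))(k := snd p))) \<in> ?P \<Otimes>\<^sub>M ?R \<rightarrow>\<^sub>M S \<Otimes>\<^sub>M (\<Pi>\<^sub>M i\<in>{..<Suc k}. ?R)"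
    by (intro measurable_Pair measurable_fun_upd[where J="{..<k}"]) (auto simp: lessThan_Suc)
  have g': "g' \<in> borel_measurable (?P \<Otimes>\<^sub>M ?R)"
    unfolding g'_def by (intro borel_measurable_times_ennreal 1 measurable_compose[OF 2 Suc.prems])
  have "(\<lambda>p. m (fst p)) \<in> ?P \<rightarrow>\<^sub>M config_space E"
    using m by (rule measurable_compose[OF measurable_fst])
  from measurable_nn_integral_config[OF this g']
  have "(\<lambda>s. tuple_sum k (\<lambda>x. \<integral>\<^sup>+u. g' ((s, x), u) \<partial>m s) (points (m s))) \<in> borel_measurable S"
    using Suc.IH[of "\<lambda>p. \<integral>\<^sup>+u. g' (p, u) \<partial>m (fst p)"] by simp
  moreover have "tuple_sum (Suc k) (\<lambda>x. g (s, x)) (points (m s)) =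
      tuple_sum k (\<lambda>x. \<integral>\<^sup>+u. g' ((s, x), u) \<partial>m s) (points (m s))"
    if s: "s \<in> space S" for s
    unfolding tuple_sum_Suc'
  proof (rule tuple_sum_cong)
    interpret configuration E "m s"
      using measurable_space[OF m s] by unfold_locales simp
    fix x assume "x \<in> tuples k (points (m s))"
    then have "(s, x) \<in> space ?P"
      using s points_subset by (auto simp: tuples_def space_pair_measure space_PiM PiE_iff
          space_restrict_space)
    from measurable_compose[OF measurable_Pair1'[OF this] g']
    show "(\<integral>\<^sup>+u. g (s, x(k := u)) * indicator {u. \<forall>i<k. x i \<noteq> u} u \<partial>count_space (points (m s))) =
        (\<integral>\<^sup>+u. g' ((s, x), u) \<partial>m s)"
      by (simp add: nn_integral_config g'_def)
  qed
  ultimately show ?case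
    by (subst measurable_cong) auto
qed

lemma measurable_tuple_sum':
  assumes "g \<in> borel_measurable (\<Pi>\<^sub>M i\<in>{..<k}. restrict_space borel E)"
  shows "(\<lambda>\<mu>. tuple_sum k g (points \<mu>)) \<in> borel_measurable (config_space E)"
  using measurable_tuple_sum[of "\<lambda>\<mu>. \<mu>" "config_space E" "\<lambda>p. g (snd p)" k] assms by simp

text \<open>Campbell's formula of order \<open>k\<close>: the density identity on sets is carried
  over to nonnegative functions by linearity and monotone limits.\<close>

lemma nn_integral_tuple_sum_density:
  assumes Q: "sets Q = sets (config_space E)"
    and \<rho>: "\<rho> \<in> borel_measurable (\<Pi>\<^sub>M i\<in>{..<k}. restrict_space lborel E)"
    and A: "\<And>A. A \<in> sets (\<Pi>\<^sub>M i\<in>{..<k}. restrict_space lborel E) \<Longrightarrow>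
      factorial_moment Q k A = (\<integral>\<^sup>+x\<in>A. \<rho> x \<partial>(\<Pi>\<^sub>M i\<in>{..<k}. restrict_space lborel E))"
    and f: "f \<in> borel_measurable (\<Pi>\<^sub>M i\<in>{..<k}. restrict_space borel E)"
  shows "(\<integral>\<^sup>+\<mu>. tuple_sum k f (points \<mu>) \<partial>Q) =
    (\<integral>\<^sup>+x. f x * \<rho> x \<partial>(\<Pi>\<^sub>M i\<in>{..<k}. restrict_space lborel E))"
proof -
  let ?L = "\<Pi>\<^sub>M i\<in>{..<k}. restrict_space lborel E" and ?B = "\<Pi>\<^sub>M i\<in>{..<k}. restrict_space borel E"
  have sL: "sets ?L = sets ?B" by (rule sets_PiM_lborel)
  have tm: "(\<lambda>\<mu>. tuple_sum k g (points \<mu>)) \<in> borel_measurable Q" if "g \<in> borel_measurable ?L" for g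
    using measurable_tuple_sum'[of g k] that by (simp add: measurable_cong_sets[OF Q refl]
        measurable_cong_sets[OF sL refl])
  have spQ: "space Q = configs E"
    using sets_eq_imp_space_eq[OF Q] by simp
  have tL: "x \<in> space ?L" if "x \<in> tuples k (points \<mu>)" "\<mu> \<in> space Q" for x \<mu>
  proof -
    interpret configuration E \<mu> using that spQ by unfold_locales simp
    show ?thesis using that(1) points_subset by (auto simp: tuples_def space_PiM PiE_iff
        space_restrict_space)
  qed
  have "f \<in> borel_measurable ?L"
    using f by (simp add: measurable_cong_sets[OF sL refl])
  then show ?thesis
  proof (induction rule: borel_measurable_induct)
    case (cong f g)
    have "(\<integral>\<^sup>+\<mu>. tuple_sum k f (points \<mu>) \<partial>Q) = (\<integral>\<^sup>+\<mu>. tuple_sum k g (points \<mu>) \<partial>Q)"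
      using cong(3) tL by (intro nn_integral_cong tuple_sum_cong) auto
    moreover have "(\<integral>\<^sup>+x. f x * \<rho> x \<partial>?L) = (\<integral>\<^sup>+x. g x * \<rho> x \<partial>?L)"
      using cong(3) by (intro nn_integral_cong) auto
    ultimately show ?case using cong(4) by simp
  next
    case (set A)
    have "A \<subseteq> extensional {..<k}"
      using sets.sets_into_space[OF set] by (auto simp: space_PiM PiE_def)
    with A[OF set] show ?case
      by (subst factorial_moment_eq[symmetric]) (auto simp: mult.commute)
  next
    case (mult u c)
    then show ?case using \<rho>
      by (simp add: tuple_sum_mult nn_integral_cmult tm mult.assoc)
  next
    case (add u v)
    then show ?case using \<rho>
      by (simp add: tuple_sum_add nn_integral_add tm distrib_right)
  next
    case (seq U)
    have "(\<integral>\<^sup>+\<mu>. tuple_sum k (SUP i. U i) (points \<mu>) \<partial>Q) = (\<integral>\<^sup>+\<mu>. (SUP i. tuple_sum k (U i) (points \<mu>)) \<partial>Q)"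
    proof -
      have "(SUP i. U i) = (\<lambda>x. SUP i. U i x)" by (simp add: fun_eq_iff image_comp)
      then show ?thesis using tuple_sum_SUP[OF \<open>incseq U\<close>] by simp
    qed
    also have "\<dots> = (SUP i. \<integral>\<^sup>+\<mu>. tuple_sum k (U i) (points \<mu>) \<partial>Q)"
      using seq by (intro nn_integral_monotone_convergence_SUP tm)
        (auto simp: incseq_def le_fun_def tuple_sum_def intro!: nn_integral_mono)
    also have "\<dots> = (SUP i. \<integral>\<^sup>+x. U i x * \<rho> x \<partial>?L)"
      using seq by simp
    also have "\<dots> = (\<integral>\<^sup>+x. (SUP i. U i x * \<rho> x) \<partial>?L)"
      using seq \<rho> by (intro nn_integral_monotone_convergence_SUP[symmetric])
        (auto simp: incseq_def le_fun_def intro!: mult_right_mono)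
    also have "\<dots> = (\<integral>\<^sup>+x. (SUP i. U i) x * \<rho> x \<partial>?L)"
      by (simp add: image_comp SUP_mult_right_ennreal)
    finally show ?case .
  qed
qed

text \<open>
  Bonferroni: for \<open>N\<close> points in \<open>C\<close> the partial sum \<open>\<Sum>k\<le>n. (-1)\<^sup>k (N choose k)\<close> differs from the void
  indicator by at most \<open>N choose n\<close>.
\<close>

lemma void_probability_limit:
  assumes M: "finite_measure M" "sets M = sets (config_space E)" and C: "C \<in> bounded_sets E"
    and a: "\<And>k. (\<integral>\<^sup>+\<mu>. tuple_sum k (indicator ({..<k} \<rightarrow>\<^sub>E C)) (points \<mu>) \<partial>M) = ennreal (fact k * a k)"
    and a0: "\<And>k. 0 \<le> a k" and lim: "a \<longlonglongrightarrow> 0"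
  shows "(\<lambda>n. \<Sum>k\<le>n. (-1) ^ k * a k) \<longlonglongrightarrow> measure M (void C)"
proof -
  interpret M: finite_measure M by fact
  have spM: "space M = configs E" using sets_eq_imp_space_eq[OF M(2)] by simp
  define N where "N \<mu> = card (points \<mu> \<inter> C)" for \<mu> :: "'a measure"
  have N: "tuple_sum k (indicator ({..<k} \<rightarrow>\<^sub>E C)) (points \<mu>) = ennreal (fact k * real (N \<mu> choose k))"
    if "\<mu> \<in> space M" for k \<mu>
  proof -
    interpret configuration E \<mu> using that spM by unfold_locales simp
    show ?thesis
      unfolding tuple_sum_indicator[OF finite_points_bounded[OF C]] N_def
      by (simp add: ennreal_of_nat_eq_real_of_nat)
  qed
  have Nmeas: "(\<lambda>\<mu>. real (N \<mu>)) \<in> borel_measurable M"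
  proof -
    have "(\<lambda>\<mu>. enn2real (emeasure \<mu> C)) \<in> borel_measurable M"
      using measurable_emeasure_config[OF bounded_sets_in_E[OF C]]
      by (simp add: measurable_cong_sets[OF M(2) refl])
    then show ?thesis
      by (subst measurable_cong[where g="\<lambda>\<mu>. enn2real (emeasure \<mu> C)"])
         (auto simp: spM emeasure_eq_card[OF _ C] N_def)
  qed
  \<comment> \<open>Binomial coefficients act on a natural number, so measurability of the
    real-valued count is brought back through the floor.\<close>
  have N'meas [measurable]: "N \<in> M \<rightarrow>\<^sub>M count_space UNIV"
  proof -
    have "(\<lambda>\<mu>. nat \<lfloor>real (N \<mu>)\<rfloor>) \<in> M \<rightarrow>\<^sub>M count_space UNIV"
      using Nmeas by measurable
    then show ?thesis by simp
  qed
  \<comment> \<open>Dividing by \<open>fact k\<close> turns the factorial moment into the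
    expectation of \<open>N \<mu> choose k\<close>, and \<open>a k\<close> into its value.\<close>
  have bi: "has_bochner_integral M (\<lambda>\<mu>. real (N \<mu> choose k)) (a k)" for k
  proof -
    have "ennreal (fact k) * (\<integral>\<^sup>+\<mu>. ennreal (real (N \<mu> choose k)) \<partial>M) =
        (\<integral>\<^sup>+\<mu>. ennreal (fact k) * ennreal (real (N \<mu> choose k)) \<partial>M)"
      by (rule nn_integral_cmult[symmetric]) measurable
    also have "\<dots> = (\<integral>\<^sup>+\<mu>. tuple_sum k (indicator ({..<k} \<rightarrow>\<^sub>E C)) (points \<mu>) \<partial>M)"
      by (intro nn_integral_cong) (simp add: N ennreal_mult')
    also have "\<dots> = ennreal (fact k) * ennreal (a k)"
      by (simp add: a ennreal_mult')
    finally have "(\<integral>\<^sup>+\<mu>. ennreal (real (N \<mu> choose k)) \<partial>M) = ennreal (a k)"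
      by (subst (asm) ennreal_mult_cancel_left) auto
    then show ?thesis
      using a0 by (intro has_bochner_integral_nn_integral) (auto)
  qed
  have vM: "void C \<in> sets M" using void_in_sets_config_space[OF C] M(2) by simp
  have est: "\<bar>(\<Sum>k\<le>n. (-1) ^ k * a k) - measure M (void C)\<bar> \<le> a n" for n
  proof -
    have i1: "has_bochner_integral M (\<lambda>\<mu>. \<Sum>k\<le>n. (-1) ^ k * real (N \<mu> choose k)) (\<Sum>k\<le>n. (-1) ^ k * a k)"
      by (intro has_bochner_integral_sum has_bochner_integral_mult_right bi)
    have i2: "has_bochner_integral M (indicator (void C)) (measure M (void C))"
      using vM by (intro has_bochner_integral_real_indicator) (simp_all add: M.emeasure_eq_measure)
    have i: "has_bochner_integral M (\<lambda>\<mu>. (\<Sum>k\<le>n. (-1) ^ k * real (N \<mu> choose k)) - indicator (void C) \<mu>)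
        ((\<Sum>k\<le>n. (-1) ^ k * a k) - measure M (void C))"
      by (rule has_bochner_integral_diff[OF i1 i2])
    have ptw: "\<bar>(\<Sum>k\<le>n. (-1) ^ k * real (N \<mu> choose k)) - indicator (void C) \<mu>\<bar> \<le>
        real (N \<mu> choose n)" if "\<mu> \<in> space M" for \<mu>
    proof -
      interpret configuration E \<mu> using that spM by unfold_locales simp
      have v: "\<mu> \<in> void C \<longleftrightarrow> N \<mu> = 0"
        using that finite_points_bounded[OF C] by (auto simp: void_def N_def spM)
      show ?thesis
      proof (cases "N \<mu>")
        case 0
        have "(\<Sum>k\<le>n. (-1) ^ k * real (0 choose k)) = (\<Sum>k\<in>{0}. (-1) ^ k * real (0 choose k))"
          by (rule sum.mono_neutral_right) (auto simp: binomial_eq_0)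
        with 0 v show ?thesis by simp
      next
        case (Suc N')
        have "real (N' choose n) \<le> real (Suc N' choose n)"
          by (cases n) auto
        with Suc v show ?thesis by (simp add: alternating_sum_choose_Suc abs_mult)
      qed
    qed
    have "\<bar>(\<Sum>k\<le>n. (-1) ^ k * a k) - measure M (void C)\<bar> =
        norm (\<integral>\<mu>. (\<Sum>k\<le>n. (-1) ^ k * real (N \<mu> choose k)) - indicator (void C) \<mu> \<partial>M)"
      using has_bochner_integral_integral_eq[OF i] by simp
    also have "\<dots> \<le> (\<integral>\<mu>. real (N \<mu> choose n) \<partial>M)"
      by (rule order_trans[OF integral_norm_bound integral_mono])
         (use ptw integrable.intros[OF i] integrable.intros[OF bi] in auto)
    also have "\<dots> = a n" by (rule has_bochner_integral_integral_eq[OF bi])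
    finally show ?thesis .
  qed
  have "(\<lambda>n. (\<Sum>k\<le>n. (-1) ^ k * a k) - measure M (void C)) \<longlonglongrightarrow> 0"
    by (rule tendsto_0_le[OF lim, of _ 1]) (use est in \<open>auto intro!: always_eventually simp: order_trans[OF
        est abs_ge_self]\<close>)
  then show ?thesis by (rule LIM_zero_cancel)
qed

end

section \<open>Determinants and Hadamard's inequality\<close>

abbreviation square_mat :: "nat \<Rightarrow> (nat \<Rightarrow> nat \<Rightarrow> complex) \<Rightarrow> complex mat" where
  "square_mat n M \<equiv> mat n n (\<lambda>(i, j). M i j)"

abbreviation fdet :: "nat \<Rightarrow> (nat \<Rightarrow> nat \<Rightarrow> complex) \<Rightarrow> complex" where
  "fdet n M \<equiv> Determinant.det (square_mat n M)"

lemma permutes_atLeast0LessThan_less: "p permutes {0..<n} \<Longrightarrow> i < n \<Longrightarrow> p i < n" for n :: nat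
  using permutes_in_image[of p "{0..<n}" i] by simp

lemma fdet_Leibniz: "fdet n M = (\<Sum>p | p permutes {0..<n}. signof p * (\<Prod>i<n. M i (p i)))"
proof -
  have "fdet n M = (\<Sum>p\<in>{p. p permutes {0..<n}}. signof p * (\<Prod>i=0..<n. square_mat n M $$ (i, p i)))"
    by (rule det_def') simp
  also have "\<dots> = (\<Sum>p\<in>{p. p permutes {0..<n}}. signof p * (\<Prod>i<n. M i (p i)))"
    by (intro sum.cong refl arg_cong2[where f="(*)"] prod.cong)
       (auto simp: atLeast0LessThan permutes_atLeast0LessThan_less[unfolded atLeast0LessThan])
  finally show ?thesis .
qed

lemma fdet_cong: "(\<And>i j. i < n \<Longrightarrow> j < n \<Longrightarrow> M i j = N i j) \<Longrightarrow> fdet n M = fdet n N"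
  by (intro arg_cong[where f=Determinant.det] cong_mat) auto

text \<open>Each Leibniz term meets every row and every column once. In this way the square roots of
  the weight leave the determinant as the weight itself.\<close>

lemma fdet_mult_row_col: "fdet n (\<lambda>i j. f i * M i j * g j) = (\<Prod>i<n. f i) * (\<Prod>i<n. g i) * fdet n M"
proof -
  have "(\<Prod>i<n. f i * M i (p i) * g (p i)) = (\<Prod>i<n. f i) * (\<Prod>i<n. g i) * (\<Prod>i<n. M i (p i))"
    if "p permutes {0..<n}" for p
  proof -
    have "(\<Prod>i<n. g (p i)) = (\<Prod>i<n. g i)"
      using prod.permute[OF that[unfolded atLeast0LessThan], of g] by (simp add: o_def)
    then show ?thesis by (simp add: prod.distrib)
  qed
  then show ?thesis
    by (auto simp: fdet_Leibniz sum_distrib_left mult_ac intro!: sum.cong)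
qed

lemma fdet_0: "fdet 0 M = 1"
  by (simp add: fdet_Leibniz)

lemma fdet_zero_row: "(\<And>j. j \<le> k \<Longrightarrow> M k j = 0) \<Longrightarrow> fdet (Suc k) M = 0"
  by (subst laplace_expansion_row[of _ "Suc k" k]) auto

text \<open>Multiplication by \<open>L\<close> subtracts multiples of the last row and clears the
  last column above the pivot; \<open>L\<close> is unit upper triangular, so the determinant is
  kept, and expansion along the last column finishes. For \<open>K_H\<close> the complement is
  \<open>K_H_palm\<close> at the last point.\<close>

lemma fdet_Schur:
  assumes "M k k \<noteq> 0"
  shows "fdet (Suc k) M = M k k * fdet k (\<lambda>i j. M i j - M i k * M k j / M k k)"
proof -
  define L where "L = (\<lambda>i j. if i = j then 1 else if j = k then - M i k / M k k else 0)"
  define N where "N = (\<lambda>i j. if i = k then M k j else M i j - M i k * M k j / M k k)"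
  have "square_mat (Suc k) L * square_mat (Suc k) M = square_mat (Suc k) N"
  proof (rule eq_matI)
    fix i j assume "i < dim_row (square_mat (Suc k) N)" "j < dim_col (square_mat (Suc k) N)"
    then have ij: "i < Suc k" "j < Suc k" by auto
    have "(square_mat (Suc k) L * square_mat (Suc k) M) $$ (i, j) = (\<Sum>l<Suc k. L i l * M l j)"
      using ij by (auto simp: scalar_prod_def atLeast0LessThan intro!: sum.cong)
    also have "\<dots> = N i j"
    proof (cases "i = k")
      case True
      have "(\<Sum>l<k. L i l * M l j) = 0"
        using True by (intro sum.neutral) (auto simp: L_def)
      with True show ?thesis by (simp add: L_def N_def)
    next
      case False
      then have "i < k" using ij by simp
      have "(\<Sum>l<k. L i l * M l j) = (\<Sum>l<k. if l = i then M l j else 0)"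
        using False by (intro sum.cong) (auto simp: L_def)
      also have "\<dots> = M i j" using \<open>i < k\<close> by simp
      finally show ?thesis using False by (simp add: L_def N_def)
    qed
    finally show "(square_mat (Suc k) L * square_mat (Suc k) M) $$ (i, j) = square_mat (Suc k) N $$ (i, j)"
      using ij by simp
  qed auto
  then have "fdet (Suc k) N = fdet (Suc k) L * fdet (Suc k) M"
    by (metis det_mult mat_carrier)
  moreover have "fdet (Suc k) L = 1"
  proof -
    have "fdet (Suc k) L = prod_list (diag_mat (square_mat (Suc k) L))"
      by (rule det_upper_triangular[of _ "Suc k"]) (auto simp: L_def)
    also have "diag_mat (square_mat (Suc k) L) = map (\<lambda>_. 1) [0..<Suc k]"
      unfolding diag_mat_def by (intro map_cong) (auto simp: L_def)
    also have "prod_list (map (\<lambda>_. 1 :: complex) [0..<Suc k]) = 1"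
      by (induction k) auto
    finally show ?thesis .
  qed
  moreover have "fdet (Suc k) N = M k k * fdet k (\<lambda>i j. M i j - M i k * M k j / M k k)"
  proof -
    have "fdet (Suc k) N = (\<Sum>i<Suc k. square_mat (Suc k) N $$ (i, k) * cofactor (square_mat (Suc k) N) i k)"
      by (rule laplace_expansion_column) auto
    also have "\<dots> = (\<Sum>i\<in>{k}. square_mat (Suc k) N $$ (i, k) * cofactor (square_mat (Suc k) N) i k)"
      using assms by (intro sum.mono_neutral_right) (auto simp: N_def)
    also have "\<dots> = M k k * Determinant.det (mat_delete (square_mat (Suc k) N) k k)"
      by (simp add: cofactor_def N_def)
    also have "mat_delete (square_mat (Suc k) N) k k = square_mat k (\<lambda>i j. M i j - M i k * M k j / M k k)"
      by (rule eq_matI) (auto simp: mat_delete_def N_def)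
    finally show ?thesis .
  qed
  ultimately show ?thesis by simp
qed

text \<open>
  Induction on the number of rows: the Schur complement of a Gram matrix is the Gram matrix of the
  remaining rows projected orthogonally to the last one, which shortens them.
\<close>

lemma fdet_Gram:
  fixes a :: "nat \<Rightarrow> nat \<Rightarrow> complex"
  shows "\<exists>r. fdet n (\<lambda>i j. \<Sum>l<m. a i l * cnj (a j l)) = complex_of_real r \<and> 0 \<le> r \<and> r \<le>
      (\<Prod>i<n. \<Sum>l<m. (cmod (a i l))\<^sup>2)"
proof (induction n arbitrary: a)
  case 0
  show ?case by (intro exI[of _ 1]) (simp add: fdet_0)
next
  case (Suc k)
  define G where "G = (\<lambda>i j. \<Sum>l<m. a i l * cnj (a j l))"
  define s where "s i = (\<Sum>l<m. (cmod (a i l))\<^sup>2)" for i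
  have Gs: "G i i = complex_of_real (s i)" for i
    by (simp only: G_def s_def of_real_sum complex_norm_square)
  have s0: "0 \<le> s i" for i by (auto simp: s_def intro!: sum_nonneg)
  show ?case
  proof (cases "s k = 0")
    case True
    then have "a k l = 0" if "l < m" for l
      using that sum_nonneg_eq_0_iff[of "{..<m}" "\<lambda>l. (cmod (a k l))\<^sup>2"] by (simp add: s_def)
    then have "fdet (Suc k) (\<lambda>i j. \<Sum>l<m. a i l * cnj (a j l)) = 0"
      by (intro fdet_zero_row) auto
    then show ?thesis
      by (intro exI[of _ 0] conjI prod_nonneg) (auto intro!: sum_nonneg)
  next
    case False
    \<comment> \<open>The component of row \<open>i\<close> orthogonal to row \<open>k\<close>;
      \<open>G i k / G k k\<close> is the coefficient of the projection.\<close>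
    define b where "b i l = a i l - G i k / G k k * a k l" for i l
    have Gk: "G k k \<noteq> 0" using False Gs by simp
    have cG: "cnj (G i j) = G j i" for i j
      by (simp add: G_def mult.commute)
    have cGk: "cnj (G k k) = G k k" by (rule cG)
    have bG: "(\<Sum>l<m. b i l * cnj (b j l)) = G i j - G i k * G k j / G k k" for i j
    proof -
      define c d where "c = G k j / G k k" and "d = G i k / G k k"
      have "(\<Sum>l<m. b i l * cnj (b j l)) =
          (\<Sum>l<m. a i l * cnj (a j l) - c * (a i l * cnj (a k l)) - d * (a k l * cnj (a j l)) + d * c *
              (a k l * cnj (a k l)))"
        by (intro sum.cong) (auto simp: b_def c_def d_def cG algebra_simps)
      also have "\<dots> = G i j - c * G i k - d * G k j + d * c * G k k"
        by (simp only: sum.distrib sum_subtractf sum_distrib_left G_def)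
      also have "\<dots> = G i j - G i k * G k j / G k k"
        using Gk by (simp add: c_def d_def field_simps)
      finally show ?thesis .
    qed
    \<comment> \<open>Pythagoras: the squared length drops by that of the projection, which is
      |\<open>G i k\<close>|^2 / \<open>s k\<close>.\<close>
    have bs: "(\<Sum>l<m. (cmod (b i l))\<^sup>2) \<le> s i" for i
    proof -
      have "complex_of_real (\<Sum>l<m. (cmod (b i l))\<^sup>2) = (\<Sum>l<m. b i l * cnj (b i l))"
        by (simp only: of_real_sum complex_norm_square)
      also have "\<dots> = complex_of_real (s i - (cmod (G i k))\<^sup>2 / s k)"
        by (simp only: bG Gs of_real_diff of_real_divide complex_norm_square cG)
      finally have "(\<Sum>l<m. (cmod (b i l))\<^sup>2) = s i - (cmod (G i k))\<^sup>2 / s k"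
        using of_real_eq_iff by blast
      then show ?thesis using s0[of k] by simp
    qed
    obtain r where r: "fdet k (\<lambda>i j. \<Sum>l<m. b i l * cnj (b j l)) = complex_of_real r" "0 \<le> r"
      "r \<le> (\<Prod>i<k. \<Sum>l<m. (cmod (b i l))\<^sup>2)"
      using Suc.IH[of b] by blast
    have "fdet (Suc k) G = G k k * fdet k (\<lambda>i j. G i j - G i k * G k j / G k k)"
      using Gk by (rule fdet_Schur[of G k])
    also have "\<dots> = complex_of_real (s k * r)"
      using r(1) by (simp add: bG Gs)
    finally have "fdet (Suc k) (\<lambda>i j. \<Sum>l<m. a i l * cnj (a j l)) = complex_of_real (s k * r)"
      by (simp add: G_def)
    moreover have "s k * r \<le> (\<Prod>i<Suc k. s i)"
    proof -
      have "r \<le> (\<Prod>i<k. s i)"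
        using r(3) by (rule order_trans) (auto intro!: prod_mono bs sum_nonneg)
      from mult_left_mono[OF this s0[of k]] show ?thesis by (simp add: mult.commute)
    qed
    ultimately show ?thesis
      using r(2) s0[of k] by (intro exI[of _ "s k * r"]) (auto simp: s_def)
  qed
qed

text \<open>The product of the matrix with its adjoint is the Gram matrix of the rows, and its
  determinant is the squared modulus on the left.\<close>

theorem Hadamard_inequality: "(cmod (fdet n A))\<^sup>2 \<le> (\<Prod>i<n. \<Sum>l<n. (cmod (A i l))\<^sup>2)"
proof -
  interpret cnj: comm_ring_hom cnj by unfold_locales auto
  obtain r where r: "fdet n (\<lambda>i j. \<Sum>l<n. A i l * cnj (A j l)) = complex_of_real r"
    "r \<le> (\<Prod>i<n. \<Sum>l<n. (cmod (A i l))\<^sup>2)"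
    using fdet_Gram[where n=n and m=n and a=A] by blast
  have "square_mat n (\<lambda>i j. \<Sum>l<n. A i l * cnj (A j l)) =
      square_mat n A * transpose_mat (map_mat cnj (square_mat n A))"
    by (rule eq_matI) (auto simp: scalar_prod_def atLeast0LessThan intro!: sum.cong)
  then have "fdet n (\<lambda>i j. \<Sum>l<n. A i l * cnj (A j l)) =
      fdet n A * Determinant.det (transpose_mat (map_mat cnj (square_mat n A)))"
    by (simp add: det_mult[of _ n])
  also have "Determinant.det (transpose_mat (map_mat cnj (square_mat n A))) = cnj (fdet n A)"
    by (subst det_transpose[of _ n]) (auto simp: cnj.hom_det)
  finally have "complex_of_real r = complex_of_real ((cmod (fdet n A))\<^sup>2)"
    unfolding r(1) by (simp only: complex_norm_square)
  then have "(cmod (fdet n A))\<^sup>2 = r" using of_real_eq_iff by metis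
  with r(2) show ?thesis by simp
qed

lemma norm_fdet_le:
  assumes A: "\<And>i j. i < n \<Longrightarrow> j < n \<Longrightarrow> cmod (A i j) \<le> c"
  shows "cmod (fdet n A) \<le> (c * sqrt n) ^ n"
\<comment> \<open>For \<open>n = 0\<close> the assumption does not force \<open>c\<close> to be
  nonnegative, but both sides are 1.\<close>
proof (cases "n = 0")
  case False
  then have c: "0 \<le> c" using A[of 0 0] by (meson norm_ge_zero order_trans not_gr_zero)
  have "(cmod (fdet n A))\<^sup>2 \<le> (\<Prod>i<n. \<Sum>l<n. (cmod (A i l))\<^sup>2)"
    by (rule Hadamard_inequality)
  also have "\<dots> \<le> (\<Prod>i<n. \<Sum>l<n. c\<^sup>2)"
    using A by (intro prod_mono conjI sum_nonneg sum_mono power_mono) auto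
  also have "\<dots> = ((c * sqrt n) ^ n)\<^sup>2"
  proof -
    have "((c * sqrt n) ^ n)\<^sup>2 = ((c * sqrt n)\<^sup>2) ^ n"
      by (metis power_mult mult.commute)
    then show ?thesis by (simp add: power_mult_distrib mult.commute)
  qed
  finally show ?thesis
    by (rule power2_le_imp_le) (use c in simp)
qed (simp add: fdet_0)

section \<open>Measurability of determinants and growth of Hadamard's bound\<close>

lemma borel_measurable_fdet:
  assumes "\<And>i j. i < n \<Longrightarrow> j < n \<Longrightarrow> (\<lambda>s. M s i j) \<in> borel_measurable S"
  shows "(\<lambda>s. fdet n (M s)) \<in> borel_measurable S"
proof -
  have "(\<lambda>s. M s i (p i)) \<in> borel_measurable S" if "p permutes {0..<n}" "i < n" for i p
    using that assms by (auto simp: permutes_atLeast0LessThan_less)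
  then show ?thesis
    unfolding fdet_Leibniz by (intro borel_measurable_sum borel_measurable_times borel_measurable_const
        borel_measurable_prod) auto
qed

text \<open>One term of the exponential series is at most the sum. With \<open>x = n\<close> this
  replaces Stirling's formula.\<close>

lemma power_le_fact_exp: "x ^ n \<le> fact n * exp x" if "0 \<le> x" for x :: real
proof -
  have s: "summable (\<lambda>n. x ^ n /\<^sub>R fact n)" by (rule summable_exp_generic)
  have "(\<Sum>k\<in>{n}. x ^ k /\<^sub>R fact k) \<le> (\<Sum>k. x ^ k /\<^sub>R fact k)"
    using s that by (intro sum_le_suminf) auto
  then have "x ^ n / fact n \<le> exp x" by (simp add: exp_def divide_inverse mult.commute)
  then show ?thesis by (simp add: field_simps)
qed

text \<open>From n^n \<le> n! e^n the quotient is at most (c e / sqrt n)^n, and its base is at most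
  1/2 as soon as n exceeds (2 c e)^2.\<close>

lemma Hadamard_growth: "(\<lambda>n. (c * sqrt n) ^ n / fact n) \<longlonglongrightarrow> 0" if "0 \<le> c" for c :: real
proof -
  have le: "(c * sqrt n) ^ n / fact n \<le> (1 / 2) ^ n" if n: "real n > (2 * c * exp 1)\<^sup>2" for n :: nat
  proof -
    have n0: "0 < sqrt n" using n by (metis le_less_trans of_nat_0_less_iff real_sqrt_gt_0_iff
        zero_le_power2)
    have "2 * c * exp 1 \<le> sqrt n" using n by (intro real_le_rsqrt) simp
    then have "c * exp 1 / sqrt n \<le> 1 / 2" using n0 by (simp add: field_simps)
    moreover have "(c * sqrt n) ^ n / fact n \<le> (c * exp 1 / sqrt n) ^ n"
    proof -
      have "(sqrt n) ^ n * (sqrt n) ^ n = real n ^ n"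
        by (simp add: power_mult_distrib[symmetric])
      also have "\<dots> \<le> fact n * exp (real n)" by (rule power_le_fact_exp) simp
      also have "exp (real n) = exp 1 ^ n" by (simp add: exp_of_nat_mult[symmetric])
      finally have "(sqrt n) ^ n / fact n \<le> (exp 1 / sqrt n) ^ n"
        using n0 by (simp add: field_simps power_divide)
      from mult_left_mono[OF this, of "c ^ n"] show ?thesis
        using \<open>0 \<le> c\<close> by (simp add: power_mult_distrib power_divide)
    qed
    moreover have "(c * exp 1 / sqrt n) ^ n \<le> (1 / 2) ^ n"
      using \<open>0 \<le> c\<close> n0 calculation(1) by (intro power_mono) auto
    ultimately show ?thesis by linarith
  qed
  have "\<forall>\<^sub>F n in sequentially. (c * sqrt n) ^ n / fact n \<le> (1 / 2) ^ n"
    using eventually_gt_at_top[of "nat \<lceil>(2 * c * exp 1)\<^sup>2\<rceil>"]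
  proof eventually_elim
    case (elim n)
    then have "nat \<lceil>(2 * c * exp 1)\<^sup>2\<rceil> < n" .
    then have "(2 * c * exp 1)\<^sup>2 < real n"
      by (metis le_less_trans of_nat_less_iff real_nat_ceiling_ge)
    then show ?case by (rule le)
  qed
  then have up: "\<forall>\<^sub>F n in sequentially. (c * sqrt (real n)) ^ n / fact n \<le> (1 / 2) ^ n" .
  have half: "(\<lambda>n. (1 / 2) ^ n :: real) \<longlonglongrightarrow> 0" by (rule LIMSEQ_power_zero) simp
  have low: "\<forall>\<^sub>F n in sequentially. 0 \<le> (c * sqrt (real n)) ^ n / fact n"
    using that by (intro always_eventually) simp
  show ?thesis
    by (rule tendsto_sandwich[OF low up tendsto_const half])
qed

lemma kernel_det_fdet: "kernel_det K k x = fdet k (\<lambda>i j. K (x i) (x j))"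
  by (simp add: kernel_det_def)

section \<open>Determinantal laws and independent thinning\<close>

context open_region begin

lemma determinantal_prob_space: "determinantal E K Q \<Longrightarrow> prob_space Q"
  and determinantal_sets: "determinantal E K Q \<Longrightarrow> sets Q = sets (config_space E)"
  by (auto simp: determinantal_def)

lemma borel_measurable_kernel_det:
  assumes K: "\<And>i j. i < k \<Longrightarrow> j < k \<Longrightarrow> (\<lambda>s. K s (x s i) (x s j)) \<in> borel_measurable S"
  shows "(\<lambda>s. ennreal (Re (kernel_det (K s) k (x s)))) \<in> borel_measurable S"
proof -
  have "(\<lambda>s. kernel_det (K s) k (x s)) \<in> borel_measurable S"
    unfolding kernel_det_fdet using K by (rule borel_measurable_fdet)
  then show ?thesis by measurable
qed

lemma borel_measurable_kernel_det_PiM: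
  assumes K: "(\<lambda>p. K (fst p) (snd p)) \<in> borel_measurable (restrict_space borel E \<Otimes>\<^sub>M restrict_space borel
      E)"
  shows "(\<lambda>x. ennreal (Re (kernel_det K k x))) \<in> borel_measurable (\<Pi>\<^sub>M i\<in>{..<k}. restrict_space borel E)"
proof (rule borel_measurable_kernel_det)
  fix i j assume "i < k" "j < k"
  then have "(\<lambda>x. (x i, x j)) \<in> (\<Pi>\<^sub>M i\<in>{..<k}. restrict_space borel E)
      \<rightarrow>\<^sub>M restrict_space borel E \<Otimes>\<^sub>M restrict_space borel E"
    by (intro measurable_Pair measurable_component_singleton) auto
  from measurable_compose[OF this K]
  show "(\<lambda>x. K (x i) (x j)) \<in> borel_measurable (\<Pi>\<^sub>M i\<in>{..<k}. restrict_space borel E)" by simp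
qed

lemma determinantal_tuple_sum:
  assumes Q: "determinantal E K Q"
    and K: "(\<lambda>p. K (fst p) (snd p)) \<in> borel_measurable (restrict_space borel E \<Otimes>\<^sub>M restrict_space borel E)"
    and f: "f \<in> borel_measurable (\<Pi>\<^sub>M i\<in>{..<k}. restrict_space borel E)"
  shows "(\<integral>\<^sup>+\<mu>. tuple_sum k f (points \<mu>) \<partial>Q) =
    (\<integral>\<^sup>+x. f x * ennreal (Re (kernel_det K k x)) \<partial>(\<Pi>\<^sub>M i\<in>{..<k}. restrict_space lborel E))"
\<comment> \<open>The definition of a determinantal law speaks of \<open>k \<ge> 1\<close>. For
  \<open>k = 0\<close> both sides are the value of \<open>f\<close> at the empty tuple, because
  \<open>Q\<close> has mass 1; the alternating series starts with this term.\<close>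
proof (cases "k = 0")
  case True
  interpret prob_space Q by (rule determinantal_prob_space[OF Q])
  show ?thesis
    using True by (simp add: tuple_sum_0 kernel_det_fdet fdet_0 PiM_empty nn_integral_count_space_finite
        emeasure_space_1)
next
  case False
  have "(\<lambda>x. ennreal (Re (kernel_det K k x))) \<in> borel_measurable (\<Pi>\<^sub>M i\<in>{..<k}. restrict_space lborel E)"
    using borel_measurable_kernel_det_PiM[OF K] by (simp add: measurable_cong_sets[OF sets_PiM_lborel refl])
  moreover have "factorial_moment Q k A = (\<integral>\<^sup>+x\<in>A. ennreal (Re (kernel_det K k x))
      \<partial>(\<Pi>\<^sub>M i\<in>{..<k}. restrict_space lborel E))"
    if "A \<in> sets (\<Pi>\<^sub>M i\<in>{..<k}. restrict_space lborel E)" for A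
    using Q False that by (simp add: determinantal_def Let_def)
  ultimately show ?thesis
    using f by (intro nn_integral_tuple_sum_density[OF determinantal_sets[OF Q]])
qed

end

section \<open>Independent thinning of a configuration\<close>

locale thinned_region = open_region E for E :: "'a::euclidean_space set" +
  fixes q :: "'a \<Rightarrow> real"
  assumes measurable_q: "q \<in> borel_measurable (restrict_space borel E)"
    and q_nonneg: "z \<in> E \<Longrightarrow> 0 \<le> q z" and q_le_1: "z \<in> E \<Longrightarrow> q z \<le> 1"
begin

abbreviation retention :: "'a measure \<Rightarrow> ('a \<Rightarrow> bool) measure" where
  "retention \<mu> \<equiv> \<Pi>\<^sub>M z\<in>points \<mu>. measure_pmf (bernoulli_pmf (q z))"

lemma product_prob_space_retention: "product_prob_space (\<lambda>z. measure_pmf (bernoulli_pmf (q z)))"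
  by (intro product_prob_spaceI measure_pmf.prob_space_axioms)

lemma emeasure_retention:
  assumes F: "finite F" "F \<subseteq> points \<mu>"
  shows "emeasure (retention \<mu>) {r \<in> space (retention \<mu>). \<forall>z\<in>F. r z = b} =
    (\<Prod>z\<in>F. emeasure (measure_pmf (bernoulli_pmf (q z))) {b})"
proof -
  interpret product_prob_space "\<lambda>z. measure_pmf (bernoulli_pmf (q z))" "points \<mu>"
    by (rule product_prob_space_retention)
  show ?thesis
    using emeasure_PiM_Collect[OF F(2,1), of "\<lambda>_. {b}"] by simp
qed

lemma sets_retention_Collect:
  assumes "finite F" "F \<subseteq> points \<mu>"
  shows "{r \<in> space (retention \<mu>). \<forall>z\<in>F. r z = b} \<in> sets (retention \<mu>)"
proof (intro sets.sets_Collect_finite_All assms)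
  fix z assume "z \<in> F"
  then have "(\<lambda>r. r z) \<in> retention \<mu> \<rightarrow>\<^sub>M measure_pmf (bernoulli_pmf (q z))"
    using assms by (intro measurable_component_singleton) auto
  then have "(\<lambda>r. r z) -` {b} \<inter> space (retention \<mu>) \<in> sets (retention \<mu>)"
    by (rule measurable_sets) simp
  also have "(\<lambda>r. r z) -` {b} \<inter> space (retention \<mu>) = {r \<in> space (retention \<mu>). r z = b}" by auto
  finally show "{r \<in> space (retention \<mu>). r z = b} \<in> sets (retention \<mu>)" .
qed

lemma dirac_sum_thinned:
  assumes "\<mu> \<in> configs E"
  shows "dirac_sum E {z \<in> points \<mu>. r z} \<in> configs E"
    and "points (dirac_sum E {z \<in> points \<mu>. r z}) = points \<mu> \<inter> {z. r z}"
proof -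
  interpret configuration E \<mu> by unfold_locales fact
  have lf: "locally_finite E {z \<in> points \<mu>. r z}"
    by (rule locally_finite_subset[OF locally_finite_points]) auto
  show "dirac_sum E {z \<in> points \<mu>. r z} \<in> configs E"
    by (rule dirac_sum_in_configs[OF lf])
  show "points (dirac_sum E {z \<in> points \<mu>. r z}) = points \<mu> \<inter> {z. r z}"
    using lf by (subst points_dirac_sum) (auto simp: locally_finite_def)
qed

lemma thinned_void:
  assumes "\<mu> \<in> configs E"
  shows "{r \<in> space (retention \<mu>). points (dirac_sum E {z \<in> points \<mu>. r z}) \<inter> C = {}} =
    {r \<in> space (retention \<mu>). \<forall>z\<in>points \<mu> \<inter> C. r z = False}"
  by (auto simp: dirac_sum_thinned[OF assms])

text \<open>Whether the thinned configuration avoids a bounded set depends on the finitely many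
  coins tossed at the points in that set, which is a cylinder event of the possibly infinite
  product.\<close>

lemma measurable_thinned:
  assumes "\<mu> \<in> configs E"
  shows "(\<lambda>r. dirac_sum E {z \<in> points \<mu>. r z}) \<in> retention \<mu> \<rightarrow>\<^sub>M config_space E"
proof (rule measurable_config_spaceI)
  interpret configuration E \<mu> by unfold_locales fact
  fix C assume "C \<in> bounded_sets E"
  then show "{r \<in> space (retention \<mu>). points (dirac_sum E {z \<in> points \<mu>. r z}) \<inter> C = {}}
      \<in> sets (retention \<mu>)"
    unfolding thinned_void[OF assms] by (intro sets_retention_Collect finite_points_bounded) auto
qed (rule dirac_sum_thinned[OF assms])

lemma prob_space_thinning_kernel:
  assumes "\<mu> \<in> configs E" shows "prob_space (thinning_kernel E q \<mu>)"
proof -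
  interpret product_prob_space "\<lambda>z. measure_pmf (bernoulli_pmf (q z))" "points \<mu>"
    by (rule product_prob_space_retention)
  show ?thesis
    unfolding thinning_kernel_def by (rule prob_space_distr[OF measurable_thinned[OF assms]])
qed

lemma sets_thinning_kernel [simp]: "sets (thinning_kernel E q \<mu>) = sets (config_space E)"
  by (simp add: thinning_kernel_def)

lemma emeasure_thinning_kernel_void:
  assumes "\<mu> \<in> configs E" and C: "C \<in> bounded_sets E"
  shows "emeasure (thinning_kernel E q \<mu>) (void C) = (\<Prod>z\<in>points \<mu> \<inter> C. ennreal (1 - q z))"
proof -
  interpret configuration E \<mu> by unfold_locales fact
  have "emeasure (thinning_kernel E q \<mu>) (void C) =
      emeasure (retention \<mu>) ((\<lambda>r. dirac_sum E {z \<in> points \<mu>. r z}) -` void C \<inter> space (retention \<mu>))"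
    unfolding thinning_kernel_def
    by (rule emeasure_distr[OF measurable_thinned[OF assms(1)] void_in_sets_config_space[OF C]])
  also have "(\<lambda>r. dirac_sum E {z \<in> points \<mu>. r z}) -` void C \<inter> space (retention \<mu>) =
      {r \<in> space (retention \<mu>). \<forall>z\<in>points \<mu> \<inter> C. r z = False}"
    unfolding thinned_void[OF assms(1), symmetric] by (auto simp: void_def dirac_sum_thinned[OF assms(1)])
  also have "emeasure (retention \<mu>) \<dots> = (\<Prod>z\<in>points \<mu> \<inter> C. emeasure (measure_pmf (bernoulli_pmf (q z)))
      {False})"
    using finite_points_bounded[OF C] by (rule emeasure_retention) auto
  also have "\<dots> = (\<Prod>z\<in>points \<mu> \<inter> C. ennreal (1 - q z))"
    using points_subset q_nonneg q_le_1 by (intro prod.cong refl) (auto simp: emeasure_pmf_single)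
  finally show ?thesis .
qed

text \<open>Only void events have to be tested. Their probability is a finite product over the
  points in \<open>C\<close>, and the difficulty is to write this product through integrals against
  \<mu>, whose measurability is known.\<close>

lemma measurable_thinning_kernel: "thinning_kernel E q \<in> config_space E \<rightarrow>\<^sub>M prob_algebra (config_space E)"
proof (rule measurable_prob_algebra_generated[OF sets_config_space_voids Int_stable_voids voids_Pow])
  fix A assume "A \<in> void ` bounded_sets E"
  then obtain C where C: "C \<in> bounded_sets E" and A: "A = void C" by auto
  let ?R = "restrict_space borel E"
  have [measurable]: "q \<in> borel_measurable ?R" by (rule measurable_q)
  have [measurable]: "C \<in> sets ?R" by (rule bounded_sets_in_E[OF C])
  define Full where "Full = {z \<in> space ?R. q z = 1} \<inter> C"
  have [measurable]: "Full \<in> sets ?R" unfolding Full_def by measurable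
  have h [measurable]: "(\<lambda>z. ennreal (- ln (1 - q z)) * indicator C z) \<in> borel_measurable ?R"
    by measurable
  txt \<open>The void probability \<open>\<Prod>z. 1 - q z\<close> is the exponential of an integral of \<open>ln (1 - q z)\<close>, but \<open>ln 0 = 0\<close>,
    so points with \<open>q z = 1\<close> are treated apart.\<close>
  have "(\<lambda>\<mu>. if emeasure \<mu> Full = 0 then ennreal (exp (- enn2real (\<integral>\<^sup>+z. ennreal (- ln (1 - q z)) *
      indicator C z \<partial>\<mu>))) else 0)
      \<in> borel_measurable (config_space E)"
  proof -
    have "(\<lambda>\<mu>. \<integral>\<^sup>+z. ennreal (- ln (1 - q z)) * indicator C z \<partial>\<mu>) \<in> borel_measurable (config_space E)"
      using measurable_nn_integral_config[of "\<lambda>\<mu>. \<mu>" "config_space E" "\<lambda>p. ennreal (- ln (1 - q (snd p))) *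
          indicator C (snd p)"]
      by (simp add: measurable_compose[OF measurable_snd h])
    moreover have "(\<lambda>\<mu>. emeasure \<mu> Full) \<in> borel_measurable (config_space E)"
      by (rule measurable_emeasure_config) measurable
    ultimately show ?thesis by measurable
  qed
  moreover have "emeasure (thinning_kernel E q \<mu>) A =
      (if emeasure \<mu> Full = 0 then ennreal (exp (- enn2real (\<integral>\<^sup>+z. ennreal (- ln (1 - q z)) * indicator C z
          \<partial>\<mu>))) else 0)"
    if \<mu>: "\<mu> \<in> configs E" for \<mu>
  proof -
    interpret configuration E \<mu> by unfold_locales fact
    have fin: "finite (points \<mu> \<inter> C)" by (rule finite_points_bounded[OF C])
    have "Full \<in> bounded_sets E"
      using sets.sets_into_space[of C ?R] \<open>Full \<in> sets ?R\<close>
        by (intro bounded_sets_subset[OF C]) (auto simp: Full_def sets_E_iff)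
    then have full: "emeasure \<mu> Full = 0 \<longleftrightarrow> (\<forall>z\<in>points \<mu> \<inter> C. q z \<noteq> 1)"
      using emeasure_eq_card[OF \<mu>, of Full] finite_points_bounded[of Full] points_subset
      by (auto simp: Full_def space_restrict_space)
    show ?thesis
    proof (cases "\<forall>z\<in>points \<mu> \<inter> C. q z \<noteq> 1")
      case True
      then have q: "0 \<le> q z" "q z < 1" if "z \<in> points \<mu> \<inter> C" for z
        using that points_subset q_nonneg[of z] q_le_1[of z] by (auto simp: less_le)
      have "(\<integral>\<^sup>+z. ennreal (- ln (1 - q z)) * indicator C z \<partial>\<mu>) =
          (\<integral>\<^sup>+z. ennreal (- ln (1 - q z)) \<partial>count_space (points \<mu> \<inter> C))"
        by (simp add: nn_integral_config nn_integral_count_space_inter)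
      also have "\<dots> = ennreal (\<Sum>z\<in>points \<mu> \<inter> C. - ln (1 - q z))"
        using fin q by (simp add: nn_integral_count_space_finite) (intro sum_ennreal, force)
      finally have "enn2real (\<integral>\<^sup>+z. ennreal (- ln (1 - q z)) * indicator C z \<partial>\<mu>) =
          (\<Sum>z\<in>points \<mu> \<inter> C. - ln (1 - q z))"
        using q by (simp only:, intro enn2real_ennreal sum_nonneg) force
      then have "exp (- enn2real (\<integral>\<^sup>+z. ennreal (- ln (1 - q z)) * indicator C z \<partial>\<mu>)) =
          (\<Prod>z\<in>points \<mu> \<inter> C. exp (ln (1 - q z)))"
        using fin by (simp add: sum_negf exp_sum)
      also have "\<dots> = (\<Prod>z\<in>points \<mu> \<inter> C. 1 - q z)"
        using q by (intro prod.cong refl exp_ln) auto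
      finally show ?thesis
      proof -
        have "(\<Prod>z\<in>points \<mu> \<inter> C. ennreal (1 - q z)) = ennreal (\<Prod>z\<in>points \<mu> \<inter> C. 1 - q z)"
          using q by (intro prod_ennreal) force
        then show ?thesis
          using full True \<open>exp _ = _\<close> \<open>(\<Prod>z\<in>_. exp _) = _\<close> unfolding A emeasure_thinning_kernel_void[OF \<mu> C]
            by simp
      qed
    next
      case False
      then obtain z where "z \<in> points \<mu> \<inter> C" "q z = 1" by auto
      then have "(\<Prod>z\<in>points \<mu> \<inter> C. ennreal (1 - q z)) = 0"
        using fin by (intro prod_zero bexI[of _ z]) auto
      with full False show ?thesis
        unfolding A emeasure_thinning_kernel_void[OF \<mu> C] by simp
    qed
  qed
  ultimately show "(\<lambda>\<mu>. emeasure (thinning_kernel E q \<mu>) A) \<in> borel_measurable (config_space E)"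
    by (subst measurable_cong) auto
qed (auto intro: prob_space_thinning_kernel)

lemma countable_tuples: "countable D \<Longrightarrow> countable (tuples k D)"
  by (rule countable_subset[of _ "{..<k} \<rightarrow>\<^sub>E D"]) (auto simp: tuples_def intro: countable_PiE)

text \<open>The points of a tuple are distinct, so their coins are independent and the tuple
  survives with the product of the retention probabilities. There are countably many tuples, which
  allows the expectation to move inside the sum.\<close>

lemma nn_integral_thinning_kernel_tuple_sum:
  assumes \<mu>: "\<mu> \<in> configs E"
    and f: "f \<in> borel_measurable (\<Pi>\<^sub>M i\<in>{..<k}. restrict_space borel E)"
  shows "(\<integral>\<^sup>+\<xi>. tuple_sum k f (points \<xi>) \<partial>thinning_kernel E q \<mu>) =
    tuple_sum k (\<lambda>x. f x * (\<Prod>i<k. ennreal (q (x i)))) (points \<mu>)"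
proof -
  interpret configuration E \<mu> by unfold_locales fact
  let ?T = "tuples k (points \<mu>)"
  let ?kept = "\<lambda>x. {r \<in> space (retention \<mu>). \<forall>z\<in>x ` {..<k}. r z = True}"
  have T: "finite (x ` {..<k})" "x ` {..<k} \<subseteq> points \<mu>" if "x \<in> ?T" for x
    using that by (auto simp: tuples_def)
  have kept: "?kept x \<in> sets (retention \<mu>)" if "x \<in> ?T" for x
    using T[OF that] by (rule sets_retention_Collect)
  have "(\<integral>\<^sup>+\<xi>. tuple_sum k f (points \<xi>) \<partial>thinning_kernel E q \<mu>) =
      (\<integral>\<^sup>+r. tuple_sum k f (points (dirac_sum E {z \<in> points \<mu>. r z})) \<partial>retention \<mu>)"
    unfolding thinning_kernel_def
    by (rule nn_integral_distr[OF measurable_thinned[OF \<mu>]]) (simp add: measurable_tuple_sum'[OF f])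
  also have "\<dots> = (\<integral>\<^sup>+r. \<integral>\<^sup>+x. f x * indicator (?kept x) r \<partial>count_space ?T \<partial>retention \<mu>)"
    by (intro nn_integral_cong, unfold dirac_sum_thinned(2)[OF \<mu>], unfold tuple_sum_inter, unfold
        tuple_sum_def)
       (auto intro!: nn_integral_cong simp: indicator_def tuples_def PiE_iff)
  also have "\<dots> = (\<integral>\<^sup>+x. \<integral>\<^sup>+r. f x * indicator (?kept x) r \<partial>retention \<mu> \<partial>count_space ?T)"
    using countable_tuples[OF countable_points[OF \<mu>]] kept
    by (intro nn_integral_count_space_nn_integral) auto
  also have "\<dots> = (\<integral>\<^sup>+x. f x * (\<Prod>i<k. ennreal (q (x i))) \<partial>count_space ?T)"
  proof (rule nn_integral_cong)
    fix x assume "x \<in> space (count_space ?T)"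
    then have x: "x \<in> ?T" by simp
    have "(\<integral>\<^sup>+r. f x * indicator (?kept x) r \<partial>retention \<mu>) = f x * emeasure (retention \<mu>) (?kept x)"
      using kept[OF x] by (rule nn_integral_cmult_indicator)
    also have "emeasure (retention \<mu>) (?kept x) =
        (\<Prod>z\<in>x ` {..<k}. emeasure (measure_pmf (bernoulli_pmf (q z))) {True})"
      using T[OF x] by (rule emeasure_retention)
    also have "\<dots> = (\<Prod>z\<in>x ` {..<k}. ennreal (q z))"
      using T(2)[OF x] points_subset q_nonneg q_le_1
        by (intro prod.cong refl) (force simp: emeasure_pmf_single)
    also have "\<dots> = (\<Prod>i<k. ennreal (q (x i)))"
      using x by (subst prod.reindex) (auto simp: tuples_def)
    finally show "(\<integral>\<^sup>+r. f x * indicator (?kept x) r \<partial>retention \<mu>) = f x * (\<Prod>i<k. ennreal (q (x i)))" .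
  qed
  finally show ?thesis by (simp add: tuple_sum_def)
qed

lemma
  assumes Q: "prob_space Q" "sets Q = sets (config_space E)"
  shows prob_space_thinning: "prob_space (thinning E q Q)"
    and sets_thinning: "sets (thinning E q Q) = sets (config_space E)"
    and nn_integral_thinning: "g \<in> borel_measurable (config_space E) \<Longrightarrow>
      (\<integral>\<^sup>+\<xi>. g \<xi> \<partial>thinning E q Q) = (\<integral>\<^sup>+\<mu>. \<integral>\<^sup>+\<xi>. g \<xi> \<partial>thinning_kernel E q \<mu> \<partial>Q)"
proof -
  have tk: "thinning_kernel E q \<in> Q \<rightarrow>\<^sub>M prob_algebra (config_space E)"
    using measurable_thinning_kernel by (simp add: measurable_cong_sets[OF Q(2) refl])
  have ne: "space Q \<noteq> {}" using Q(1) by (rule prob_space.not_empty)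

  show "prob_space (thinning E q Q)"
    unfolding thinning_def
    by (rule prob_space.prob_space_bind[OF Q(1) _ measurable_prob_algebraD[OF tk]])
       (use prob_space_thinning_kernel sets_eq_imp_space_eq[OF Q(2)] in auto)
  show "sets (thinning E q Q) = sets (config_space E)"
    unfolding thinning_def using ne by (intro sets_bind) auto
  show "(\<integral>\<^sup>+\<xi>. g \<xi> \<partial>thinning E q Q) = (\<integral>\<^sup>+\<mu>. \<integral>\<^sup>+\<xi>. g \<xi> \<partial>thinning_kernel E q \<mu> \<partial>Q)"
    if "g \<in> borel_measurable (config_space E)"
    unfolding thinning_def by (rule nn_integral_bind[OF that measurable_prob_algebraD[OF tk]])
qed

lemma nn_integral_thinning_tuple_sum:
  assumes Q: "prob_space Q" "sets Q = sets (config_space E)"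
    and f: "f \<in> borel_measurable (\<Pi>\<^sub>M i\<in>{..<k}. restrict_space borel E)"
  shows "(\<integral>\<^sup>+\<xi>. tuple_sum k f (points \<xi>) \<partial>thinning E q Q) =
    (\<integral>\<^sup>+\<mu>. tuple_sum k (\<lambda>x. f x * (\<Prod>i<k. ennreal (q (x i)))) (points \<mu>) \<partial>Q)"
  unfolding nn_integral_thinning[OF Q measurable_tuple_sum'[OF f]]
  using f sets_eq_imp_space_eq[OF Q(2)]
  by (intro nn_integral_cong nn_integral_thinning_kernel_tuple_sum) auto

end

section \<open>The half-plane\<close>

lemma restrict_borel_UNIV [simp]: "restrict_space borel UNIV = borel"
  by (rule measure_eqI) (auto simp: sets_restrict_space emeasure_restrict_space)

lemma open_upper_half_plane: "open upper_half_plane"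
  unfolding upper_half_plane_def by (rule open_halfspace_Im_gt)

global_interpretation HP: open_region upper_half_plane
  by unfold_locales (rule open_upper_half_plane)

global_interpretation RL: open_region "UNIV :: real set"
  by unfold_locales simp

abbreviation borel_H :: "complex measure" where
  "borel_H \<equiv> restrict_space borel upper_half_plane"

abbreviation lborel_H :: "complex measure" where
  "lborel_H \<equiv> restrict_space lborel upper_half_plane"

abbreviation (input) HC :: "complex measure measure" where
  "HC \<equiv> config_space upper_half_plane"

abbreviation borel_Hs :: "nat \<Rightarrow> (nat \<Rightarrow> complex) measure" where
  "borel_Hs k \<equiv> \<Pi>\<^sub>M i\<in>{..<k}. borel_H"

abbreviation lborel_Hs :: "nat \<Rightarrow> (nat \<Rightarrow> complex) measure" where
  "lborel_Hs k \<equiv> \<Pi>\<^sub>M i\<in>{..<k}. lborel_H"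

lemma sets_lborel_H: "sets lborel_H = sets borel_H"
  by (intro sets_restrict_space_cong sets_lborel)

lemma sigma_finite_lborel_H: "sigma_finite_measure lborel_H"
  by (intro sigma_finite_measure_restrict_space lborel.sigma_finite_measure_axioms) simp

global_interpretation LH: product_sigma_finite "\<lambda>_ :: nat. lborel_H"
  by (simp add: product_sigma_finite_def sigma_finite_lborel_H)

lemma measurable_borel_H_id: "(\<lambda>z. z) \<in> borel_H \<rightarrow>\<^sub>M borel"
  by (rule measurable_restrict_space1) simp

lemma measurable_PiM_H_component [measurable]:
  "i < k \<Longrightarrow> (\<lambda>x. x i) \<in> borel_Hs k \<rightarrow>\<^sub>M borel"
  using measurable_compose[OF measurable_component_singleton[of i "{..<k}" "\<lambda>_. borel_H"]
      measurable_borel_H_id]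
  by simp

lemma lborel_complex_eq: "(lborel :: complex measure) =
    distr (lborel \<Otimes>\<^sub>M lborel) borel (\<lambda>p. Complex (fst p) (snd p))"
proof (rule lborel_eqI)
  have m [measurable]: "(\<lambda>p. Complex (fst p) (snd p)) \<in> (lborel \<Otimes>\<^sub>M lborel) \<rightarrow>\<^sub>M borel"
    unfolding Complex_eq by measurable
  fix l u :: complex assume le: "\<And>b. b \<in> Basis \<Longrightarrow> l \<bullet> b \<le> u \<bullet> b"
  have le': "Re l \<le> Re u" "Im l \<le> Im u"
    using le[of 1] le[of \<i>] by (auto simp: Basis_complex_def inner_complex_def)
  have "(\<lambda>p. Complex (fst p) (snd p)) -` box l u \<inter> space (lborel \<Otimes>\<^sub>M lborel) =
      {Re l<..<Re u} \<times> {Im l<..<Im u}"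
    by (auto simp: box_def Basis_complex_def inner_complex_def space_pair_measure)
  then show "emeasure (distr (lborel \<Otimes>\<^sub>M lborel) borel (\<lambda>p. Complex (fst p) (snd p))) (box l u) =
      ennreal (\<Prod>b\<in>Basis. (u - l) \<bullet> b)"
    using le' by (subst emeasure_distr)
      (auto simp: lborel.emeasure_pair_measure_Times Basis_complex_def inner_complex_def ennreal_mult)
qed simp

text \<open>The abscissa is the inner variable: at a fixed height it will integrate to the length of
  the window \<open>B\<close>.\<close>

lemma nn_integral_lborel_complex:
  assumes "f \<in> borel_measurable borel"
  shows "(\<integral>\<^sup>+z. f z \<partial>(lborel :: complex measure)) = (\<integral>\<^sup>+y. \<integral>\<^sup>+x. f (Complex x y) \<partial>lborel \<partial>lborel)"
proof -
  have m [measurable]: "(\<lambda>p. Complex (fst p) (snd p)) \<in> (lborel \<Otimes>\<^sub>M lborel) \<rightarrow>\<^sub>M borel"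
    unfolding Complex_eq by measurable
  have "(\<integral>\<^sup>+z. f z \<partial>(lborel :: complex measure)) = (\<integral>\<^sup>+p. f (Complex (fst p) (snd p)) \<partial>(lborel \<Otimes>\<^sub>M lborel))"
    by (subst lborel_complex_eq, subst nn_integral_distr) (use assms in auto)
  also have "\<dots> = (\<integral>\<^sup>+y. \<integral>\<^sup>+x. f (Complex x y) \<partial>lborel \<partial>lborel)"
    using measurable_compose[OF m assms] by (subst lborel_pair.nn_integral_snd[symmetric]) auto
  finally show ?thesis .
qed

lemma vertical_line_null: "emeasure lborel_H {z \<in> upper_half_plane. Re z = c} = 0"
proof -
  have "{z. Re z = c} \<in> sets borel"
    by (intro borel_closed closed_Collect_eq continuous_intros)
  then have "emeasure lborel {z. Re z = c} = (\<integral>\<^sup>+y. \<integral>\<^sup>+x. indicator {z. Re z =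
      c} (Complex x y) \<partial>lborel \<partial>lborel)"
    by (subst nn_integral_indicator[symmetric], simp, subst nn_integral_lborel_complex) auto
  also have "\<dots> = integral\<^sup>N (lborel :: real measure) (\<lambda>y. \<integral>\<^sup>+x. indicator {c} x \<partial>lborel)"
    by (intro nn_integral_cong) (auto simp: indicator_def)
  finally have "emeasure lborel {z. Re z = c} = 0" by simp
  moreover have "emeasure lborel_H {z \<in> upper_half_plane. Re z = c} =
      emeasure lborel {z \<in> upper_half_plane. Re z = c}"
    by (subst emeasure_restrict_space) auto
  moreover have "emeasure lborel {z \<in> upper_half_plane. Re z = c} \<le> emeasure lborel {z. Re z = c}"
    using \<open>{z. Re z = c} \<in> sets borel\<close> by (intro emeasure_mono) auto
  ultimately show ?thesis by simp
qed

section \<open>Projection to the line\<close>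

text \<open>Characterises simple and locally finite images under \<open>Re\<close>
  (\<open>distr_Re_configs_iff\<close>). Windows indexed by natural numbers make it a countable
  condition, hence a measurable event.\<close>

definition good_projection :: "complex set \<Rightarrow> bool" where
  "good_projection D \<longleftrightarrow> inj_on Re D \<and> (\<forall>n::nat. finite (D \<inter> {z. \<bar>Re z\<bar> \<le> real n}))"

lemma Re_measurable_config: "\<xi> \<in> configs upper_half_plane \<Longrightarrow> Re \<in> \<xi> \<rightarrow>\<^sub>M borel"
proof -
  assume "\<xi> \<in> configs upper_half_plane"
  then interpret configuration upper_half_plane \<xi> by unfold_locales
  have "Re \<in> borel_H \<rightarrow>\<^sub>M borel" by (rule measurable_restrict_space1) simp
  then show ?thesis by (simp add: measurable_cong_sets[OF sets_config refl])
qed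

lemma vimage_Re_sets_borel_H: "A \<in> sets borel \<Longrightarrow> Re -` A \<inter> upper_half_plane \<in> sets borel_H"
proof -
  assume "A \<in> sets borel"
  moreover have "Re \<in> borel_H \<rightarrow>\<^sub>M borel" by (rule measurable_restrict_space1) simp
  ultimately have "Re -` A \<inter> space borel_H \<in> sets borel_H" by (rule measurable_sets[rotated])
  then show ?thesis by (simp only: space_restrict_space space_borel Int_UNIV_right)
qed

lemma emeasure_distr_Re:
  assumes "\<xi> \<in> configs upper_half_plane" "A \<in> sets borel"
  shows "emeasure (distr \<xi> borel Re) A = emeasure (count_space UNIV) (points \<xi> \<inter> Re -` A)"
proof -
  interpret configuration upper_half_plane \<xi> using assms(1) by unfold_locales
  have "emeasure (distr \<xi> borel Re) A = emeasure \<xi> (Re -` A \<inter> upper_half_plane)"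
    using assms Re_measurable_config by (subst emeasure_distr) (auto simp: space_config)
  also have "\<dots> = emeasure (count_space UNIV) (Re -` A \<inter> upper_half_plane \<inter> points \<xi>)"
    by (rule emeasure_config[OF vimage_Re_sets_borel_H[OF assms(2)]])
  also have "Re -` A \<inter> upper_half_plane \<inter> points \<xi> = points \<xi> \<inter> Re -` A"
    using points_subset by auto
  finally show ?thesis .
qed

lemma locally_finite_Re_image:
  assumes "good_projection D" shows "locally_finite UNIV (Re ` D)"
  unfolding locally_finite_def
proof (intro conjI allI impI)
  fix K :: "real set" assume "compact K \<and> K \<subseteq> UNIV"
  then have "bounded K" by (simp add: compact_imp_bounded)
  then obtain b where b: "\<And>x. x \<in> K \<Longrightarrow> \<bar>x\<bar> \<le> b"
    by (auto simp: bounded_iff)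
  obtain n :: nat where "b \<le> real n" using real_arch_simple by blast
  with b have "Re ` D \<inter> K \<subseteq> Re ` (D \<inter> {z. \<bar>Re z\<bar> \<le> real n})" by fastforce
  moreover have "finite (Re ` (D \<inter> {z. \<bar>Re z\<bar> \<le> real n}))"
    using assms by (auto simp: good_projection_def)
  ultimately show "finite (Re ` D \<inter> K)" by (rule finite_subset)
qed simp

lemma distr_Re_good:
  assumes \<xi>: "\<xi> \<in> configs upper_half_plane" and good: "good_projection (points \<xi>)"
  shows "distr \<xi> borel Re = dirac_sum UNIV (Re ` points \<xi>)"
proof (rule measure_eqI)
  fix A assume "A \<in> sets (distr \<xi> borel Re)"
  then have A: "A \<in> sets borel" by simp
  have "bij_betw Re (points \<xi> \<inter> Re -` A) (A \<inter> Re ` points \<xi>)"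
    using good by (auto simp: bij_betw_def good_projection_def inj_on_def)
  then have "emeasure (count_space UNIV) (points \<xi> \<inter> Re -` A) =
      emeasure (count_space UNIV) (A \<inter> Re ` points \<xi>)"
    by (auto simp: emeasure_count_space bij_betw_finite bij_betw_same_card)
  then show "emeasure (distr \<xi> borel Re) A = emeasure (dirac_sum UNIV (Re ` points \<xi>)) A"
    using A by (simp add: emeasure_distr_Re[OF \<xi>] emeasure_dirac_sum)
qed (simp add: sets_dirac_sum)

text \<open>For the converse: two points above the same abscissa would give it mass at least two,
  whereas a simple configuration gives a single real at most one; finiteness in a window is read off
  from the mass of a compact interval.\<close>

lemma distr_Re_configs_iff:
  assumes \<xi>: "\<xi> \<in> configs upper_half_plane"
  shows "distr \<xi> borel Re \<in> configs UNIV \<longleftrightarrow> good_projection (points \<xi>)"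
proof
  assume "good_projection (points \<xi>)"
  then show "distr \<xi> borel Re \<in> configs UNIV"
    using distr_Re_good[OF \<xi>] dirac_sum_in_configs[OF locally_finite_Re_image] by simp
next
  assume "distr \<xi> borel Re \<in> configs UNIV"
  then interpret p: configuration UNIV "distr \<xi> borel Re" by unfold_locales
  have em: "emeasure (count_space UNIV) (points \<xi> \<inter> Re -` A) =
      emeasure (count_space UNIV) (A \<inter> points (distr \<xi> borel Re))"
    if "A \<in> sets borel" for A
    using that p.emeasure_config[of A] by (simp add: emeasure_distr_Re[OF \<xi>])
  show "good_projection (points \<xi>)"
    unfolding good_projection_def
  proof (intro conjI allI inj_onI)
    fix z v assume zv: "z \<in> points \<xi>" "v \<in> points \<xi>" "Re z = Re v"
    show "z = v"
    proof (rule ccontr)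
      assume "z \<noteq> v"
      have "emeasure (count_space UNIV) {z, v} \<le> emeasure (count_space UNIV) (points \<xi> \<inter> Re -` {Re z})"
        using zv by (intro emeasure_mono) auto
      also have "\<dots> = emeasure (count_space UNIV) ({Re z} \<inter> points (distr \<xi> borel Re))"
        by (rule em) simp
      also have "\<dots> \<le> emeasure (count_space UNIV) {Re z}" by (intro emeasure_mono) auto
      finally show False using \<open>z \<noteq> v\<close> by (simp add: emeasure_count_space)
    qed
  next
    fix n :: nat
    have "finite (points (distr \<xi> borel Re) \<inter> {-real n..real n})"
      using p.locally_finite_points by (auto simp: locally_finite_def)
    then have "emeasure (count_space UNIV) (points \<xi> \<inter> Re -` {-real n..real n}) \<noteq> \<infinity>"
      by (subst em) (auto simp: emeasure_count_space Int_commute)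
    moreover have "points \<xi> \<inter> Re -` {-real n..real n} = points \<xi> \<inter> {z. \<bar>Re z\<bar> \<le> real n}" by auto
    ultimately show "finite (points \<xi> \<inter> {z. \<bar>Re z\<bar> \<le> real n})"
      by (auto simp: emeasure_count_space split: if_splits)
  qed
qed

lemma null_measure_borel_eq: "null_measure borel = dirac_sum UNIV ({} :: real set)"
  by (rule measure_eqI) (auto simp: sets_dirac_sum emeasure_dirac_sum)

lemma
  assumes \<xi>: "\<xi> \<in> configs upper_half_plane"
  shows proj_in_configs: "proj \<xi> \<in> configs UNIV"
    and points_proj_good: "good_projection (points \<xi>) \<Longrightarrow> points (proj \<xi>) = Re ` points \<xi>"
    and points_proj_bad: "\<not> good_projection (points \<xi>) \<Longrightarrow> points (proj \<xi>) = {}"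
  using distr_Re_configs_iff[OF \<xi>] dirac_sum_in_configs[of UNIV "{}"]
  by (auto simp: proj_def distr_Re_good[OF \<xi>] points_dirac_sum null_measure_borel_eq locally_finite_def)

text \<open>Injectivity of \<open>Re\<close> on a configuration is not visibly measurable; counting
  the ordered pairs of distinct points with equal abscissa turns it into the vanishing of a tuple
  sum.\<close>

definition coincident :: "(nat \<Rightarrow> complex) \<Rightarrow> ennreal" where
  "coincident = indicator {x. Re (x 0) = Re (x 1)}"

lemma coincident_sets: "{x \<in> space (borel_Hs 2). Re (x 0) = Re (x 1)} \<in> sets (borel_Hs 2)"
  by (intro measurable_equality_set measurable_compose[OF measurable_PiM_H_component borel_measurable_Re])
      auto

lemma coincident_measurable: "coincident \<in> borel_measurable (borel_Hs 2)"
  unfolding coincident_def using coincident_sets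
  by (subst borel_measurable_indicator_iff) (auto simp: Int_def conj_commute)

lemma tuple_sum_coincident_iff: "tuple_sum 2 coincident D = 0 \<longleftrightarrow> inj_on Re D"
proof
  assume "tuple_sum 2 coincident D = 0"
  then have *: "x \<in> tuples 2 D \<Longrightarrow> Re (x 0) \<noteq> Re (x 1)" for x
    by (auto simp: tuple_sum_eq_0_iff coincident_def)
  show "inj_on Re D"
  proof (rule inj_onI, rule ccontr)
    fix z v assume "z \<in> D" "v \<in> D" "Re z = Re v" "z \<noteq> v"
    have "inj_on (\<lambda>i\<in>{..<2}. if i = 0 then z else v) {..<2 :: nat}"
      using \<open>z \<noteq> v\<close> by (simp add: numeral_2_eq_2 lessThan_Suc)
    then have "(\<lambda>i\<in>{..<2}. if i = 0 then z else v) \<in> tuples 2 D"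
      using \<open>z \<in> D\<close> \<open>v \<in> D\<close> by (simp add: tuples_def)
    from *[OF this] \<open>Re z = Re v\<close> show False by simp
  qed
next
  assume inj: "inj_on Re D"
  have "Re (x 0) \<noteq> Re (x 1)" if "x \<in> tuples 2 D" for x
  proof
    assume "Re (x 0) = Re (x 1)"
    then have "x 0 = x 1"
      using that PiE_mem[of x "{..<2}" "\<lambda>_. D"] by (simp add: tuples_def inj_on_eq_iff[OF inj])
    moreover have "inj_on x {..<2}" using that by (simp add: tuples_def)
    ultimately show False
      using inj_onD[of x "{..<2}" 0 1] by simp
  qed
  then show "tuple_sum 2 coincident D = 0"
    by (auto simp: tuple_sum_eq_0_iff coincident_def)
qed

lemma good_projection_sets: "{\<xi> \<in> configs upper_half_plane. good_projection (points \<xi>)} \<in> sets HC"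
proof -
  let ?M = "HC"
  have "(\<lambda>\<xi>. tuple_sum 2 coincident (points \<xi>)) \<in> borel_measurable ?M"
    by (rule HP.measurable_tuple_sum'[OF coincident_measurable])
  moreover have "(\<lambda>\<xi>. emeasure \<xi> (Re -` {-real n..real n} \<inter> upper_half_plane))
      \<in> borel_measurable ?M" for n :: nat
    by (intro HP.measurable_emeasure_config vimage_Re_sets_borel_H) simp
  ultimately have "{\<xi> \<in> space ?M. tuple_sum 2 coincident (points \<xi>) = 0 \<and>
      (\<forall>n::nat. emeasure \<xi> (Re -` {-real n..real n} \<inter> upper_half_plane) \<noteq> \<infinity>)} \<in> sets ?M"
    by measurable
  also have "{\<xi> \<in> space ?M. tuple_sum 2 coincident (points \<xi>) = 0 \<and>
      (\<forall>n::nat. emeasure \<xi> (Re -` {-real n..real n} \<inter> upper_half_plane) \<noteq> \<infinity>)} =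
    {\<xi> \<in> configs upper_half_plane. good_projection (points \<xi>)}"
  proof -
    have "emeasure \<xi> (Re -` {-real n..real n} \<inter> upper_half_plane) \<noteq> \<infinity> \<longleftrightarrow> finite (points \<xi> \<inter> {z. \<bar>Re z\<bar> \<le>
        real n})"
      if "\<xi> \<in> configs upper_half_plane" for \<xi> n
    proof -
      interpret configuration upper_half_plane \<xi> using that by unfold_locales
      have "Re -` {-real n..real n} \<inter> upper_half_plane \<inter> points \<xi> = points \<xi> \<inter> {z. \<bar>Re z\<bar> \<le> real n}"
        using points_subset by auto
      then show ?thesis
        by (simp add: emeasure_config vimage_Re_sets_borel_H emeasure_count_space)
    qed
    then show ?thesis by (auto simp: good_projection_def tuple_sum_coincident_iff)
  qed
  finally show ?thesis .
qed

lemma measurable_proj: "proj \<in> HC \<rightarrow>\<^sub>M config_space UNIV"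
proof (rule RL.measurable_config_spaceI)
  let ?M = "HC"
  fix C :: "real set" assume "C \<in> bounded_sets UNIV"
  then have C: "C \<in> sets borel" by (rule RL.bounded_sets_borel)
  let ?G = "{\<xi> \<in> configs upper_half_plane. good_projection (points \<xi>)}"
  have "(\<lambda>\<xi>. emeasure \<xi> (Re -` C \<inter> upper_half_plane)) \<in> borel_measurable ?M"
    by (intro HP.measurable_emeasure_config vimage_Re_sets_borel_H C)
  then have "{\<xi> \<in> space ?M. emeasure \<xi> (Re -` C \<inter> upper_half_plane) = 0} \<in> sets ?M"
    by measurable
  \<comment> \<open>A bad configuration projects to the zero configuration, which avoids every
    \<open>C\<close>; this accounts for the complement of \<open>?G\<close>.\<close>
  then have "(space ?M - ?G) \<union> {\<xi> \<in> space ?M. emeasure \<xi> (Re -` C \<inter> upper_half_plane) = 0} \<in> sets ?M"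
    using good_projection_sets by blast
  also have "(space ?M - ?G) \<union> {\<xi> \<in> space ?M. emeasure \<xi> (Re -` C \<inter> upper_half_plane) = 0} =
      {\<xi> \<in> space ?M. points (proj \<xi>) \<inter> C = {}}"
  proof -
    have "emeasure \<xi> (Re -` C \<inter> upper_half_plane) = 0 \<longleftrightarrow> Re ` points \<xi> \<inter> C = {}"
      if "\<xi> \<in> configs upper_half_plane" for \<xi>
    proof -
      interpret configuration upper_half_plane \<xi> using that by unfold_locales
      have "Re -` C \<inter> upper_half_plane \<inter> points \<xi> = {} \<longleftrightarrow> Re ` points \<xi> \<inter> C = {}"
        using points_subset by auto
      then show ?thesis
        by (auto simp: emeasure_config vimage_Re_sets_borel_H[OF C] emeasure_count_space split: if_splits)
    qed
    then show ?thesis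
      by (auto simp: points_proj_good points_proj_bad) (metis points_proj_good points_proj_bad
          Int_empty_left disjoint_iff)+
  qed
  finally show "{\<xi> \<in> space ?M. points (proj \<xi>) \<inter> C = {}} \<in> sets ?M" .
qed (simp add: proj_in_configs)

section \<open>The kernels on the half-plane\<close>

lemma borel_measurable_K_H:
  assumes "f \<in> borel_measurable S" "g \<in> borel_measurable S"
  shows "(\<lambda>s. K_H (f s) (g s)) \<in> borel_measurable S"
proof -
  have "cnj \<in> borel_measurable borel"
    by (intro borel_measurable_continuous_onI continuous_intros)
  from measurable_compose[OF assms(2) this] assms(1) show ?thesis
    unfolding K_H_def by measurable
qed

lemma borel_measurable_K_H_palm:
  assumes "a \<in> borel_measurable S" "f \<in> borel_measurable S" "g \<in> borel_measurable S"
  shows "(\<lambda>s. K_H_palm (a s) (f s) (g s)) \<in> borel_measurable S"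
  unfolding K_H_palm_def using assms
  by (intro borel_measurable_diff borel_measurable_divide borel_measurable_times borel_measurable_K_H)

lemma K_H_diag: "K_H z z = complex_of_real (1 / (4 * pi * (Im z)\<^sup>2))"
proof -
  have "z - cnj z = 2 * \<i> * complex_of_real (Im z)" by (simp add: complex_eq_iff)
  then show ?thesis by (simp add: K_H_def power_mult_distrib mult_ac)
qed

lemma K_H_translate: "K_H (z + complex_of_real t) (\<zeta> + complex_of_real t) = K_H z \<zeta>"
  by (simp add: K_H_def)

lemma K_H_palm_translate:
  "K_H_palm (a + complex_of_real t) (z + complex_of_real t) (\<zeta> + complex_of_real t) = K_H_palm a z \<zeta>"
  by (simp add: K_H_palm_def K_H_translate)

abbreviation palm_K :: "real \<Rightarrow> complex \<Rightarrow> complex \<Rightarrow> complex" where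
  "palm_K y \<equiv> K_H_palm (\<i> * complex_of_real y)"

text \<open>The point \<open>z\<close> and the reflection of \<zeta> in the real axis are at least
  \<open>Im z + Im \<zeta>\<close> apart. One of the two lower bounds may be 0; this gives estimates
  at the point \<i> y that do not deteriorate as y tends to 0.\<close>

lemma norm_K_H_le:
  assumes "a \<le> Im z" "b \<le> Im \<zeta>" "0 \<le> a" "0 \<le> b" "0 < a + b"
  shows "cmod (K_H z \<zeta>) \<le> 1 / (pi * (a + b)\<^sup>2)"
proof -
  have "a + b \<le> \<bar>Im (z - cnj \<zeta>)\<bar>" using assms by simp
  also have "\<dots> \<le> cmod (z - cnj \<zeta>)" by (rule abs_Im_le_cmod)
  finally have "(a + b)\<^sup>2 \<le> (cmod (z - cnj \<zeta>))\<^sup>2" using assms by (intro power_mono) auto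
  then show ?thesis
    using assms by (simp add: K_H_def norm_divide norm_mult norm_power) (intro divide_left_mono
        mult_left_mono mult_pos_pos, auto)
qed

text \<open>The factor \<open>4 * pi * \<beta>\<^sup>2\<close> bounds the inverse of
  \<open>K_H\<close> on the diagonal at height \<open>y\<close>, which is where the upper bound on
  \<open>y\<close> enters; all other factors are bounded through the heights of the two arguments,
  uniformly in \<open>y\<close>.\<close>

lemma norm_K_H_palm_le:
  assumes "0 < a" "0 < y" "y \<le> \<beta>" "a \<le> Im z" "a \<le> Im \<zeta>"
  shows "cmod (palm_K y z \<zeta>) \<le> 1 / (pi * a\<^sup>2) + (1 / (pi * a\<^sup>2))\<^sup>2 * (4 * pi * \<beta>\<^sup>2)"
proof -
  let ?c = "1 / (pi * a\<^sup>2)" and ?y = "\<i> * complex_of_real y"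
  have 1: "cmod (K_H z \<zeta>) \<le> ?c" "cmod (K_H z ?y) \<le> ?c" "cmod (K_H ?y \<zeta>) \<le> ?c"
    using norm_K_H_le[of a z 0 \<zeta>] norm_K_H_le[of a z 0 ?y] norm_K_H_le[of 0 ?y a \<zeta>] assms by auto
  have "cmod (K_H z ?y * K_H ?y \<zeta> / K_H ?y ?y) = cmod (K_H z ?y) * cmod (K_H ?y \<zeta>) * (4 * pi * y\<^sup>2)"
    using assms by (simp add: K_H_diag norm_divide norm_mult norm_power)
  also have "\<dots> \<le> ?c * ?c * (4 * pi * \<beta>\<^sup>2)"
    using 1 assms by (intro mult_mono mult_nonneg_nonneg power_mono) auto
  finally have "cmod (K_H z ?y * K_H ?y \<zeta> / K_H ?y ?y) \<le> ?c\<^sup>2 * (4 * pi * \<beta>\<^sup>2)"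
    by (simp add: power2_eq_square)
  with 1(1) show ?thesis
    unfolding K_H_palm_def by (intro order_trans[OF norm_triangle_ineq4]) simp
qed

lemma kernel_det_K_H_Suc:
  assumes "0 < Im (x k)"
  shows "kernel_det K_H (Suc k) x = complex_of_real (1 / (4 * pi * (Im (x k))\<^sup>2)) *
      kernel_det (K_H_palm (x k)) k x"
proof -
  have "K_H (x k) (x k) \<noteq> 0" using assms by (simp add: K_H_diag)
  then show ?thesis
    using fdet_Schur[of "\<lambda>i j. K_H (x i) (x j)" k]
    by (simp add: kernel_det_fdet K_H_palm_def K_H_diag)
qed

lemma kernel_det_thinned_palm_kernel:
  assumes "\<And>i. i < k \<Longrightarrow> 0 \<le> w (Im (x i))"
  shows "kernel_det (thinned_palm_kernel w y) k x =
    complex_of_real (\<Prod>i<k. w (Im (x i))) * kernel_det (palm_K y) k x"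
proof -
  have "(\<Prod>i<k. complex_of_real (sqrt (w (Im (x i))))) * (\<Prod>i<k. complex_of_real (sqrt (w (Im (x i))))) =
      complex_of_real (\<Prod>i<k. w (Im (x i)))"
    unfolding prod.distrib[symmetric] of_real_prod
    using assms by (intro prod.cong) (auto simp: of_real_mult[symmetric] simp del: of_real_mult)
  then show ?thesis
    unfolding kernel_det_fdet thinned_palm_kernel_def
    by (subst fdet_mult_row_col) simp
qed

lemma bounded_sets_H_Im:
  assumes "C \<in> bounded_sets upper_half_plane"
  shows "\<exists>a>0. \<forall>z\<in>C. a \<le> Im z"
proof -
  obtain K where K: "compact K" "C \<subseteq> K" "K \<subseteq> upper_half_plane"
    using assms by (auto simp: bounded_sets_def)
  show ?thesis
  proof (cases "K = {}")
    case False
    obtain z where "z \<in> K" "\<And>v. v \<in> K \<Longrightarrow> Im z \<le> Im v"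
      using continuous_attains_inf[OF K(1) False, of Im] continuous_on_Im[OF continuous_on_id] by auto
    with K show ?thesis by (intro exI[of _ "Im z"]) (auto simp: upper_half_plane_def)
  qed (use K in \<open>auto intro: exI[of _ 1]\<close>)
qed

lemma K_H_palm_bounded:
  assumes "C \<in> bounded_sets upper_half_plane"
  shows "\<exists>c\<ge>0. \<forall>y z \<zeta>. 0 < y \<longrightarrow> y \<le> \<beta> \<longrightarrow> z \<in> C \<longrightarrow> \<zeta> \<in> C \<longrightarrow> cmod (palm_K y z \<zeta>) \<le> c"
proof -
  obtain a where a: "a > 0" "\<forall>z\<in>C. a \<le> Im z"
    using bounded_sets_H_Im[OF assms] by auto
  then show ?thesis
    by (intro exI[of _ "1 / (pi * a\<^sup>2) + (1 / (pi * a\<^sup>2))\<^sup>2 * (4 * pi * \<beta>\<^sup>2)"])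
       (auto intro!: norm_K_H_palm_le add_nonneg_nonneg)
qed

lemma emeasure_bounded_set_finite:
  fixes C :: "complex set"
  assumes "C \<in> bounded_sets E" shows "emeasure lborel C < \<infinity>"
proof -
  obtain K where K: "compact K" "C \<subseteq> K" "C \<in> sets borel"
    using assms by (auto simp: bounded_sets_def)
  have "emeasure lborel C \<le> emeasure lborel K"
    using K by (intro emeasure_mono) (auto simp: compact_imp_closed)
  also have "\<dots> < \<infinity>" by (rule emeasure_compact_finite[OF K(1)])
  finally show ?thesis .
qed

section \<open>Thinned processes in a horizontal strip\<close>

locale strip_weight =
  fixes \<alpha> \<beta> :: real and w :: "real \<Rightarrow> real"
  assumes \<alpha>_pos: "0 < \<alpha>" and \<alpha>_less_\<beta>: "\<alpha> < \<beta>" and weight: "w \<in> weights \<alpha> \<beta>"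
begin

lemma w_measurable: "w \<in> borel_measurable height_space"
  and w_nonneg: "0 < y \<Longrightarrow> 0 \<le> w y"
  and w_le_1: "0 < y \<Longrightarrow> w y \<le> 1"
  and w_outside: "0 < y \<Longrightarrow> y \<notin> {\<alpha>..\<beta>} \<Longrightarrow> w y = 0"
  and w_integral_pos: "0 < (LBINT y:{\<alpha>..\<beta>}. w y)"
  using weight by (auto simp: weights_def)

lemma w_Im_measurable: "(\<lambda>z. w (Im z)) \<in> borel_measurable borel_H"
proof (rule measurable_compose[OF _ w_measurable])
  show "Im \<in> borel_H \<rightarrow>\<^sub>M height_space"
    by (intro measurable_restrict_space2 measurable_restrict_space1) (auto simp: space_restrict_space
        upper_half_plane_def)
qed

sublocale thinned_region upper_half_plane "\<lambda>z. w (Im z)"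
  by unfold_locales (use w_Im_measurable w_nonneg w_le_1 in \<open>auto simp: upper_half_plane_def\<close>)

definition retain :: "nat \<Rightarrow> (nat \<Rightarrow> complex) \<Rightarrow> ennreal" where
  "retain k x = (\<Prod>i<k. ennreal (w (Im (x i))))"

lemma retain_measurable: "retain k \<in> borel_measurable (borel_Hs k)"
proof -
  have "(\<lambda>x. ennreal (w (Im (x i)))) \<in> borel_measurable (borel_Hs k)" if "i < k" for i
    using measurable_compose[OF measurable_component_singleton[of i "{..<k}" "\<lambda>_. borel_H"] w_Im_measurable]
        that by simp
  then show ?thesis
    unfolding retain_def[abs_def] by (intro borel_measurable_prod_ennreal) auto
qed

lemma retain_le_1: "x \<in> {..<k} \<rightarrow>\<^sub>E upper_half_plane \<Longrightarrow> retain k x \<le> 1"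
  unfolding retain_def using w_le_1
  by (intro prod_le_1) (auto simp: upper_half_plane_def PiE_iff ennreal_le_1)

lemma retain_outside:
  assumes "x \<in> {..<k} \<rightarrow>\<^sub>E upper_half_plane" "i < k" "Im (x i) \<notin> {\<alpha>..\<beta>}"
  shows "retain k x = 0"
  unfolding retain_def using assms w_outside[of "Im (x i)"]
  by (intro prod_zero bexI[of _ i]) (auto simp: PiE_iff upper_half_plane_def)

lemma space_PiM_lborel_H: "space (\<Pi>\<^sub>M i\<in>I. lborel_H) = I \<rightarrow>\<^sub>E upper_half_plane"
  by (simp add: space_PiM space_restrict_space)

text \<open>
  The determinant is taken of the unthinned kernel \<open>K\<close>: the factors \<open>\<surd>w\<close> of the rows and columns have
  been collected in \<open>retain\<close>.
\<close>

definition thinned_moments :: "(complex \<Rightarrow> complex \<Rightarrow> complex) \<Rightarrow> complex measure measure \<Rightarrow> bool" where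
  "thinned_moments K Q \<longleftrightarrow> prob_space Q \<and> sets Q = sets HC \<and>
     (\<forall>k. \<forall>f\<in>borel_measurable (borel_Hs k).
        (\<integral>\<^sup>+\<xi>. tuple_sum k f (points \<xi>) \<partial>Q) =
        (\<integral>\<^sup>+x. f x * (retain k x * ennreal (Re (kernel_det K k x))) \<partial>lborel_Hs k))"

lemma thinned_moments_thinning:
  assumes Z: "determinantal upper_half_plane K_H Z"
  shows "thinned_moments K_H (thinning upper_half_plane (\<lambda>z. w (Im z)) Z)"
  unfolding thinned_moments_def
proof (intro conjI allI ballI)
  note Q = HP.determinantal_prob_space[OF Z] HP.determinantal_sets[OF Z]
  show "prob_space (thinning upper_half_plane (\<lambda>z. w (Im z)) Z)" by (rule prob_space_thinning[OF Q])
  show "sets (thinning upper_half_plane (\<lambda>z. w (Im z)) Z) = sets HC"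
    by (rule sets_thinning[OF Q])
  fix k and f :: "(nat \<Rightarrow> complex) \<Rightarrow> ennreal" assume f: "f \<in> borel_measurable (borel_Hs k)"
  have "(\<lambda>p. K_H (fst p) (snd p)) \<in> borel_measurable (borel_H \<Otimes>\<^sub>M borel_H)"
    by (intro borel_measurable_K_H measurable_compose[OF measurable_fst measurable_borel_H_id]
        measurable_compose[OF measurable_snd measurable_borel_H_id])
  from HP.determinantal_tuple_sum[OF Z this borel_measurable_times_ennreal[OF f retain_measurable]]
  show "(\<integral>\<^sup>+\<xi>. tuple_sum k f (points \<xi>) \<partial>thinning upper_half_plane (\<lambda>z. w (Im z)) Z) =
      (\<integral>\<^sup>+x. f x * (retain k x * ennreal (Re (kernel_det K_H k x))) \<partial>lborel_Hs k)"
    by (simp add: nn_integral_thinning_tuple_sum[OF Q f] retain_def mult.assoc)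
qed

lemma thinned_moments_palm:
  assumes P: "determinantal upper_half_plane (thinned_palm_kernel w y) P"
  shows "thinned_moments (palm_K y) P"
  unfolding thinned_moments_def
proof (intro conjI allI ballI HP.determinantal_prob_space[OF P] HP.determinantal_sets[OF P])
  fix k and f :: "(nat \<Rightarrow> complex) \<Rightarrow> ennreal" assume f: "f \<in> borel_measurable (borel_Hs k)"
  note id = measurable_compose[OF measurable_fst measurable_borel_H_id] measurable_compose[OF measurable_snd
      measurable_borel_H_id]
  have w: "(\<lambda>p. w (Im (fst p))) \<in> borel_measurable (borel_H \<Otimes>\<^sub>M borel_H)"
    "(\<lambda>p. w (Im (snd p))) \<in> borel_measurable (borel_H \<Otimes>\<^sub>M borel_H)"
    using measurable_compose[OF measurable_fst w_Im_measurable] measurable_compose[OF measurable_snd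
        w_Im_measurable] by auto
  have "(\<lambda>p. palm_K y (fst p) (snd p)) \<in> borel_measurable (borel_H \<Otimes>\<^sub>M borel_H)"
    by (intro borel_measurable_K_H_palm id) simp
  then have "(\<lambda>p. thinned_palm_kernel w y (fst p) (snd p)) \<in> borel_measurable (borel_H \<Otimes>\<^sub>M borel_H)"
    unfolding thinned_palm_kernel_def using w by measurable
  from HP.determinantal_tuple_sum[OF P this f]
  have "(\<integral>\<^sup>+\<xi>. tuple_sum k f (points \<xi>) \<partial>P) =
      (\<integral>\<^sup>+x. f x * ennreal (Re (kernel_det (thinned_palm_kernel w y) k x)) \<partial>lborel_Hs k)" .
  also have "\<dots> = (\<integral>\<^sup>+x. f x * (retain k x * ennreal (Re (kernel_det (palm_K y) k x))) \<partial>lborel_Hs k)"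
  proof (rule nn_integral_cong)
    fix x assume "x \<in> space (lborel_Hs k)"
    then have "0 \<le> w (Im (x i))" if "i < k" for i
      using that w_nonneg unfolding space_PiM_lborel_H by (auto simp: PiE_iff upper_half_plane_def)
    then show "f x * ennreal (Re (kernel_det (thinned_palm_kernel w y) k x)) =
        f x * (retain k x * ennreal (Re (kernel_det (palm_K y) k x)))"
    proof -
      define r where "r = (\<Prod>i<k. w (Im (x i)))"
      have "retain k x = ennreal r" "0 \<le> r"
        using \<open>\<And>i. i < k \<Longrightarrow> 0 \<le> w (Im (x i))\<close> by (auto simp: retain_def r_def intro!: prod_ennreal
            prod_nonneg)
      moreover have "kernel_det (thinned_palm_kernel w y) k x =
          complex_of_real r * kernel_det (palm_K y) k x"
        unfolding r_def by (rule kernel_det_thinned_palm_kernel) fact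
      ultimately show ?thesis by (simp add: ennreal_mult')
    qed
  qed
  finally show "(\<integral>\<^sup>+\<xi>. tuple_sum k f (points \<xi>) \<partial>P) =
      (\<integral>\<^sup>+x. f x * (retain k x * ennreal (Re (kernel_det (palm_K y) k x))) \<partial>lborel_Hs k)" .
qed

text \<open>Once the first point is fixed, the second has to lie on a vertical line, which has no
  area.\<close>

lemma AE_coincident_abscissae: "AE x in lborel_Hs 2. Re (x 0) \<noteq> Re (x 1)"
proof -
  let ?A = "{x \<in> space (lborel_Hs 2). Re (x 0) = Re (x 1)}"
  from coincident_sets have A: "?A \<in> sets (lborel_Hs 2)"
    using HP.sets_PiM_lborel[of "{..<2::nat}"] by (simp add: space_PiM space_restrict_space)
  have ins: "{..<2::nat} = insert 1 {..<1}" by auto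
  have "emeasure (lborel_Hs 2) ?A = (\<integral>\<^sup>+x. indicator ?A x \<partial>lborel_Hs 2)"
    using A by simp
  also have "\<dots> = (\<integral>\<^sup>+x. \<integral>\<^sup>+y. indicator ?A (x(1 := y)) \<partial>lborel_H \<partial>lborel_Hs 1)"
    using A unfolding ins by (intro LH.product_nn_integral_insert) auto
  also have "\<dots> = (\<integral>\<^sup>+x. 0 \<partial>lborel_Hs 1)"
  proof (rule nn_integral_cong)
    fix x assume x: "x \<in> space (lborel_Hs 1)"
    have "(\<integral>\<^sup>+y. indicator ?A (x(1 := y)) \<partial>lborel_H) = (\<integral>\<^sup>+y. indicator {z \<in> upper_half_plane. Re z =
        Re (x 0)} y \<partial>lborel_H)"
      using x by (intro nn_integral_cong)
        (auto simp: indicator_def space_PiM space_restrict_space PiE_iff extensional_def less_2_cases_iff)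
    also have "\<dots> = emeasure lborel_H {z \<in> upper_half_plane. Re z = Re (x 0)}"
    proof (rule nn_integral_indicator)
      have "{z \<in> upper_half_plane. Re z = Re (x 0)} = Re -` {Re (x 0)} \<inter> upper_half_plane" by auto
      then show "{z \<in> upper_half_plane. Re z = Re (x 0)} \<in> sets lborel_H"
        using vimage_Re_sets_borel_H[of "{Re (x 0)}"] by (simp add: sets_lborel_H)
    qed
    finally show "(\<integral>\<^sup>+y. indicator ?A (x(1 := y)) \<partial>lborel_H) = 0" by (simp add: vertical_line_null)
  qed
  finally have "emeasure (lborel_Hs 2) ?A = 0" by simp
  with A show ?thesis by (intro AE_I[of _ _ ?A]) auto
qed

text \<open>Two tuple sums have expectation zero: the points outside the strip, where the weight
  vanishes, and the pairs with a common abscissa, which form a null set. Over a bounded window the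
  strip is a compact rectangle of the half-plane and holds finitely many points.\<close>

lemma AE_good_projection:
  assumes Q: "thinned_moments K Q"
  shows "AE \<xi> in Q. good_projection (points \<xi>)"
proof -
  have sQ: "sets Q = sets HC" using Q by (simp add: thinned_moments_def)
  have spQ: "space Q = configs upper_half_plane" using sets_eq_imp_space_eq[OF sQ] by simp
  have AE0: "AE \<xi> in Q. tuple_sum k f (points \<xi>) = 0"
    if f: "f \<in> borel_measurable (borel_Hs k)"
      and 0: "AE x in lborel_Hs k. f x * (retain k x * ennreal (Re (kernel_det K k x))) = 0" for k f
  proof -
    have "(\<integral>\<^sup>+\<xi>. tuple_sum k f (points \<xi>) \<partial>Q) =
        (\<integral>\<^sup>+x. f x * (retain k x * ennreal (Re (kernel_det K k x))) \<partial>lborel_Hs k)"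
      using Q f by (simp add: thinned_moments_def)
    also have "\<dots> = (\<integral>\<^sup>+x. 0 \<partial>lborel_Hs k)"
      using 0 by (rule nn_integral_cong_AE)
    finally have "(\<integral>\<^sup>+\<xi>. tuple_sum k f (points \<xi>) \<partial>Q) = 0" by simp
    moreover have "(\<lambda>\<xi>. tuple_sum k f (points \<xi>)) \<in> borel_measurable Q"
      using HP.measurable_tuple_sum'[OF f] by (simp add: measurable_cong_sets[OF sQ refl])
    ultimately show ?thesis by (simp add: nn_integral_0_iff_AE)
  qed
  define f1 where "f1 = (indicator {x. Im (x 0) \<notin> {\<alpha>..\<beta>}} :: (nat \<Rightarrow> complex) \<Rightarrow> ennreal)"
  have f1: "f1 \<in> borel_measurable (borel_Hs 1)"
  proof -
    have "(\<lambda>x. Im (x 0)) \<in> borel_Hs 1 \<rightarrow>\<^sub>M borel"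
      by (rule measurable_compose[OF measurable_PiM_H_component borel_measurable_Im]) simp
    from measurable_compose[OF this, of "indicator (- {\<alpha>..\<beta>}) :: real \<Rightarrow> ennreal"]
    show ?thesis by (simp add: f1_def indicator_def[abs_def])
  qed
  have "AE \<xi> in Q. tuple_sum 1 f1 (points \<xi>) = 0"
  proof (rule AE0[OF f1 AE_I2])
    fix x assume "x \<in> space (lborel_Hs 1)"
    then show "f1 x * (retain 1 x * ennreal (Re (kernel_det K 1 x))) = 0"
      using retain_outside[of x 1 0] by (auto simp: f1_def space_PiM_lborel_H indicator_def)
  qed
  then have strip: "AE \<xi> in Q. points \<xi> \<subseteq> {z. Im z \<in> {\<alpha>..\<beta>}}"
  proof (rule AE_mp, intro AE_I2 impI subsetI CollectI)
    fix \<xi> z assume *: "tuple_sum 1 f1 (points \<xi>) = 0" "z \<in> points \<xi>"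
    then have "(\<lambda>i\<in>{..<1}. z) \<in> tuples 1 (points \<xi>)" by (auto simp: tuples_def inj_on_def)
    with * show "Im z \<in> {\<alpha>..\<beta>}"
      by (auto simp: tuple_sum_eq_0_iff f1_def indicator_def dest!: bspec split: if_splits)
  qed
  have "AE \<xi> in Q. tuple_sum 2 coincident (points \<xi>) = 0"
    by (rule AE0[OF coincident_measurable AE_mp[OF AE_coincident_abscissae]]) (auto simp: coincident_def)
  with strip AE_space[of Q] show "AE \<xi> in Q. good_projection (points \<xi>)"
  proof eventually_elim
    case (elim \<xi>)
    then interpret configuration upper_half_plane \<xi> by unfold_locales (simp add: spQ)
    have "finite (points \<xi> \<inter> {z. \<bar>Re z\<bar> \<le> real n})" for n :: nat
    proof -
      define K where "K = cbox (Complex (- real n) \<alpha>) (Complex (real n) \<beta>)"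
      have K: "K = {z. \<bar>Re z\<bar> \<le> real n \<and> Im z \<in> {\<alpha>..\<beta>}}"
        by (auto simp: K_def cbox_def Basis_complex_def inner_complex_def)
      have "compact K" by (simp add: K_def)
      moreover have "K \<subseteq> upper_half_plane" using \<alpha>_pos by (auto simp: K upper_half_plane_def)
      ultimately have "finite (points \<xi> \<inter> K)"
        using locally_finite_points by (simp add: locally_finite_def)
      then show ?thesis
        by (rule finite_subset[rotated]) (use elim in \<open>auto simp: K\<close>)
    qed
    with elim show ?case by (simp add: good_projection_def tuple_sum_coincident_iff)
  qed
qed

text \<open>The factorial moment of order \<open>k\<close> of the number of points in
  \<open>C\<close> under any law with \<open>thinned_moments K\<close>; written through the kernel,
  so that it can be studied as a function of the height without mentioning the laws.\<close>

definition void_moment :: "(complex \<Rightarrow> complex \<Rightarrow> complex) \<Rightarrow> nat \<Rightarrow> complex set \<Rightarrow> ennreal" where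
  "void_moment K k C = (\<integral>\<^sup>+x. indicator ({..<k} \<rightarrow>\<^sub>E C) x * (retain k x * ennreal (Re (kernel_det K k x)))
     \<partial>lborel_Hs k)"

lemma PiE_sets_borel_H:
  fixes k :: nat
  assumes "C \<in> sets borel_H" shows "({..<k} \<rightarrow>\<^sub>E C) \<in> sets (borel_Hs k)"
  using assms by (intro sets_PiM_I_finite) auto

lemma indicator_PiE_measurable:
  "C \<in> sets borel_H \<Longrightarrow> (indicator ({..<k} \<rightarrow>\<^sub>E C) :: _ \<Rightarrow> ennreal) \<in> borel_measurable (borel_Hs k)"
  for k :: nat
  by (intro borel_measurable_indicator PiE_sets_borel_H)

lemma thinned_moments_void_moment:
  assumes "thinned_moments K Q" "C \<in> sets borel_H"
  shows "(\<integral>\<^sup>+\<xi>. tuple_sum k (indicator ({..<k} \<rightarrow>\<^sub>E C)) (points \<xi>) \<partial>Q) = void_moment K k C"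
  using assms indicator_PiE_measurable[OF assms(2)] by (simp add: thinned_moments_def void_moment_def)

text \<open>The weight is at most 1 and Hadamard's inequality bounds the determinant on the
  \<open>k\<close>-fold product of \<open>C\<close>, so the area of \<open>C\<close> merely
  multiplies the constant \<open>c\<close>.\<close>

lemma void_moment_le:
  assumes C: "C \<in> bounded_sets upper_half_plane" and c: "0 \<le> c"
    and K: "\<And>z \<zeta>. z \<in> C \<Longrightarrow> \<zeta> \<in> C \<Longrightarrow> cmod (K z \<zeta>) \<le> c"
  shows "void_moment K k C \<le> ennreal ((c * measure lborel C * sqrt k) ^ k)"
proof -
  have CH: "C \<in> sets borel_H" by (rule HP.bounded_sets_in_E[OF C])
  have C': "C \<subseteq> upper_half_plane" "C \<in> sets lborel_H"
    using CH sets_lborel_H by (auto simp: HP.sets_E_iff)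
  have "void_moment K k C \<le> (\<integral>\<^sup>+x. ennreal ((c * sqrt k) ^ k) * indicator ({..<k} \<rightarrow>\<^sub>E C) x \<partial>lborel_Hs k)"
    unfolding void_moment_def
  proof (rule nn_integral_mono)
    fix x assume x: "x \<in> space (lborel_Hs k)"
    show "indicator ({..<k} \<rightarrow>\<^sub>E C) x * (retain k x * ennreal (Re (kernel_det K k x))) \<le>
        ennreal ((c * sqrt k) ^ k) * indicator ({..<k} \<rightarrow>\<^sub>E C) x"
    proof (cases "x \<in> {..<k} \<rightarrow>\<^sub>E C")
      case True
      have "cmod (kernel_det K k x) \<le> (c * sqrt k) ^ k"
        unfolding kernel_det_fdet using True by (intro norm_fdet_le K) (auto simp: PiE_iff)
      then have "Re (kernel_det K k x) \<le> (c * sqrt k) ^ k"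
        using complex_Re_le_cmod order_trans by blast
      then have "retain k x * ennreal (Re (kernel_det K k x)) \<le> 1 * ennreal ((c * sqrt k) ^ k)"
        using retain_le_1[of x k] x unfolding space_PiM_lborel_H by (intro mult_mono ennreal_leI) auto
      with True show ?thesis by simp
    qed simp
  qed
  also have "\<dots> = ennreal ((c * sqrt k) ^ k) * emeasure (lborel_Hs k) ({..<k} \<rightarrow>\<^sub>E C)"
    using C' by (intro nn_integral_cmult_indicator sets_PiM_I_finite) auto
  also have "emeasure (lborel_Hs k) ({..<k} \<rightarrow>\<^sub>E C) = (\<Prod>i<k. emeasure lborel_H C)"
    using C' by (intro LH.emeasure_PiM) auto
  also have "emeasure lborel_H C = ennreal (measure lborel C)"
    using C' emeasure_bounded_set_finite[OF C]
      by (subst emeasure_restrict_space) (auto simp: emeasure_eq_ennreal_measure)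
  also have "ennreal ((c * sqrt k) ^ k) * (\<Prod>i<k. ennreal (measure lborel C)) =
      ennreal ((c * measure lborel C * sqrt k) ^ k)"
    using c by (simp add: ennreal_power ennreal_mult[symmetric] power_mult_distrib mult_ac)
  finally show ?thesis .
qed

lemma void_probability_series:
  assumes Q: "thinned_moments K Q" and C: "C \<in> bounded_sets upper_half_plane" and c: "0 \<le> c"
    and K: "\<And>z \<zeta>. z \<in> C \<Longrightarrow> \<zeta> \<in> C \<Longrightarrow> cmod (K z \<zeta>) \<le> c"
  shows "(\<lambda>n. \<Sum>k\<le>n. (-1) ^ k * (enn2real (void_moment K k C) / fact k)) \<longlonglongrightarrow> measure Q (HP.void C)"
proof (rule HP.void_probability_limit[OF _ _ C])
  have CH: "C \<in> sets borel_H" by (rule HP.bounded_sets_in_E[OF C])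
  interpret prob_space Q using Q by (simp add: thinned_moments_def)
  show "finite_measure Q" by unfold_locales
  show "sets Q = sets HC" using Q by (simp add: thinned_moments_def)
  note le = void_moment_le[of C c K, OF C c K]
  have fin: "void_moment K k C = ennreal (enn2real (void_moment K k C))" for k
    using le[of k] by (simp add: ennreal_enn2real_if) (metis ennreal_neq_top top.extremum_unique)
  show "(\<integral>\<^sup>+\<xi>. tuple_sum k (indicator ({..<k} \<rightarrow>\<^sub>E C)) (points \<xi>) \<partial>Q) =
      ennreal (fact k * (enn2real (void_moment K k C) / fact k))" for k
    using fin[of k] by (simp add: thinned_moments_void_moment[OF Q CH])
  show "0 \<le> enn2real (void_moment K k C) / fact k" for k by simp
  have "enn2real (void_moment K k C) \<le> (c * measure lborel C * sqrt k) ^ k" for k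
    using le[of k] c by (intro enn2real_leI) auto
  then have up: "enn2real (void_moment K k C) / fact k \<le> (c * measure lborel C * sqrt k) ^ k / fact k" for k
    by (intro divide_right_mono) auto
  have "(\<lambda>k. (c * measure lborel C * sqrt k) ^ k / fact k) \<longlonglongrightarrow> 0"
    using c by (intro Hadamard_growth) simp
  from tendsto_sandwich[OF _ _ tendsto_const[of 0] this]
  show "(\<lambda>k. enn2real (void_moment K k C) / fact k) \<longlonglongrightarrow> 0"
    using up by (simp add: always_eventually)
qed

lemma void_moment_palm_measurable:
  assumes "C \<in> sets borel_H"
  shows "(\<lambda>y. void_moment (palm_K y) k C) \<in> borel_measurable borel"
proof -
  let ?L = "\<Pi>\<^sub>M i\<in>{..<k}. lborel_H"
  interpret sigma_finite_measure ?L by (rule LH.sigma_finite) simp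
  have cong: "borel_measurable ?L = borel_measurable (borel_Hs k)"
    by (rule measurable_cong_sets[OF HP.sets_PiM_lborel refl])
  have comp: "(\<lambda>p. snd p i) \<in> borel \<Otimes>\<^sub>M ?L \<rightarrow>\<^sub>M borel" if "i < k" for i
    using measurable_compose[OF measurable_snd, of "\<lambda>x. x i" ?L borel borel] that
        measurable_PiM_H_component[OF that]
    by (simp add: cong)
  have "(\<lambda>p. ennreal (Re (kernel_det (palm_K (fst p)) k (snd p)))) \<in> borel_measurable (borel \<Otimes>\<^sub>M ?L)"
    by (intro HP.borel_measurable_kernel_det borel_measurable_K_H_palm comp) measurable
  moreover have "(\<lambda>p. indicator ({..<k} \<rightarrow>\<^sub>E C) (snd p) * retain k (snd p))
      \<in> borel_measurable (borel \<Otimes>\<^sub>M ?L)"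
    using indicator_PiE_measurable[OF assms] retain_measurable
    by (intro measurable_compose[OF measurable_snd] borel_measurable_times_ennreal) (simp_all add: cong)
  ultimately have "(\<lambda>p. indicator ({..<k} \<rightarrow>\<^sub>E C) (snd p) *
      (retain k (snd p) * ennreal (Re (kernel_det (palm_K (fst p)) k (snd p)))))
          \<in> borel_measurable (borel \<Otimes>\<^sub>M ?L)"
    unfolding mult.assoc[symmetric] by (rule borel_measurable_times_ennreal[rotated])
  then show ?thesis
    unfolding void_moment_def by (intro borel_measurable_nn_integral) (simp add: split_beta')
qed

text \<open>Void probabilities are pointwise limits of partial sums of void moments, and those are
  measurable in the height by Fubini.\<close>

lemma measurable_palm_kernel:
  assumes P: "\<And>y. 0 < y \<Longrightarrow> thinned_moments (palm_K y) (P y)"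
  shows "P \<in> height_space \<rightarrow>\<^sub>M prob_algebra HC"
proof (rule measurable_prob_algebra_generated[OF HP.sets_config_space_voids HP.Int_stable_voids
    HP.voids_Pow])
  fix A assume "A \<in> HP.void ` bounded_sets upper_half_plane"
  then obtain C where C: "C \<in> bounded_sets upper_half_plane" and A: "A = HP.void C" by auto
  have CH: "C \<in> sets borel_H" by (rule HP.bounded_sets_in_E[OF C])
  have lim: "(\<lambda>n. \<Sum>k\<le>n. (-1) ^ k * (enn2real (void_moment (palm_K y) k C) / fact k))
      \<longlonglongrightarrow> measure (P y) A" if y: "0 < y" for y
  proof -
    \<comment> \<open>\<open>K_H_palm_bounded\<close> is used with the height itself as upper bound;
      the constant then depends on \<open>y\<close>, which pointwise convergence tolerates.\<close>
    obtain c where "c \<ge> 0" "\<And>z \<zeta>. z \<in> C \<Longrightarrow> \<zeta> \<in> C \<Longrightarrow> cmod (palm_K y z \<zeta>) \<le> c"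
      using K_H_palm_bounded[OF C, of y] y by auto
    from void_probability_series[OF P[OF y] C this] show ?thesis by (simp add: A)
  qed
  have "(\<lambda>y. \<Sum>k\<le>n. (-1) ^ k * (enn2real (void_moment (palm_K y) k C) / fact k))
      \<in> borel_measurable height_space" for n
  proof -
    have "(\<lambda>y. void_moment (palm_K y) k C) \<in> borel_measurable height_space" for k
      by (rule measurable_restrict_space1[OF void_moment_palm_measurable[OF CH]])
    then show ?thesis by measurable
  qed
  then have "(\<lambda>y. measure (P y) A) \<in> borel_measurable height_space"
    by (rule borel_measurable_LIMSEQ_real[rotated]) (use lim in \<open>simp add: space_restrict_space\<close>)
  then have "(\<lambda>y. ennreal (measure (P y) A)) \<in> borel_measurable height_space" by measurable
  moreover have "emeasure (P y) A = ennreal (measure (P y) A)" if "y \<in> space height_space" for y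
  proof -
    interpret prob_space "P y" using P[of y] that by (simp add: thinned_moments_def space_restrict_space)
    show ?thesis by (rule emeasure_eq_measure)
  qed
  ultimately show "(\<lambda>y. emeasure (P y) A) \<in> borel_measurable height_space"
    by (subst measurable_cong) auto
qed (use P in \<open>auto simp: thinned_moments_def space_restrict_space\<close>)

end

section \<open>The Campbell measure on the line\<close>

lemma distr_dirac_sum:
  assumes D: "D \<subseteq> E" and \<phi>: "\<phi> \<in> restrict_space borel E \<rightarrow>\<^sub>M borel" "inj_on \<phi> D"
  shows "distr (dirac_sum E D) borel \<phi> = dirac_sum UNIV (\<phi> ` D)"
proof (rule measure_eqI)
  fix A assume "A \<in> sets (distr (dirac_sum E D) borel \<phi>)"
  then have A: "A \<in> sets borel" by simp
  have \<phi>': "\<phi> \<in> dirac_sum E D \<rightarrow>\<^sub>M borel"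
    using \<phi>(1) by (simp add: measurable_cong_sets[OF sets_dirac_sum refl])
  have pre: "\<phi> -` A \<inter> E \<in> sets (restrict_space borel E)"
    using measurable_sets[OF \<phi>(1) A] by (simp add: space_restrict_space)
  have "bij_betw \<phi> (\<phi> -` A \<inter> E \<inter> D) (A \<inter> \<phi> ` D)"
    using \<phi>(2) D by (auto simp: bij_betw_def inj_on_def)
  then have "emeasure (count_space UNIV) (\<phi> -` A \<inter> E \<inter> D) = emeasure (count_space UNIV) (A \<inter> \<phi> ` D)"
    by (auto simp: emeasure_count_space bij_betw_finite bij_betw_same_card)
  then show "emeasure (distr (dirac_sum E D) borel \<phi>) A = emeasure (dirac_sum UNIV (\<phi> ` D)) A"
    using A by (simp add: emeasure_distr[OF \<phi>' A] emeasure_dirac_sum[OF D pre] emeasure_dirac_sum)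
qed (simp add: sets_dirac_sum)

text \<open>As \<open>x\<close> is a point of \<open>D\<close>, a Borel set containing
  \<open>x\<close> has mass at least 1, so the truncated subtraction of extended reals is exact on
  every Borel set, infinite masses included.\<close>

lemma remove_point_dirac_sum:
  assumes "x \<in> D"
  shows "remove_point x (dirac_sum UNIV D) = dirac_sum UNIV (D - {x})"
proof -
  have eq: "emeasure (dirac_sum UNIV D) A - emeasure (return borel x) A =
      emeasure (dirac_sum UNIV (D - {x})) A"
    if A: "A \<in> sets borel" for A
  proof (cases "x \<in> A")
    case True
    have "emeasure (count_space UNIV) (A \<inter> (D - {x})) + emeasure (count_space UNIV) {x} =
        emeasure (count_space UNIV) (A \<inter> (D - {x}) \<union> {x})"
      by (rule plus_emeasure) auto
    also have "A \<inter> (D - {x}) \<union> {x} = A \<inter> D" using True assms by auto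
    finally have "emeasure (dirac_sum UNIV D) A = emeasure (dirac_sum UNIV (D - {x})) A + 1"
      using A by (simp add: emeasure_dirac_sum)
    then show ?thesis using True A by simp
  next
    case False
    then have "A \<inter> D = A \<inter> (D - {x})" by auto
    with False A show ?thesis by (simp add: emeasure_dirac_sum)
  qed
  have "remove_point x (dirac_sum UNIV D) =
      measure_of UNIV (sets borel) (\<lambda>A. emeasure (dirac_sum UNIV D) A - emeasure (return borel x) A)"
    by (simp add: remove_point_def diff_measure_def sets_dirac_sum)
  also have "\<dots> = measure_of UNIV (sets borel) (emeasure (dirac_sum UNIV (D - {x})))"
    using eq sets.sigma_sets_eq[of "borel :: real measure"] by (intro measure_of_eq) auto
  also have "\<dots> = dirac_sum UNIV (D - {x})"
    using measure_of_of_measure[of "dirac_sum UNIV (D - {x})"] by (simp add: sets_dirac_sum)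
  finally show ?thesis .
qed

text \<open>
  Agrees with \<open>translate x (remove_point x \<mu>)\<close> if \<open>x\<close> is a point of \<open>\<mu>\<close>, and stays a configuration,
  depending measurably on \<open>(x, \<mu>)\<close>, if it is not.
\<close>

definition reduced :: "real \<Rightarrow> real measure \<Rightarrow> real measure" where
  "reduced x \<mu> = dirac_sum UNIV ((\<lambda>u. u - x) ` (points \<mu> - {x}))"

lemma translate_remove_point:
  assumes "\<mu> \<in> configs UNIV" "x \<in> points \<mu>"
  shows "translate x (remove_point x \<mu>) = reduced x \<mu>"
proof -
  interpret configuration UNIV \<mu> using assms(1) by unfold_locales
  have "remove_point x \<mu> = dirac_sum UNIV (points \<mu> - {x})"
    using remove_point_dirac_sum[OF assms(2)] by (simp add: dirac_sum_points)
  then show ?thesis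
    by (simp add: translate_def reduced_def distr_dirac_sum inj_on_def)
qed

lemma points_reduced: "points (reduced x \<mu>) = (\<lambda>u. u - x) ` (points \<mu> - {x})"
  by (simp add: reduced_def points_dirac_sum)

lemma reduced_in_configs:
  assumes "\<mu> \<in> configs UNIV" shows "reduced x \<mu> \<in> configs UNIV"
  unfolding reduced_def
proof (intro dirac_sum_in_configs, unfold locally_finite_def, intro conjI allI impI)
  interpret configuration UNIV \<mu> using assms by unfold_locales
  fix K :: "real set" assume "compact K \<and> K \<subseteq> UNIV"
  then have "compact ((+) x ` K)" by (intro compact_translation) auto
  then have "finite (points \<mu> \<inter> (+) x ` K)"
    using locally_finite_points by (simp add: locally_finite_def)
  then have "finite ((\<lambda>u. u - x) ` (points \<mu> \<inter> (+) x ` K))" by simp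
  then show "finite ((\<lambda>u. u - x) ` (points \<mu> - {x}) \<inter> K)"
    by (rule finite_subset[rotated]) (auto intro!: image_eqI)
qed simp

text \<open>The reduced configuration avoids \<open>C\<close> iff the indicator of \<open>C\<close>
  shifted by \<open>x\<close>, with the point \<open>x\<close> itself blanked out, has integral zero
  against \<mu>; this integral is jointly measurable in \<open>x\<close> and \<mu>.\<close>

lemma measurable_reduced: "(\<lambda>p. reduced (fst p) (snd p)) \<in> borel \<Otimes>\<^sub>M config_space UNIV
    \<rightarrow>\<^sub>M config_space UNIV"
proof (rule RL.measurable_config_spaceI)
  let ?S = "borel \<Otimes>\<^sub>M config_space UNIV :: (real \<times> real measure) measure"
  fix C :: "real set" assume "C \<in> bounded_sets UNIV"
  then have C [measurable]: "C \<in> sets borel" by (rule RL.bounded_sets_borel)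
  define g where "g = (\<lambda>p :: (real \<times> real measure) \<times> real. indicator C (snd p - fst (fst p)) * (if snd p =
      fst (fst p) then 0 else 1 :: ennreal))"
  have [measurable]: "g \<in> borel_measurable (?S \<Otimes>\<^sub>M borel)"
    unfolding g_def by measurable
  have "(\<lambda>s. \<integral>\<^sup>+u. g (s, u) \<partial>snd s) \<in> borel_measurable ?S"
    by (rule RL.measurable_nn_integral_config) simp_all
  then have "{s \<in> space ?S. (\<integral>\<^sup>+u. g (s, u) \<partial>snd s) = 0} \<in> sets ?S" by measurable
  also have "{s \<in> space ?S. (\<integral>\<^sup>+u. g (s, u) \<partial>snd s) = 0} =
      {s \<in> space ?S. points (reduced (fst s) (snd s)) \<inter> C = {}}"
  proof -
    have "(\<integral>\<^sup>+u. g ((x, \<mu>), u) \<partial>\<mu>) = 0 \<longleftrightarrow> points (reduced x \<mu>) \<inter> C = {}" if "\<mu> \<in> configs UNIV" for x \<mu>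
    proof -
      interpret configuration UNIV \<mu> using that by unfold_locales
      have "(\<lambda>u. g ((x, \<mu>), u)) \<in> borel_measurable borel"
        unfolding g_def by simp
      then have "(\<integral>\<^sup>+u. g ((x, \<mu>), u) \<partial>\<mu>) = 0 \<longleftrightarrow> (\<forall>u\<in>points \<mu>. g ((x, \<mu>), u) = 0)"
        by (subst nn_integral_config) (auto simp: nn_integral_0_iff_AE AE_count_space)
      also have "\<dots> \<longleftrightarrow> points (reduced x \<mu>) \<inter> C = {}"
        by (auto simp: points_reduced g_def indicator_def split: if_splits)
      finally show ?thesis .
    qed
    then show ?thesis by (auto simp: space_pair_measure)
  qed
  finally show "{s \<in> space ?S. points (reduced (fst s) (snd s)) \<inter> C = {}} \<in> sets ?S" .
qed (auto simp: space_pair_measure reduced_in_configs)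

text \<open>The sum over points of the Palm formula as an integral against \<mu>, meaningful in
  \<open>ennreal\<close> also when \<open>B\<close> catches infinitely many points;
  \<open>palm_sum_eq\<close> returns to the finite sum.\<close>

definition palm_sum :: "real set \<Rightarrow> (real measure \<Rightarrow> ennreal) \<Rightarrow> real measure \<Rightarrow> ennreal" where
  "palm_sum B g \<mu> = (\<integral>\<^sup>+x. indicator B x * g (reduced x \<mu>) \<partial>\<mu>)"

lemma
  assumes B: "B \<in> sets borel" and g: "g \<in> borel_measurable (config_space UNIV)"
  shows measurable_palm_sum: "palm_sum B g \<in> borel_measurable (config_space UNIV)"
    and palm_sum_integrand_measurable:
      "\<mu> \<in> configs UNIV \<Longrightarrow> (\<lambda>x. indicator B x * g (reduced x \<mu>)) \<in> borel_measurable borel"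
proof -
  have sw: "(\<lambda>p. (snd p, fst p)) \<in> config_space UNIV \<Otimes>\<^sub>M borel
      \<rightarrow>\<^sub>M borel \<Otimes>\<^sub>M config_space (UNIV :: real set)"
    by measurable
  have "(\<lambda>p. g (reduced (snd p) (fst p))) \<in> borel_measurable (config_space UNIV \<Otimes>\<^sub>M borel)"
    using measurable_compose[OF measurable_compose[OF sw measurable_reduced] g] by simp
  then have m: "(\<lambda>p. indicator B (snd p) * g (reduced (snd p) (fst p)))
      \<in> borel_measurable (config_space UNIV \<Otimes>\<^sub>M borel)"
    using B by measurable
  show "palm_sum B g \<in> borel_measurable (config_space UNIV)"
    unfolding palm_sum_def[abs_def]
    using RL.measurable_nn_integral_config[of "\<lambda>\<mu>. \<mu>" "config_space UNIV" "\<lambda>p. indicator B (snd p) *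
        g (reduced (snd p) (fst p))"] m
    by simp
  show "(\<lambda>x. indicator B x * g (reduced x \<mu>)) \<in> borel_measurable borel" if "\<mu> \<in> configs UNIV"
    using measurable_compose[OF measurable_Pair1'[of \<mu> "config_space UNIV" borel] m] that by simp
qed

lemma palm_sum_eq:
  assumes B: "B \<in> sets borel" "bounded B" and g: "g
      \<in> borel_measurable (config_space UNIV)" and \<mu>: "\<mu> \<in> configs UNIV"
  shows "finite (points \<mu> \<inter> B)"
    and "palm_sum B g \<mu> = (\<Sum>x\<in>points \<mu> \<inter> B. g (translate x (remove_point x \<mu>)))"
proof -
  interpret configuration UNIV \<mu> using \<mu> by unfold_locales
  have "B \<in> bounded_sets UNIV"
    using B compact_closure[of B] closure_subset[of B]
      by (auto simp: bounded_sets_def intro!: exI[of _ "closure B"])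
  then show fin: "finite (points \<mu> \<inter> B)" by (rule finite_points_bounded)
  have "palm_sum B g \<mu> = (\<integral>\<^sup>+x. g (reduced x \<mu>) * indicator B x \<partial>count_space (points \<mu>))"
    using palm_sum_integrand_measurable[OF B(1) g \<mu>]
      by (simp add: palm_sum_def nn_integral_config mult.commute)
  also have "\<dots> = (\<Sum>x\<in>points \<mu> \<inter> B. g (reduced x \<mu>))"
    using fin by (simp add: nn_integral_count_space_inter[symmetric] nn_integral_count_space_finite)
  finally show "palm_sum B g \<mu> = (\<Sum>x\<in>points \<mu> \<inter> B. g (translate x (remove_point x \<mu>)))"
    using translate_remove_point[OF \<mu>] by simp
qed

text \<open>The mean number of points in \<open>B\<close> from which the rest of the configuration
  looks like a member of \<open>A\<close>. For fixed \<open>B\<close> this is a measure in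
  \<open>A\<close>, so that the Palm formula becomes an equality of two measures on
  configurations.\<close>

definition campbell :: "real measure measure \<Rightarrow> real set \<Rightarrow> real measure measure" where
  "campbell Q B = measure_of (configs UNIV) (sets (config_space UNIV)) (\<lambda>A. \<integral>\<^sup>+\<mu>. palm_sum B (indicator A) \<mu>
      \<partial>Q)"

lemma sets_campbell [simp]: "sets (campbell Q B) = sets (config_space UNIV)"
  and space_campbell [simp]: "space (campbell Q B) = configs UNIV"
proof -
  have *: "sets (config_space UNIV) \<subseteq> Pow (configs (UNIV :: real set))"
    using sets.space_closed[of "config_space (UNIV :: real set)"] by simp
  show "sets (campbell Q B) = sets (config_space UNIV)"
    using * sets.sigma_sets_eq[of "config_space (UNIV :: real set)"]
      by (simp add: campbell_def sets_measure_of)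
  show "space (campbell Q B) = configs UNIV"
    by (simp add: campbell_def space_measure_of_conv)
qed

section \<open>Integration against the Campbell measure\<close>

context
  fixes Q :: "real measure measure" and B :: "real set"
  assumes Q: "sets Q = sets (config_space UNIV)" and B: "B \<in> sets borel"
begin

lemma space_Q: "space Q = configs UNIV"
  using sets_eq_imp_space_eq[OF Q] by simp

lemma palm_sum_measurable_Q: "g \<in> borel_measurable (config_space UNIV) \<Longrightarrow> palm_sum B g \<in> borel_measurable Q"
  using measurable_palm_sum[OF B] by (simp add: measurable_cong_sets[OF Q refl])

lemma palm_sum_integrand_measurable_config:
  fixes g :: "real measure \<Rightarrow> ennreal"
  assumes "\<mu> \<in> configs UNIV" "g \<in> borel_measurable (config_space UNIV)"
  shows "(\<lambda>x. indicator B x * g (reduced x \<mu>)) \<in> borel_measurable \<mu>"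
proof -
  interpret configuration UNIV \<mu> using assms(1) by unfold_locales
  show ?thesis
    using palm_sum_integrand_measurable[OF B assms(2,1)]
      by (simp add: measurable_cong_sets[OF sets_config refl])
qed

lemma emeasure_campbell:
  assumes A: "A \<in> sets (config_space UNIV)"
  shows "emeasure (campbell Q B) A = (\<integral>\<^sup>+\<mu>. palm_sum B (indicator A) \<mu> \<partial>Q)"
proof (rule emeasure_measure_of[OF campbell_def])
  show "sets (config_space UNIV) \<subseteq> Pow (configs (UNIV :: real set))"
    using sets.space_closed[of "config_space (UNIV :: real set)"] by simp
  show "A \<in> sets (campbell Q B)" using A by simp
  show "positive (sets (campbell Q B)) (\<lambda>A. \<integral>\<^sup>+\<mu>. palm_sum B (indicator A) \<mu> \<partial>Q)"
    by (simp add: positive_def palm_sum_def)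
  show "countably_additive (sets (campbell Q B)) (\<lambda>A. \<integral>\<^sup>+\<mu>. palm_sum B (indicator A) \<mu> \<partial>Q)"
  proof (rule countably_additiveI)
    fix F :: "nat \<Rightarrow> real measure set"
    assume "range F \<subseteq> sets (campbell Q B)" and disj: "disjoint_family F"
    then have F: "F i \<in> sets (config_space UNIV)" for i by auto
    have "(\<Sum>i. \<integral>\<^sup>+\<mu>. palm_sum B (indicator (F i)) \<mu> \<partial>Q) = (\<integral>\<^sup>+\<mu>. (\<Sum>i. palm_sum B (indicator (F i)) \<mu>) \<partial>Q)"
      using F by (intro nn_integral_suminf[symmetric] palm_sum_measurable_Q) auto
    also have "\<dots> = (\<integral>\<^sup>+\<mu>. palm_sum B (indicator (\<Union>i. F i)) \<mu> \<partial>Q)"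
    proof (rule nn_integral_cong)
      fix \<mu> assume "\<mu> \<in> space Q"
      then have "(\<Sum>i. palm_sum B (indicator (F i)) \<mu>) =
          (\<integral>\<^sup>+x. (\<Sum>i. indicator B x * indicator (F i) (reduced x \<mu>)) \<partial>\<mu>)"
        unfolding palm_sum_def using F
        by (intro nn_integral_suminf[symmetric] palm_sum_integrand_measurable_config) (auto simp: space_Q)
      also have "\<dots> = palm_sum B (indicator (\<Union>i. F i)) \<mu>"
        unfolding palm_sum_def by (simp add: suminf_indicator[OF disj])
      finally show "(\<Sum>i. palm_sum B (indicator (F i)) \<mu>) = palm_sum B (indicator (\<Union>i. F i)) \<mu>" .
    qed
    finally show "(\<Sum>i. \<integral>\<^sup>+\<mu>. palm_sum B (indicator (F i)) \<mu> \<partial>Q) =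
        (\<integral>\<^sup>+\<mu>. palm_sum B (indicator (\<Union> (range F))) \<mu> \<partial>Q)" .
  qed
qed

lemma nn_integral_campbell:
  assumes "g \<in> borel_measurable (config_space UNIV)"
  shows "(\<integral>\<^sup>+\<mu>. g \<mu> \<partial>campbell Q B) = (\<integral>\<^sup>+\<mu>. palm_sum B g \<mu> \<partial>Q)"
proof -
  have meas: "h \<in> borel_measurable (campbell Q B)" if "h
      \<in> borel_measurable (config_space UNIV)" for h :: "_ \<Rightarrow> ennreal"
    using that by (simp add: measurable_cong_sets[OF sets_campbell refl])
  from assms show ?thesis
  proof (induction rule: borel_measurable_induct)
    case (cong f g)
    have "(\<integral>\<^sup>+\<mu>. palm_sum B f \<mu> \<partial>Q) = (\<integral>\<^sup>+\<mu>. palm_sum B g \<mu> \<partial>Q)"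
      unfolding palm_sum_def using cong(3) reduced_in_configs
      by (intro nn_integral_cong) (auto simp: space_Q)
    moreover have "(\<integral>\<^sup>+\<mu>. f \<mu> \<partial>campbell Q B) = (\<integral>\<^sup>+\<mu>. g \<mu> \<partial>campbell Q B)"
      using cong(3) by (intro nn_integral_cong) auto
    ultimately show ?case using cong(4) by simp
  next
    case (set A)
    then show ?case by (simp add: emeasure_campbell)
  next
    case (mult u c)
    have "palm_sum B (\<lambda>x. c * u x) \<mu> = c * palm_sum B u \<mu>" if "\<mu> \<in> space Q" for \<mu>
      unfolding palm_sum_def using mult palm_sum_integrand_measurable_config[of \<mu> u] that
      by (simp add: space_Q nn_integral_cmult[symmetric] mult_ac)
    then have "(\<integral>\<^sup>+\<mu>. palm_sum B (\<lambda>x. c * u x) \<mu> \<partial>Q) = (\<integral>\<^sup>+\<mu>. c * palm_sum B u \<mu> \<partial>Q)"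
      by (rule nn_integral_cong)
    with mult show ?case
      by (simp add: nn_integral_cmult meas palm_sum_measurable_Q)
  next
    case (add u v)
    have "palm_sum B (\<lambda>x. v x + u x) \<mu> = palm_sum B v \<mu> + palm_sum B u \<mu>" if "\<mu> \<in> space Q" for \<mu>
      unfolding palm_sum_def distrib_left using add that
      by (intro nn_integral_add palm_sum_integrand_measurable_config) (auto simp: space_Q)
    then have "(\<integral>\<^sup>+\<mu>. palm_sum B (\<lambda>x. v x + u x) \<mu> \<partial>Q) = (\<integral>\<^sup>+\<mu>. palm_sum B v \<mu> + palm_sum B u \<mu> \<partial>Q)"
      by (rule nn_integral_cong)
    with add show ?case
      by (simp add: nn_integral_add meas palm_sum_measurable_Q)
  next
    case (seq U)
    have U: "(SUP i. U i) = (\<lambda>\<mu>. SUP i. U i \<mu>)" by (simp add: fun_eq_iff image_comp)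
    have ps: "palm_sum B (SUP i. U i) \<mu> = (SUP i. palm_sum B (U i) \<mu>)" if "\<mu> \<in> space Q" for \<mu>
    proof -
      have "palm_sum B (SUP i. U i) \<mu> = (\<integral>\<^sup>+x. (SUP i. indicator B x * U i (reduced x \<mu>)) \<partial>\<mu>)"
        unfolding palm_sum_def U by (simp add: SUP_mult_left_ennreal)
      also have "\<dots> = (SUP i. palm_sum B (U i) \<mu>)"
        unfolding palm_sum_def using seq that
        by (intro nn_integral_monotone_convergence_SUP palm_sum_integrand_measurable_config)
          (auto simp: space_Q incseq_def le_fun_def intro!: mult_left_mono)
      finally show ?thesis .
    qed
    have "(\<integral>\<^sup>+\<mu>. palm_sum B (SUP i. U i) \<mu> \<partial>Q) = (\<integral>\<^sup>+\<mu>. (SUP i. palm_sum B (U i) \<mu>) \<partial>Q)"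
      using ps by (rule nn_integral_cong)
    also have "\<dots> = (SUP i. \<integral>\<^sup>+\<mu>. palm_sum B (U i) \<mu> \<partial>Q)"
      using seq by (intro nn_integral_monotone_convergence_SUP palm_sum_measurable_Q)
        (auto simp: incseq_def le_fun_def palm_sum_def intro!: nn_integral_mono mult_left_mono)
    also have "\<dots> = (SUP i. \<integral>\<^sup>+\<mu>. U i \<mu> \<partial>campbell Q B)"
      using seq by simp
    also have "\<dots> = (\<integral>\<^sup>+\<mu>. (SUP i. U i \<mu>) \<partial>campbell Q B)"
      using seq by (intro nn_integral_monotone_convergence_SUP[symmetric] meas) auto
    finally show ?case by (simp add: U)
  qed
qed

end

section \<open>The moments of the Campbell measure\<close>

definition shift_tuple :: "nat \<Rightarrow> real \<Rightarrow> (nat \<Rightarrow> complex) \<Rightarrow> nat \<Rightarrow> complex" where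
  "shift_tuple k b x = (\<lambda>i\<in>{..<k}. x i - complex_of_real b)"

lemma emeasure_lborel_translate:
  assumes "A \<in> sets borel"
  shows "emeasure lborel ((\<lambda>z. z - complex_of_real b) -` A) = emeasure lborel A"
proof -
  have "emeasure lborel A = emeasure (distr lborel borel ((+) (- complex_of_real b))) A"
    by (simp add: lborel_distr_plus)
  also have "\<dots> = emeasure lborel ((+) (- complex_of_real b) -` A)"
    using assms by (subst emeasure_distr) auto
  also have "(+) (- complex_of_real b) -` A = (\<lambda>z. z - complex_of_real b) -` A"
    by auto
  finally show ?thesis by simp
qed

lemma translate_measurable_lborel_H: "(\<lambda>z. z - complex_of_real b) \<in> lborel_H \<rightarrow>\<^sub>M lborel_H"
proof -
  have "(\<lambda>z. z - complex_of_real b) \<in> borel_H \<rightarrow>\<^sub>M borel_H"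
    by (intro measurable_restrict_space2 measurable_restrict_space1)
       (auto simp: space_restrict_space upper_half_plane_def)
  then show ?thesis
    by (simp add: measurable_cong_sets[OF sets_lborel_H sets_lborel_H])
qed

lemma measurable_shift_tuple: "shift_tuple k b \<in> lborel_Hs k \<rightarrow>\<^sub>M lborel_Hs k"
  unfolding shift_tuple_def[abs_def]
  by (rule measurable_restrict, rule measurable_compose[OF _ translate_measurable_lborel_H], rule
      measurable_component_singleton)

lemma distr_shift_tuple:
  "distr (lborel_Hs k) (lborel_Hs k) (shift_tuple k b) = lborel_Hs k"
proof (rule LH.PiM_eqI)
  fix A :: "nat \<Rightarrow> complex set" assume A: "\<And>i. i \<in> {..<k} \<Longrightarrow> A i \<in> sets lborel_H"
  let ?S = "\<lambda>i. (\<lambda>z. z - complex_of_real b) -` A i \<inter> upper_half_plane"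
  have AH: "A i \<subseteq> upper_half_plane" "A i \<in> sets borel" if "i < k" for i
    using A[of i] that sets_lborel_H by (auto simp: HP.sets_E_iff)
  have S: "?S i \<in> sets lborel_H" if "i < k" for i
    using measurable_sets[OF translate_measurable_lborel_H A[of i]] that by (simp add: space_restrict_space)
  have "shift_tuple k b -` (Pi\<^sub>E {..<k} A) \<inter> space (lborel_Hs k) = Pi\<^sub>E {..<k} ?S"
    by (auto simp: shift_tuple_def space_PiM space_restrict_space PiE_iff)
  then have "emeasure (distr (lborel_Hs k) (lborel_Hs k) (shift_tuple k b)) (Pi\<^sub>E {..<k} A) =
      emeasure (lborel_Hs k) (Pi\<^sub>E {..<k} ?S)"
    using A by (subst emeasure_distr[OF measurable_shift_tuple]) (auto intro!: sets_PiM_I_finite)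
  also have "\<dots> = (\<Prod>i<k. emeasure lborel_H (?S i))"
    using S by (intro LH.emeasure_PiM) auto
  also have "\<dots> = (\<Prod>i<k. emeasure lborel_H (A i))"
  proof (rule prod.cong)
    fix i assume "i \<in> {..<k}"
    then have i: "i < k" by simp
    have "?S i = (\<lambda>z. z - complex_of_real b) -` A i"
      using AH[OF i] by (auto simp: upper_half_plane_def)
    then have "emeasure lborel_H (?S i) = emeasure lborel ((\<lambda>z. z - complex_of_real b) -` A i)"
      using S[OF i] by (subst emeasure_restrict_space) auto
    also have "\<dots> = emeasure lborel (A i)"
      by (rule emeasure_lborel_translate[OF AH(2)[OF i]])
    also have "\<dots> = emeasure lborel_H (A i)"
      using AH[OF i] by (subst emeasure_restrict_space) auto
    finally show "emeasure lborel_H (?S i) = emeasure lborel_H (A i)" .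
  qed simp
  finally show "emeasure (distr (lborel_Hs k) (lborel_Hs k) (shift_tuple k b)) (Pi\<^sub>E {..<k} A) =
      (\<Prod>i<k. emeasure lborel_H (A i))" .
qed auto

lemma nn_integral_shift_tuple:
  assumes "f \<in> borel_measurable (lborel_Hs k)"
  shows "(\<integral>\<^sup>+x. f (shift_tuple k b x) \<partial>lborel_Hs k) = (\<integral>\<^sup>+x. f x \<partial>lborel_Hs k)"
  using nn_integral_distr[OF measurable_shift_tuple, of f k b] assms by (simp add: distr_shift_tuple)

text \<open>The Palm point takes the last slot: together with it, a \<open>k\<close>-tuple of the
  reduced configuration is a tuple of \<open>k + 1\<close> distinct points of \<mu>, and the shift
  turns coordinates into differences to the last one.\<close>

lemma palm_sum_tuple_sum:
  assumes B: "B \<in> sets borel" and C: "C \<in> sets borel" and \<mu>: "\<mu> \<in> configs UNIV"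
  shows "palm_sum B (\<lambda>\<nu>. tuple_sum k (indicator ({..<k} \<rightarrow>\<^sub>E C)) (points \<nu>)) \<mu> =
    tuple_sum (Suc k) (\<lambda>x. indicator B (x k) * indicator ({..<k} \<rightarrow>\<^sub>E C) (\<lambda>i\<in>{..<k}. x i - x k)) (points \<mu>)"
proof -
  interpret configuration UNIV \<mu> using \<mu> by unfold_locales
  let ?g = "\<lambda>\<nu> :: real measure. tuple_sum k (indicator ({..<k} \<rightarrow>\<^sub>E C)) (points \<nu>) :: ennreal"
  have "(indicator ({..<k} \<rightarrow>\<^sub>E C) :: _ \<Rightarrow> ennreal) \<in> borel_measurable (\<Pi>\<^sub>M i\<in>{..<k}. borel)"
    using C by (intro borel_measurable_indicator sets_PiM_I_finite) auto
  then have g: "?g \<in> borel_measurable (config_space UNIV)"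
    using RL.measurable_tuple_sum'[of _ k] by simp
  have "palm_sum B ?g \<mu> = (\<integral>\<^sup>+u. indicator B u * ?g (reduced u \<mu>) \<partial>count_space (points \<mu>))"
    using palm_sum_integrand_measurable[OF B g \<mu>] by (simp add: palm_sum_def nn_integral_config)
  also have "\<dots> = tuple_sum (Suc k) (\<lambda>x. indicator B (x k) *
      indicator ({..<k} \<rightarrow>\<^sub>E C) (\<lambda>i\<in>{..<k}. x i - x k)) (points \<mu>)"
    unfolding tuple_sum_Suc
  proof (rule nn_integral_cong)
    fix u :: real
    have "(\<lambda>i\<in>{..<k}. (x(k := u)) i - u) = (\<lambda>i\<in>{..<k}. x i - u)" for x
      by (auto simp: restrict_def)
    moreover have "?g (reduced u \<mu>) = tuple_sum k (\<lambda>x. indicator ({..<k} \<rightarrow>\<^sub>E C) (\<lambda>i\<in>{..<k}. x i - u))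
        (points \<mu> - {u})"
      unfolding points_reduced by (rule tuple_sum_image) (auto simp: inj_on_def)
    ultimately show "indicator B u * ?g (reduced u \<mu>) =
        tuple_sum k (\<lambda>x. indicator B ((x(k := u)) k) *
            indicator ({..<k} \<rightarrow>\<^sub>E C) (\<lambda>i\<in>{..<k}. (x(k := u)) i - (x(k := u)) k))
          (points \<mu> - {u})"
      by (simp add: tuple_sum_mult)
  qed
  finally show ?thesis .
qed

text \<open>Stated for arbitrary coordinate functions \<open>f i\<close>, because it serves both
  tuples of reals and the abscissae of complex tuples.\<close>

lemma palm_tuple_measurable:
  assumes "B \<in> sets borel" "C \<in> sets borel" "\<And>i. i < Suc k \<Longrightarrow> f i \<in> borel_measurable S"
  shows "(\<lambda>s. indicator B (f k s) * indicator ({..<k} \<rightarrow>\<^sub>E C) (\<lambda>i\<in>{..<k}. f i s - f k s :: real) :: ennreal)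
      \<in> borel_measurable S"
proof -
  have "(indicator ({..<k} \<rightarrow>\<^sub>E C) :: _ \<Rightarrow> ennreal) \<in> borel_measurable (\<Pi>\<^sub>M i\<in>{..<k}. borel)"
    using assms(2) by (intro borel_measurable_indicator sets_PiM_I_finite) auto
  moreover have "(\<lambda>s. \<lambda>i\<in>{..<k}. f i s - f k s) \<in> S \<rightarrow>\<^sub>M (\<Pi>\<^sub>M i\<in>{..<k}. borel)"
    using assms(3) by (intro measurable_restrict borel_measurable_diff) auto
  ultimately have "(\<lambda>s. indicator ({..<k} \<rightarrow>\<^sub>E C) (\<lambda>i\<in>{..<k}. f i s - f k s) :: ennreal)
      \<in> borel_measurable S"
    by (rule measurable_compose[rotated])
  moreover have "(\<lambda>s. indicator B (f k s) :: ennreal) \<in> borel_measurable S"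
    using assms(1,3) by (intro measurable_compose[OF assms(3) borel_measurable_indicator]) auto
  ultimately show ?thesis by (rule borel_measurable_times_ennreal[rotated])
qed

section \<open>Palm integrals over the strip\<close>

context strip_weight
begin

abbreviation slab :: "real set \<Rightarrow> complex set" where
  "slab C \<equiv> Re -` C \<inter> upper_half_plane"

lemma void_integrand_measurable:
  assumes "C \<in> sets borel_H"
  shows "(\<lambda>x. indicator ({..<k} \<rightarrow>\<^sub>E C) x * (retain k x * ennreal (Re (kernel_det (K_H_palm a) k x))))
    \<in> borel_measurable (lborel_Hs k)"
proof -
  have "(\<lambda>x. ennreal (Re (kernel_det (K_H_palm a) k x))) \<in> borel_measurable (borel_Hs k)"
    by (intro HP.borel_measurable_kernel_det borel_measurable_K_H_palm measurable_PiM_H_component) auto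
  then show ?thesis
    using indicator_PiE_measurable[OF assms, of k] retain_measurable[of k]
    unfolding measurable_cong_sets[OF HP.sets_PiM_lborel refl]
    by (intro borel_measurable_times_ennreal)
qed

text \<open>Weight at the pivot, times \<open>K_H\<close> on the diagonal there, times the factorial
  moment of the reduced kernel at that height: what the integral over \<open>k + 1\<close> points
  leaves for the last one.\<close>

definition height_density :: "nat \<Rightarrow> real set \<Rightarrow> real \<Rightarrow> ennreal" where
  "height_density k C y = ennreal (w y / (4 * pi * y\<^sup>2)) * void_moment (palm_K y) k (slab C)"

text \<open>Shifting the other points by the abscissa of \<open>z\<close> changes neither the weight
  nor the kernel nor the area, and moves the pivot to the imaginary axis, where only its height is
  left.\<close>

lemma inner_palm_integral:
  assumes C: "C \<in> sets borel" and z: "z \<in> upper_half_plane"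
  shows "(\<integral>\<^sup>+x. indicator B (Re ((x(k := z)) k)) *
        indicator ({..<k} \<rightarrow>\<^sub>E C) (\<lambda>i\<in>{..<k}. Re ((x(k := z)) i) - Re ((x(k := z)) k)) *
        (retain (Suc k) (x(k := z)) * ennreal (Re (kernel_det K_H (Suc k) (x(k := z))))) \<partial>lborel_Hs k) =
    indicator B (Re z) * height_density k C (Im z)"
proof -
  have Im: "0 < Im z" using z by (simp add: upper_half_plane_def)
  let ?a = "\<i> * complex_of_real (Im z)"
  have za: "z = ?a + complex_of_real (Re z)" by (simp add: complex_eq_iff)
  define g where "g x = indicator ({..<k} \<rightarrow>\<^sub>E slab C) x * (retain k x *
      ennreal (Re (kernel_det (K_H_palm ?a) k x)))" for x
  have g: "g \<in> borel_measurable (lborel_Hs k)"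
    unfolding g_def by (rule void_integrand_measurable[OF vimage_Re_sets_borel_H[OF C]])
  have "indicator B (Re ((x(k := z)) k)) *
        indicator ({..<k} \<rightarrow>\<^sub>E C) (\<lambda>i\<in>{..<k}. Re ((x(k := z)) i) - Re ((x(k := z)) k)) *
        (retain (Suc k) (x(k := z)) * ennreal (Re (kernel_det K_H (Suc k) (x(k := z))))) =
      (indicator B (Re z) * ennreal (w (Im z) / (4 * pi * (Im z)\<^sup>2))) * g (shift_tuple k (Re z) x)"
    if x: "x \<in> space (lborel_Hs k)" for x
  proof -
    have xH: "0 < Im (x i)" if "i < k" for i
      using x that unfolding space_PiM_lborel_H by (auto simp: PiE_iff upper_half_plane_def)
    have 1: "(indicator ({..<k} \<rightarrow>\<^sub>E C) (\<lambda>i\<in>{..<k}. Re ((x(k := z)) i) - Re ((x(k := z)) k)) :: ennreal) =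
        indicator ({..<k} \<rightarrow>\<^sub>E slab C) (shift_tuple k (Re z) x)"
      using xH by (auto simp: indicator_def shift_tuple_def PiE_iff upper_half_plane_def)
    have 2: "retain (Suc k) (x(k := z)) = retain k (shift_tuple k (Re z) x) * ennreal (w (Im z))"
      by (simp add: retain_def shift_tuple_def)
    have 3: "kernel_det K_H (Suc k) (x(k := z)) =
        complex_of_real (1 / (4 * pi * (Im z)\<^sup>2)) * kernel_det (K_H_palm ?a) k (shift_tuple k (Re z) x)"
    proof -
      have "kernel_det (K_H_palm z) k (x(k := z)) = kernel_det (K_H_palm ?a) k (shift_tuple k (Re z) x)"
        unfolding kernel_det_fdet
      proof (rule fdet_cong)
        fix i j assume ij: "i < k" "j < k"
        have "K_H_palm z (x i) (x j) = K_H_palm (?a + complex_of_real (Re z))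
            ((x i - complex_of_real (Re z)) + complex_of_real (Re z)) ((x j - complex_of_real (Re z)) +
                complex_of_real (Re z))"
          by (subst za) simp
        also have "\<dots> = K_H_palm ?a (x i - complex_of_real (Re z)) (x j - complex_of_real (Re z))"
          by (rule K_H_palm_translate)
        finally show "K_H_palm z ((x(k := z)) i) ((x(k := z)) j) =
            K_H_palm ?a (shift_tuple k (Re z) x i) (shift_tuple k (Re z) x j)"
          using ij by (simp add: shift_tuple_def)
      qed
      then show ?thesis using kernel_det_K_H_Suc[of "x(k := z)" k] Im by simp
    qed
    have 4: "ennreal (Re (kernel_det K_H (Suc k) (x(k := z)))) =
        ennreal (1 / (4 * pi * (Im z)\<^sup>2)) * ennreal (Re (kernel_det (K_H_palm ?a) k (shift_tuple k (Re z)
            x)))"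
    proof -
      define r where "r = 1 / (4 * pi * (Im z)\<^sup>2)"
      have "0 \<le> r" by (simp add: r_def)
      have "Re (kernel_det K_H (Suc k) (x(k := z))) =
          r * Re (kernel_det (K_H_palm ?a) k (shift_tuple k (Re z) x))"
        unfolding 3 r_def[symmetric] by simp
      with \<open>0 \<le> r\<close> show ?thesis
        unfolding r_def[symmetric] by (simp add: ennreal_mult')
    qed
    have 5: "ennreal (w (Im z) / (4 * pi * (Im z)\<^sup>2)) =
        ennreal (w (Im z)) * ennreal (1 / (4 * pi * (Im z)\<^sup>2))"
      using w_nonneg[OF Im] by (simp add: ennreal_mult'[symmetric])
    show ?thesis
      unfolding 1 2 4 5 g_def by (simp add: mult_ac)
  qed
  then have "(\<integral>\<^sup>+x. indicator B (Re ((x(k := z)) k)) *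
        indicator ({..<k} \<rightarrow>\<^sub>E C) (\<lambda>i\<in>{..<k}. Re ((x(k := z)) i) - Re ((x(k := z)) k)) *
        (retain (Suc k) (x(k := z)) * ennreal (Re (kernel_det K_H (Suc k) (x(k := z))))) \<partial>lborel_Hs k) =
      (\<integral>\<^sup>+x. (indicator B (Re z) * ennreal (w (Im z) / (4 * pi * (Im z)\<^sup>2))) * g (shift_tuple k (Re z) x)
          \<partial>lborel_Hs k)"
    by (rule nn_integral_cong)
  also have "\<dots> = (indicator B (Re z) * ennreal (w (Im z) / (4 * pi * (Im z)\<^sup>2))) *
      (\<integral>\<^sup>+x. g (shift_tuple k (Re z) x) \<partial>lborel_Hs k)"
    by (intro nn_integral_cmult measurable_compose[OF measurable_shift_tuple g])
  also have "(\<integral>\<^sup>+x. g (shift_tuple k (Re z) x) \<partial>lborel_Hs k) = void_moment (K_H_palm ?a) k (slab C)"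
    unfolding nn_integral_shift_tuple[OF g] by (simp add: void_moment_def g_def[abs_def])
  finally show ?thesis
    by (simp only: height_density_def mult.assoc)
qed

lemma height_density_measurable:
  assumes "C \<in> sets borel"
  shows "height_density k C \<in> borel_measurable (restrict_space borel {0<..})"
proof -
  have "(\<lambda>y. void_moment (palm_K y) k (slab C)) \<in> borel_measurable height_space"
    by (rule measurable_restrict_space1[OF void_moment_palm_measurable[OF vimage_Re_sets_borel_H[OF
        assms]]])
  moreover have "(\<lambda>y. y) \<in> borel_measurable height_space"
    by (rule measurable_restrict_space1) simp
  ultimately show ?thesis
    unfolding height_density_def[abs_def] using w_measurable by measurable
qed

lemma nn_integral_height_density:
  assumes B: "B \<in> sets borel" and C: "C \<in> sets borel"
  shows "(\<integral>\<^sup>+z. indicator B (Re z) * height_density k C (Im z) \<partial>lborel_H) =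
    emeasure lborel B * (\<integral>\<^sup>+y. height_density k C y \<partial>restrict_space lborel {0<..})"
proof -
  define F where "F y = height_density k C y * indicator {0<..} y" for y
  have F: "F \<in> borel_measurable borel"
    using height_density_measurable[OF C, of k] unfolding F_def[abs_def]
    by (subst (asm) borel_measurable_restrict_space_iff_ennreal) auto
  have "(\<integral>\<^sup>+z. indicator B (Re z) * height_density k C (Im z) \<partial>lborel_H) =
      (\<integral>\<^sup>+z. indicator B (Re z) * F (Im z) \<partial>lborel)"
    by (subst nn_integral_restrict_space) (auto simp: F_def upper_half_plane_def indicator_def intro!:
        nn_integral_cong)
  also have "\<dots> = (\<integral>\<^sup>+y. \<integral>\<^sup>+x. indicator B x * F y \<partial>lborel \<partial>lborel)"
  proof -
    have "(\<lambda>z. indicator B (Re z) * F (Im z)) \<in> borel_measurable borel"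
      using B F by measurable
    then show ?thesis by (subst nn_integral_lborel_complex) auto
  qed
  also have "\<dots> = (\<integral>\<^sup>+y. emeasure lborel B * F y \<partial>lborel)"
    using B by (intro nn_integral_cong) (simp add: nn_integral_multc)
  also have "\<dots> = emeasure lborel B * (\<integral>\<^sup>+y. F y \<partial>lborel)"
    using F by (intro nn_integral_cmult) simp
  also have "(\<integral>\<^sup>+y. F y \<partial>lborel) = (\<integral>\<^sup>+y. height_density k C y \<partial>restrict_space lborel {0<..})"
    by (subst nn_integral_restrict_space) (auto simp: F_def[abs_def])
  finally show ?thesis .
qed

lemma X_law_sets: "sets (X_law w Z) = sets (config_space UNIV)"
  by (simp add: X_law_def)

lemma campbell_void_moment:
  assumes Z: "determinantal upper_half_plane K_H Z" and B: "B \<in> sets borel" and C: "C \<in> sets borel"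
  shows "(\<integral>\<^sup>+\<nu>. tuple_sum k (indicator ({..<k} \<rightarrow>\<^sub>E C)) (points \<nu>) \<partial>campbell (X_law w Z) B) =
    emeasure lborel B * (\<integral>\<^sup>+y. height_density k C y \<partial>restrict_space lborel {0<..})"
proof -
  define T where "T = thinning upper_half_plane (\<lambda>z. w (Im z)) Z"
  have T: "thinned_moments K_H T"
    unfolding T_def by (rule thinned_moments_thinning[OF Z])
  have sT: "sets T = sets HC" using T by (simp add: thinned_moments_def)
  have spT: "space T = configs upper_half_plane" using sets_eq_imp_space_eq[OF sT] by simp
  define h where "h = (\<lambda>x :: nat \<Rightarrow> real. indicator B (x k) *
      indicator ({..<k} \<rightarrow>\<^sub>E C) (\<lambda>i\<in>{..<k}. x i - x k) :: ennreal)"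
  define H where "H = (\<lambda>x :: nat \<Rightarrow> complex. indicator B (Re (x k)) *
      indicator ({..<k} \<rightarrow>\<^sub>E C) (\<lambda>i\<in>{..<k}. Re (x i) - Re (x k)) :: ennreal)"
  have h: "h \<in> borel_measurable (\<Pi>\<^sub>M i\<in>{..<Suc k}. restrict_space borel UNIV)"
    unfolding h_def restrict_borel_UNIV by (rule palm_tuple_measurable[OF B C]) (rule
        measurable_component_singleton, simp)
  have H: "H \<in> borel_measurable (borel_Hs (Suc k))"
    unfolding H_def
    by (rule palm_tuple_measurable[OF B C, of k "\<lambda>i x. Re (x i)"])
       (rule measurable_compose[OF measurable_PiM_H_component borel_measurable_Re])
  have gm: "(\<lambda>\<nu>. tuple_sum k (indicator ({..<k} \<rightarrow>\<^sub>E C)) (points \<nu>))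
      \<in> borel_measurable (config_space (UNIV :: real set))"
    using C by (intro RL.measurable_tuple_sum' borel_measurable_indicator sets_PiM_I_finite) auto
  have "(\<integral>\<^sup>+\<nu>. tuple_sum k (indicator ({..<k} \<rightarrow>\<^sub>E C)) (points \<nu>) \<partial>campbell (X_law w Z) B) =
      (\<integral>\<^sup>+\<mu>. palm_sum B (\<lambda>\<nu>. tuple_sum k (indicator ({..<k} \<rightarrow>\<^sub>E C)) (points \<nu>)) \<mu> \<partial>X_law w Z)"
    by (rule nn_integral_campbell[OF X_law_sets B gm])
  also have "\<dots> = (\<integral>\<^sup>+\<mu>. tuple_sum (Suc k) h (points \<mu>) \<partial>X_law w Z)"
    unfolding h_def using sets_eq_imp_space_eq[OF X_law_sets]
    by (intro nn_integral_cong palm_sum_tuple_sum B C) auto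
  also have "\<dots> = (\<integral>\<^sup>+\<xi>. tuple_sum (Suc k) h (points (proj \<xi>)) \<partial>T)"
    unfolding X_law_def T_def[symmetric]
    using measurable_proj RL.measurable_tuple_sum'[OF h]
    by (intro nn_integral_distr) (simp_all add: measurable_cong_sets[OF sT refl])
  \<comment> \<open>Almost surely \<open>Re\<close> is injective on the points, so tuples of
    distinct abscissae correspond to tuples of distinct points of the half-plane.\<close>
  also have "\<dots> = (\<integral>\<^sup>+\<xi>. tuple_sum (Suc k) H (points \<xi>) \<partial>T)"
  proof (rule nn_integral_cong_AE)
    show "AE \<xi> in T. tuple_sum (Suc k) h (points (proj \<xi>)) = tuple_sum (Suc k) H (points \<xi>)"
      using AE_good_projection[OF T] AE_space
    proof eventually_elim
      case (elim \<xi>)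
      then have "points (proj \<xi>) = Re ` points \<xi>" "inj_on Re (points \<xi>)"
        using points_proj_good by (auto simp: spT good_projection_def)
      moreover have "(\<lambda>i\<in>{..<k}. (\<lambda>i\<in>{..<Suc k}. Re (x i)) i - Re (x k)) =
          (\<lambda>i\<in>{..<k}. Re (x i) - Re (x k))" for x :: "nat \<Rightarrow> complex"
        by (auto simp: restrict_def)
      ultimately show ?case
        by (simp add: tuple_sum_image h_def H_def)
    qed
  qed
  also have "\<dots> = (\<integral>\<^sup>+x. H x * (retain (Suc k) x * ennreal (Re (kernel_det K_H (Suc k) x)))
      \<partial>lborel_Hs (Suc k))"
    using T H by (simp add: thinned_moments_def)
  \<comment> \<open>The last coordinate becomes the outer variable because it is the pivot of the
    Schur complement.\<close>
  also have "\<dots> = (\<integral>\<^sup>+z. \<integral>\<^sup>+x. H (x(k := z)) * (retain (Suc k) (x(k := z)) *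
      ennreal (Re (kernel_det K_H (Suc k) (x(k := z)))))
      \<partial>lborel_Hs k \<partial>lborel_H)"
  proof -
    have "(\<lambda>x. ennreal (Re (kernel_det K_H (Suc k) x))) \<in> borel_measurable (borel_Hs (Suc k))"
      by (intro HP.borel_measurable_kernel_det borel_measurable_K_H measurable_PiM_H_component)
    then have "(\<lambda>x. H x * (retain (Suc k) x * ennreal (Re (kernel_det K_H (Suc k) x))))
        \<in> borel_measurable (lborel_Hs (Suc k))"
      unfolding measurable_cong_sets[OF HP.sets_PiM_lborel refl]
      by (intro borel_measurable_times_ennreal H retain_measurable)
    then show ?thesis
      unfolding lessThan_Suc by (intro LH.product_nn_integral_insert_rev) auto
  qed
  also have "\<dots> = (\<integral>\<^sup>+z. indicator B (Re z) * height_density k C (Im z) \<partial>lborel_H)"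
    unfolding H_def by (intro nn_integral_cong inner_palm_integral[OF C]) (simp add: space_restrict_space)
  also have "\<dots> = emeasure lborel B * (\<integral>\<^sup>+y. height_density k C y \<partial>restrict_space lborel {0<..})"
    by (rule nn_integral_height_density[OF B C])
  finally show ?thesis .
qed

end

section \<open>The mixture over the height\<close>

context strip_weight
begin

abbreviation total :: real where
  "total \<equiv> (LBINT u:{0<..}. w u / u\<^sup>2)"

lemma weighted_measurable: "(\<lambda>y. w y / y\<^sup>2) \<in> borel_measurable height_space"
proof -
  have "(\<lambda>y. y) \<in> borel_measurable height_space" by (rule measurable_restrict_space1) simp
  then show ?thesis using w_measurable by measurable
qed

lemma weighted_nonneg: "0 < y \<Longrightarrow> 0 \<le> w y / y\<^sup>2"
  using w_nonneg by simp

lemma weighted_integrable: "set_integrable lborel {0<..} (\<lambda>y. w y / y\<^sup>2)"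
  unfolding set_integrable_def
proof (rule Bochner_Integration.integrable_bound)
  \<comment> \<open>On the strip \<open>w\<close> is at most 1 and \<open>y\<close> at least
    \<alpha>.\<close>
  show "integrable lborel (\<lambda>y. indicator {\<alpha>..\<beta>} y * (1 / \<alpha>\<^sup>2) :: real)"
    by (intro integrable_mult_left integrable_real_indicator) (auto simp: emeasure_lborel_Icc_eq)
  show "(\<lambda>y. indicator {0<..} y *\<^sub>R (w y / y\<^sup>2)) \<in> borel_measurable lborel"
    using weighted_measurable by (subst (asm) borel_measurable_restrict_space_iff) auto
  have "\<bar>indicator {0<..} y * (w y / y\<^sup>2)\<bar> \<le> indicator {\<alpha>..\<beta>} y * (1 / \<alpha>\<^sup>2)" for y
  proof (cases "0 < y \<and> y \<in> {\<alpha>..\<beta>}")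
    case True
    then have "w y / y\<^sup>2 \<le> 1 / \<alpha>\<^sup>2"
      using w_le_1[of y] w_nonneg[of y] \<alpha>_pos by (intro frac_le power_mono) auto
    with True weighted_nonneg[of y] show ?thesis by simp
  next
    case False
    then show ?thesis using w_outside[of y] by (cases "0 < y") auto
  qed
  then show "AE y in lborel. norm (indicator {0<..} y *\<^sub>R (w y / y\<^sup>2)) \<le>
      norm (indicator {\<alpha>..\<beta>} y * (1 / \<alpha>\<^sup>2) :: real)"
    by (simp add: abs_mult)
qed

text \<open>On the strip the factor 1 / y^2 is at least 1 / \<beta>^2, so the positive mass of
  \<open>w\<close> carries over.\<close>

lemma total_pos: "0 < total"
proof -
  \<comment> \<open>The Bochner integral of a function that is not integrable is 0 by convention, so
    a positive value entails integrability.\<close>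
  have int: "integrable lborel (\<lambda>y. indicator {\<alpha>..\<beta>} y *\<^sub>R w y)"
    using w_integral_pos not_integrable_integral_eq unfolding set_lebesgue_integral_def by fastforce
  have "0 < 1 / \<beta>\<^sup>2 * (LBINT y:{\<alpha>..\<beta>}. w y)"
    using w_integral_pos \<alpha>_pos \<alpha>_less_\<beta> by simp
  also have "1 / \<beta>\<^sup>2 * (LBINT y:{\<alpha>..\<beta>}. w y) = (LBINT y. 1 / \<beta>\<^sup>2 * (indicator {\<alpha>..\<beta>} y *\<^sub>R w y))"
    unfolding set_lebesgue_integral_def by (rule integral_mult_right_zero[symmetric])
  also have "\<dots> \<le> total"
    unfolding set_lebesgue_integral_def
  proof (rule integral_mono)
    show "integrable lborel (\<lambda>y. 1 / \<beta>\<^sup>2 * (indicator {\<alpha>..\<beta>} y *\<^sub>R w y))"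
      by (rule integrable_mult_right[OF int])
    show "integrable lborel (\<lambda>y. indicator {0<..} y *\<^sub>R (w y / y\<^sup>2))"
      using weighted_integrable by (simp add: set_integrable_def)
    fix y :: real
    show "1 / \<beta>\<^sup>2 * (indicator {\<alpha>..\<beta>} y *\<^sub>R w y) \<le> indicator {0<..} y *\<^sub>R (w y / y\<^sup>2)"
    proof (cases "y \<in> {\<alpha>..\<beta>}")
      case True
      then have "0 < y" using \<alpha>_pos by simp
      moreover have "w y * (1 / \<beta>\<^sup>2) \<le> w y * (1 / y\<^sup>2)"
        using True \<open>0 < y\<close> w_nonneg[of y] by (intro mult_left_mono divide_left_mono power_mono) auto
      ultimately show ?thesis using True by simp
    next
      case False
      then show ?thesis using weighted_nonneg[of y] by (auto simp: indicator_def)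
    qed
  qed
  finally show ?thesis .
qed

lemma nn_integral_weighted: "(\<integral>\<^sup>+y. ennreal (w y / y\<^sup>2) \<partial>restrict_space lborel {0<..}) = ennreal total"
proof -
  have "(\<integral>\<^sup>+y. ennreal (w y / y\<^sup>2) \<partial>restrict_space lborel {0<..}) =
      (\<integral>\<^sup>+y. ennreal (indicator {0<..} y *\<^sub>R (w y / y\<^sup>2)) \<partial>lborel)"
    by (subst nn_integral_restrict_space) (auto simp: indicator_def intro!: nn_integral_cong)
  also have "\<dots> = ennreal total"
    unfolding set_lebesgue_integral_def using weighted_integrable weighted_nonneg
    by (intro nn_integral_eq_integral) (auto simp: set_integrable_def indicator_def)
  finally show ?thesis .
qed

lemma sets_lborel_heights: "sets (restrict_space lborel {0<..}) = sets height_space"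
  by (intro sets_restrict_space_cong sets_lborel)

lemma sets_\<nu>: "sets (\<nu> w) = sets height_space"
  by (simp add: \<nu>_def sets_lborel_heights)

lemma space_\<nu>: "space (\<nu> w) = {0<..}"
  by (simp add: \<nu>_def space_restrict_space)

lemma \<nu>_density_measurable: "(\<lambda>y. ennreal (w y / y\<^sup>2 / total))
    \<in> borel_measurable (restrict_space lborel {0<..})"
  using weighted_measurable unfolding measurable_cong_sets[OF sets_lborel_heights refl] by measurable

lemma nn_integral_\<nu>:
  assumes "g \<in> borel_measurable height_space"
  shows "(\<integral>\<^sup>+y. g y \<partial>\<nu> w) = (\<integral>\<^sup>+y. ennreal (w y / y\<^sup>2 / total) * g y \<partial>restrict_space lborel {0<..})"
  unfolding \<nu>_def using assms \<nu>_density_measurable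
  by (intro nn_integral_density) (simp_all add: measurable_cong_sets[OF sets_lborel_heights refl])

lemma prob_space_\<nu>: "prob_space (\<nu> w)"
proof (rule prob_spaceI)
  have "emeasure (\<nu> w) (space (\<nu> w)) = (\<integral>\<^sup>+y. 1 \<partial>\<nu> w)" by simp
  also have "\<dots> = (\<integral>\<^sup>+y. ennreal (1 / total) * ennreal (w y / y\<^sup>2) \<partial>restrict_space lborel {0<..})"
    using total_pos weighted_nonneg
    by (subst nn_integral_\<nu>) (auto simp: space_restrict_space ennreal_mult'[symmetric] mult.commute intro!:
        nn_integral_cong)
  also have "\<dots> = ennreal (1 / total) * ennreal total"
    using weighted_measurable unfolding nn_integral_weighted[symmetric]
    by (intro nn_integral_cmult) (simp add: measurable_cong_sets[OF sets_lborel_heights refl])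
  also have "\<dots> = 1"
    using total_pos by (simp add: ennreal_mult[symmetric])
  finally show "emeasure (\<nu> w) (space (\<nu> w)) = 1" .
qed

lemma AE_\<nu>: "AE y in \<nu> w. y \<in> {\<alpha>..\<beta>}"
  unfolding \<nu>_def
proof (subst AE_density[OF \<nu>_density_measurable], intro AE_I2 impI, rule ccontr)
  fix y assume "y \<in> space (restrict_space lborel {0::real<..})" "y \<notin> {\<alpha>..\<beta>}"
  then have "w y = 0" using w_outside[of y] by (simp add: space_restrict_space)
  moreover assume "0 < ennreal (w y / y\<^sup>2 / total)"
  ultimately show False by simp
qed

lemma intensity_eq: "intensity w = total / (4 * pi)"
  by (simp add: intensity_def)

lemma intensity_pos: "0 < intensity w"
  using total_pos by (simp add: intensity_eq)

text \<open>The factor 1 / (4 pi) from the diagonal of \<open>K_H\<close> and the normalising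
  constant of \<open>\<nu> w\<close> combine to the intensity.\<close>

lemma nn_integral_height_density_\<nu>:
  assumes C: "C \<in> sets borel"
  shows "(\<integral>\<^sup>+y. height_density k C y \<partial>restrict_space lborel {0<..}) =
    ennreal (intensity w) * (\<integral>\<^sup>+y. void_moment (palm_K y) k (slab C) \<partial>\<nu> w)"
proof -
  let ?V = "\<lambda>y. void_moment (palm_K y) k (slab C)"
  have V: "?V \<in> borel_measurable height_space"
    by (rule measurable_restrict_space1[OF void_moment_palm_measurable[OF vimage_Re_sets_borel_H[OF C]]])
  have "(\<integral>\<^sup>+y. height_density k C y \<partial>restrict_space lborel {0<..}) =
      (\<integral>\<^sup>+y. ennreal (intensity w) * (ennreal (w y / y\<^sup>2 / total) * ?V y) \<partial>restrict_space lborel {0<..})"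
  proof (rule nn_integral_cong)
    fix y assume "y \<in> space (restrict_space lborel {0::real<..})"
    then have "0 < y" by (simp add: space_restrict_space)
    have "w y / (4 * pi * y\<^sup>2) = intensity w * (w y / y\<^sup>2 / total)"
      using total_pos by (simp add: intensity_eq)
    then have "ennreal (w y / (4 * pi * y\<^sup>2)) = ennreal (intensity w) * ennreal (w y / y\<^sup>2 / total)"
      using intensity_pos by (simp only: ennreal_mult' less_imp_le)
    then show "height_density k C y = ennreal (intensity w) * (ennreal (w y / y\<^sup>2 / total) * ?V y)"
      by (simp only: height_density_def mult.assoc)
  qed
  also have "\<dots> = ennreal (intensity w) * (\<integral>\<^sup>+y. ennreal (w y / y\<^sup>2 / total) * ?V y
      \<partial>restrict_space lborel {0<..})"
    using V \<nu>_density_measurable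
    by (intro nn_integral_cmult borel_measurable_times_ennreal) (simp_all add: measurable_cong_sets[OF
        sets_lborel_heights refl])
  finally show ?thesis by (simp add: nn_integral_\<nu>[OF V])
qed

text \<open>Replaces a slab, which reaches the real axis, by its part in the strip, where the kernel
  estimates apply.\<close>

lemma void_moment_strip:
  "void_moment K k C = void_moment K k (C \<inter> {z. Im z \<in> {\<alpha>..\<beta>}})"
  unfolding void_moment_def
proof (rule nn_integral_cong)
  fix x assume x: "x \<in> space (lborel_Hs k)"
  show "indicator ({..<k} \<rightarrow>\<^sub>E C) x * (retain k x * ennreal (Re (kernel_det K k x))) =
      indicator ({..<k} \<rightarrow>\<^sub>E C \<inter> {z. Im z \<in> {\<alpha>..\<beta>}}) x * (retain k x * ennreal (Re (kernel_det K k x)))"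
  proof (cases "\<forall>i<k. Im (x i) \<in> {\<alpha>..\<beta>}")
    case True
    then show ?thesis by (auto simp: indicator_def PiE_iff)
  next
    case False
    then show ?thesis using retain_outside x unfolding space_PiM_lborel_H by auto
  qed
qed

lemma slab_strip_bounded:
  assumes "C \<in> bounded_sets UNIV"
  shows "slab C \<inter> {z. Im z \<in> {\<alpha>..\<beta>}} \<in> bounded_sets upper_half_plane"
proof -
  obtain K where K: "compact K" "C \<subseteq> K" "C \<in> sets borel" using assms by (auto simp: bounded_sets_def)
  obtain b where b: "\<And>x. x \<in> K \<Longrightarrow> \<bar>x\<bar> \<le> b"
    using compact_imp_bounded[OF K(1)] by (auto simp: bounded_iff)
  have "{z. Im z \<in> {\<alpha>..\<beta>}} = Im -` {\<alpha>..\<beta>} \<inter> space borel" by auto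
  also have "\<dots> \<in> sets borel" by (rule measurable_sets[OF borel_measurable_Im]) simp
  finally have "slab C \<inter> {z. Im z \<in> {\<alpha>..\<beta>}} \<in> sets borel"
    using vimage_Re_sets_borel_H[OF K(3)] by (auto simp: HP.sets_E_iff)
  moreover have "slab C \<inter> {z. Im z \<in> {\<alpha>..\<beta>}} \<subseteq> cbox (Complex (- b) \<alpha>) (Complex b \<beta>)"
    using K(2) b by (fastforce simp: cbox_def Basis_complex_def inner_complex_def)
  moreover have "cbox (Complex (- b) \<alpha>) (Complex b \<beta>) \<subseteq> upper_half_plane"
    using \<alpha>_pos by (auto simp: cbox_def Basis_complex_def inner_complex_def upper_half_plane_def)
  ultimately show ?thesis
    unfolding bounded_sets_def by (intro CollectI conjI exI[of _ "cbox (Complex (- b) \<alpha>) (Complex b \<beta>)"])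
        auto
qed

text \<open>One constant for all heights in the strip, obtained by bounding the height by \<beta>;
  this uniformity is what lets the bound pass through the integral over
  \<open>\<nu> w\<close>.\<close>

lemma palm_void_moment_growth:
  assumes C: "C \<in> bounded_sets UNIV"
  shows "\<exists>c\<ge>0. \<forall>k y. y \<in> {\<alpha>..\<beta>} \<longrightarrow>
    void_moment (palm_K y) k (slab C) \<le> ennreal ((c * sqrt k) ^ k)"
proof -
  let ?C = "slab C \<inter> {z. Im z \<in> {\<alpha>..\<beta>}}"
  obtain c where c: "c \<ge> 0" "\<And>y z \<zeta>. 0 < y \<Longrightarrow> y \<le> \<beta> \<Longrightarrow> z \<in> ?C \<Longrightarrow> \<zeta> \<in> ?C \<Longrightarrow>
      cmod (palm_K y z \<zeta>) \<le> c"
    using K_H_palm_bounded[OF slab_strip_bounded[OF C], of \<beta>] by metis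
  have "void_moment (palm_K y) k (slab C) \<le> ennreal ((c * measure lborel ?C * sqrt k) ^ k)"
    if "y \<in> {\<alpha>..\<beta>}" for k y
    unfolding void_moment_strip[of _ k "slab C"]
    using that \<alpha>_pos by (intro void_moment_le slab_strip_bounded[OF C] c) auto
  then show ?thesis
    using c(1) by (intro exI[of _ "c * measure lborel ?C"]) simp
qed

end

section \<open>The joint law of height and configuration\<close>

locale palm_family = strip_weight +
  fixes P :: "real \<Rightarrow> complex measure measure"
  assumes determinantal_P: "0 < y \<Longrightarrow> determinantal upper_half_plane (thinned_palm_kernel w y) (P y)"
begin

abbreviation "mixture \<equiv> palm_mixture w P"

lemma moments_P: "0 < y \<Longrightarrow> thinned_moments (palm_K y) (P y)"
  by (intro thinned_moments_palm determinantal_P)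

lemma P_measurable: "P \<in> height_space \<rightarrow>\<^sub>M prob_algebra HC"
  using moments_P by (rule measurable_palm_kernel)

lemma prob_space_P: "0 < y \<Longrightarrow> prob_space (P y)" and sets_P: "0 < y \<Longrightarrow> sets (P y) = sets HC"
  using moments_P by (auto simp: thinned_moments_def)

lemma Pair_measurable: "0 < y \<Longrightarrow> Pair y \<in> P y \<rightarrow>\<^sub>M height_space \<Otimes>\<^sub>M HC"
  using measurable_Pair1'[of y height_space HC]
  by (simp add: measurable_cong_sets[OF sets_P refl] space_restrict_space)

lemma kernel_measurable:
  "(\<lambda>y. distr (P y) (height_space \<Otimes>\<^sub>M HC) (\<lambda>\<xi>. (y, \<xi>))) \<in> \<nu> w \<rightarrow>\<^sub>M subprob_algebra (height_space \<Otimes>\<^sub>M HC)"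
proof -
  have "(\<lambda>y. distr (P y) (height_space \<Otimes>\<^sub>M HC) (Pair y)) \<in> height_space
      \<rightarrow>\<^sub>M subprob_algebra (height_space \<Otimes>\<^sub>M HC)"
    by (rule measurable_distr2[OF _ measurable_prob_algebraD[OF P_measurable]]) simp
  then show ?thesis by (simp add: measurable_cong_sets[OF sets_\<nu> refl])
qed

lemma sets_mixture: "sets mixture = sets (height_space \<Otimes>\<^sub>M HC)"
  unfolding palm_mixture_def by (rule sets_bind) (auto simp: space_\<nu> intro: exI[of _ 1])

lemma space_mixture: "space mixture = {0<..} \<times> configs upper_half_plane"
  using sets_eq_imp_space_eq[OF sets_mixture] by (simp add: space_pair_measure space_restrict_space)

lemma prob_space_mixture: "prob_space mixture"
  unfolding palm_mixture_def
proof (rule prob_space.prob_space_bind[OF prob_space_\<nu> _ kernel_measurable], rule AE_I2)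
  fix y assume "y \<in> space (\<nu> w)"
  then have "0 < y" by (simp add: space_\<nu>)
  then show "prob_space (distr (P y) (height_space \<Otimes>\<^sub>M HC) (\<lambda>\<xi>. (y, \<xi>)))"
    by (intro prob_space.prob_space_distr prob_space_P Pair_measurable)
qed

lemma nn_integral_mixture:
  assumes g: "g \<in> borel_measurable (height_space \<Otimes>\<^sub>M HC)"
  shows "(\<integral>\<^sup>+p. g p \<partial>mixture) = (\<integral>\<^sup>+y. \<integral>\<^sup>+\<xi>. g (y, \<xi>) \<partial>P y \<partial>\<nu> w)"
  unfolding palm_mixture_def nn_integral_bind[OF g kernel_measurable]
  using g by (intro nn_integral_cong nn_integral_distr Pair_measurable) (simp_all add: space_\<nu>)

lemma fst_measurable: "fst \<in> mixture \<rightarrow>\<^sub>M height_space" and snd_measurable: "snd \<in> mixture \<rightarrow>\<^sub>M HC"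
  by (simp_all add: measurable_cong_sets[OF sets_mixture refl])

lemma distr_fst_mixture: "distr mixture height_space fst = \<nu> w"
proof (rule measure_eqI)
  fix A assume "A \<in> sets (distr mixture height_space fst)"
  then have A: "A \<in> sets height_space" by simp
  have m: "(\<lambda>p. indicator A (fst p) :: ennreal) \<in> borel_measurable (height_space \<Otimes>\<^sub>M HC)"
    using A by measurable
  have "emeasure (distr mixture height_space fst) A = (\<integral>\<^sup>+y. indicator A y \<partial>distr mixture height_space fst)"
    using A by simp
  also have "\<dots> = (\<integral>\<^sup>+p. indicator A (fst p) \<partial>mixture)"
    using A by (intro nn_integral_distr fst_measurable) simp
  also have "\<dots> = (\<integral>\<^sup>+y. \<integral>\<^sup>+\<xi>. indicator A y \<partial>P y \<partial>\<nu> w)"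
    by (simp add: nn_integral_mixture[OF m])
  also have "\<dots> = (\<integral>\<^sup>+y. indicator A y \<partial>\<nu> w)"
    by (intro nn_integral_cong) (simp add: space_\<nu> prob_space.emeasure_space_1[OF prob_space_P])
  also have "\<dots> = emeasure (\<nu> w) A" using A by (simp add: sets_\<nu>)
  finally show "emeasure (distr mixture height_space fst) A = emeasure (\<nu> w) A" .
qed (simp add: sets_\<nu>)

text \<open>On an event that restricts the height to a set \<open>S\<close>, the indicator and the
  candidate have the same integral, namely that of \<open>measure (P y) A\<close> over
  \<open>S\<close> under \<open>\<nu> w\<close>; such events make up the sigma-field generated by
  the height.\<close>

lemma conditional_law_mixture: "conditional_law mixture snd HC fst height_space P"
  unfolding conditional_law_def
proof (intro conjI snd_measurable fst_measurable P_measurable ballI)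
  fix A assume A: "A \<in> sets HC"
  let ?F = "vimage_algebra (space mixture) fst height_space"
  interpret prob_space mixture by (rule prob_space_mixture)
  have "subalgebra mixture ?F"
    by (simp add: subalgebra_def sets_image_in_sets[OF refl fst_measurable])
  then interpret finite_measure_subalgebra mixture ?F
    by (intro finite_measure_subalgebra.intro finite_measure_subalgebra_axioms.intro finite_measure_axioms)
  have fF: "fst \<in> ?F \<rightarrow>\<^sub>M height_space"
    using measurable_space[OF fst_measurable] by (intro measurable_vimage_algebra1) auto
  have PA: "(\<lambda>y. measure (P y) A) \<in> borel_measurable height_space"
    by (rule measurable_compose[OF P_measurable measurable_measure_prob_algebra[OF A]])
  define f g where "f = (indicator (snd -` A \<inter> space mixture) :: _ \<Rightarrow> real)" and "g =
      (\<lambda>p :: real \<times> complex measure. measure (P (fst p)) A)"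
  have f: "f \<in> borel_measurable mixture"
    unfolding f_def using measurable_sets[OF snd_measurable A] by simp
  have gF: "g \<in> borel_measurable ?F"
    unfolding g_def by (rule measurable_compose[OF fF PA])
  have g: "g \<in> borel_measurable mixture"
    unfolding g_def by (rule measurable_compose[OF fst_measurable PA])
  have g1: "0 \<le> g p" "g p \<le> 1" if "p \<in> space mixture" for p
    using that prob_space.prob_le_1[OF prob_space_P, of "fst p" A] by (auto simp: g_def space_mixture)
  show "AE p in mixture. real_cond_exp mixture ?F (indicator (snd -` A \<inter> space mixture)) p =
      measure (P (fst p)) A"
    unfolding f_def[symmetric] g_def[symmetric, THEN fun_cong]
  proof (rule real_cond_exp_charact)
    show "integrable mixture f" "integrable mixture g"
      using f g g1 by (auto intro!: integrable_const_bound[of _ 1] simp: f_def)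
    show "g \<in> borel_measurable ?F" by (rule gF)
    fix D assume D: "D \<in> sets ?F"
    then obtain S where S: "S \<in> sets height_space" "D = fst -` S \<inter> space mixture"
      using measurable_space[OF fst_measurable] by (auto simp: sets_vimage_algebra2)
    have m1: "(\<lambda>p. indicator S (fst p) * indicator A (snd p) :: ennreal)
        \<in> borel_measurable (height_space \<Otimes>\<^sub>M HC)"
      using S(1) A by measurable
    have m2: "(\<lambda>p. indicator S (fst p) * ennreal (measure (P (fst p)) A))
        \<in> borel_measurable (height_space \<Otimes>\<^sub>M HC)"
      using S(1) measurable_compose[OF measurable_fst PA] by measurable
    have "(\<integral>\<^sup>+p. ennreal (indicator D p * f p) \<partial>mixture) =
        (\<integral>\<^sup>+p. indicator S (fst p) * indicator A (snd p) \<partial>mixture)"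
      by (intro nn_integral_cong) (auto simp: S(2) f_def indicator_def)
    also have "\<dots> = (\<integral>\<^sup>+y. \<integral>\<^sup>+\<xi>. indicator S y * indicator A \<xi> \<partial>P y \<partial>\<nu> w)"
      by (simp add: nn_integral_mixture[OF m1])
    also have "\<dots> = (\<integral>\<^sup>+y. \<integral>\<^sup>+\<xi>. indicator S y * ennreal (measure (P y) A) \<partial>P y \<partial>\<nu> w)"
    proof (rule nn_integral_cong)
      fix y assume "y \<in> space (\<nu> w)"
      then have y: "0 < y" by (simp add: space_\<nu>)
      interpret Py: prob_space "P y" by (rule prob_space_P[OF y])
      show "(\<integral>\<^sup>+\<xi>. indicator S y * indicator A \<xi> \<partial>P y) =
          (\<integral>\<^sup>+\<xi>. indicator S y * ennreal (measure (P y) A) \<partial>P y)"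
        using A sets_P[OF y] by (simp add: nn_integral_cmult_indicator Py.emeasure_eq_measure Py.prob_space)
    qed
    also have "\<dots> = (\<integral>\<^sup>+p. indicator S (fst p) * ennreal (measure (P (fst p)) A) \<partial>mixture)"
      by (simp add: nn_integral_mixture[OF m2])
    also have "\<dots> = (\<integral>\<^sup>+p. ennreal (indicator D p * g p) \<partial>mixture)"
      by (intro nn_integral_cong) (auto simp: S(2) g_def indicator_def)
    finally have eq: "(\<integral>\<^sup>+p. ennreal (indicator D p * f p) \<partial>mixture) =
        (\<integral>\<^sup>+p. ennreal (indicator D p * g p) \<partial>mixture)" .
    have "D \<in> sets mixture" using D subalg by (auto simp: subalgebra_def)
    then show "(LINT p:D|mixture. f p) = (LINT p:D|mixture. g p)"
      unfolding set_lebesgue_integral_def using f g g1 eq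
      by (subst (1 2) integral_eq_nn_integral) (auto simp: f_def)
  qed
qed

text \<open>The exceptional event is measurable, so its mass is the average over
  \<open>\<nu> w\<close> of its masses under the laws \<open>P y\<close>, all of which are
  zero.\<close>

lemma AE_mixture_good: "AE p in mixture. good_projection (points (snd p))"
proof -
  let ?G = "{\<xi> \<in> configs upper_half_plane. good_projection (points \<xi>)}"
  have G: "?G \<in> sets HC" by (rule good_projection_sets)
  have bad: "(\<lambda>\<xi>. if \<xi> \<in> ?G then 0 else 1 :: ennreal) \<in> borel_measurable HC"
    by (rule measurable_If_set[OF _ _ sets.Int[OF G sets.top]]) simp_all
  have m: "(\<lambda>p. if snd p \<in> ?G then 0 else 1 :: ennreal) \<in> borel_measurable (height_space \<Otimes>\<^sub>M HC)"
    by (rule measurable_compose[OF measurable_snd bad])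
  have "(\<integral>\<^sup>+p. (if snd p \<in> ?G then 0 else 1 :: ennreal) \<partial>mixture) =
      (\<integral>\<^sup>+y. \<integral>\<^sup>+\<xi>. (if \<xi> \<in> ?G then 0 else 1 :: ennreal) \<partial>P y \<partial>\<nu> w)"
    by (simp only: nn_integral_mixture[OF m] snd_conv)
  also have "\<dots> = (\<integral>\<^sup>+y. 0 \<partial>\<nu> w)"
  proof (rule nn_integral_cong)
    fix y assume "y \<in> space (\<nu> w)"
    then have y: "0 < y" by (simp add: space_\<nu>)
    have "AE \<xi> in P y. \<xi> \<in> ?G"
      using AE_good_projection[OF moments_P[OF y]] AE_space
      by eventually_elim (use sets_eq_imp_space_eq[OF sets_P[OF y]] in simp)
    then have "AE \<xi> in P y. (if \<xi> \<in> ?G then 0 else 1 :: ennreal) = 0"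
      by eventually_elim simp
    from nn_integral_cong_AE[OF this]
    show "(\<integral>\<^sup>+\<xi>. (if \<xi> \<in> ?G then 0 else 1 :: ennreal) \<partial>P y) = 0" by simp
  qed
  finally have "AE p in mixture. (if snd p \<in> ?G then 0 else 1 :: ennreal) = 0"
    using m by (simp add: nn_integral_0_iff_AE measurable_cong_sets[OF sets_mixture refl])
  then show ?thesis by eventually_elim (simp split: if_splits)
qed

lemma AE_mixture_configs: "AE (y, \<xi>) in mixture. distr \<xi> borel Re \<in> configs UNIV"
  using AE_mixture_good AE_space
  by eventually_elim (auto simp: space_mixture distr_Re_configs_iff)

lemma proj_measurable_mixture: "(\<lambda>(y, \<xi>). proj \<xi>) \<in> mixture \<rightarrow>\<^sub>M config_space UNIV"
  using measurable_compose[OF snd_measurable measurable_proj] by (simp add: split_beta')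

section \<open>Identification of the projected law\<close>

definition projected_law :: "real measure measure" where
  "projected_law = distr mixture (config_space UNIV) (\<lambda>(y, \<xi>). proj \<xi>)"

lemma prob_space_projected_law: "prob_space projected_law"
  unfolding projected_law_def
  by (rule prob_space.prob_space_distr[OF prob_space_mixture proj_measurable_mixture])

lemma sets_projected_law: "sets projected_law = sets (config_space UNIV)"
  by (simp add: projected_law_def)

lemma projected_law_void_moment:
  assumes C: "C \<in> sets borel"
  shows "(\<integral>\<^sup>+\<mu>. tuple_sum k (indicator ({..<k} \<rightarrow>\<^sub>E C)) (points \<mu>) \<partial>projected_law) =
    (\<integral>\<^sup>+y. void_moment (palm_K y) k (slab C) \<partial>\<nu> w)"
proof -
  let ?g = "\<lambda>\<xi> :: complex measure. tuple_sum k (indicator ({..<k} \<rightarrow>\<^sub>E slab C)) (points \<xi>) :: ennreal"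
  have gm: "(\<lambda>\<mu>. tuple_sum k (indicator ({..<k} \<rightarrow>\<^sub>E C)) (points \<mu>))
      \<in> borel_measurable (config_space (UNIV :: real set))"
    using C by (intro RL.measurable_tuple_sum' borel_measurable_indicator sets_PiM_I_finite) auto
  have sm: "?g \<in> borel_measurable HC"
    by (intro HP.measurable_tuple_sum' indicator_PiE_measurable vimage_Re_sets_borel_H C)
  have "(\<integral>\<^sup>+\<mu>. tuple_sum k (indicator ({..<k} \<rightarrow>\<^sub>E C)) (points \<mu>) \<partial>projected_law) =
      (\<integral>\<^sup>+p. tuple_sum k (indicator ({..<k} \<rightarrow>\<^sub>E C)) (points (proj (snd p))) \<partial>mixture)"
    unfolding projected_law_def using gm
    by (subst nn_integral_distr[OF proj_measurable_mixture]) (simp_all add: split_beta')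
  also have "\<dots> = (\<integral>\<^sup>+p. ?g (snd p) \<partial>mixture)"
  proof (rule nn_integral_cong_AE)
    show "AE p in mixture. tuple_sum k (indicator ({..<k} \<rightarrow>\<^sub>E C)) (points (proj (snd p))) = ?g (snd p)"
      using AE_mixture_good AE_space
    proof eventually_elim
      case (elim p)
      then have p: "snd p \<in> configs upper_half_plane" by (auto simp: space_mixture)
      interpret configuration upper_half_plane "snd p" using p by unfold_locales
      have "points (proj (snd p)) = Re ` points (snd p)" "inj_on Re (points (snd p))"
        using elim points_proj_good[OF p] by (auto simp: good_projection_def)
      then have "tuple_sum k (indicator ({..<k} \<rightarrow>\<^sub>E C)) (points (proj (snd p))) =
          tuple_sum k (\<lambda>x. indicator ({..<k} \<rightarrow>\<^sub>E C) (\<lambda>i\<in>{..<k}. Re (x i))) (points (snd p))"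
        by (simp add: tuple_sum_image)
      also have "\<dots> = ?g (snd p)"
        using points_subset by (intro tuple_sum_cong) (auto simp: tuples_def indicator_def PiE_iff)
      finally show ?case .
    qed
  qed
  also have "\<dots> = (\<integral>\<^sup>+y. \<integral>\<^sup>+\<xi>. ?g \<xi> \<partial>P y \<partial>\<nu> w)"
    using nn_integral_mixture[OF measurable_compose[OF measurable_snd sm]] by simp
  also have "\<dots> = (\<integral>\<^sup>+y. void_moment (palm_K y) k (slab C) \<partial>\<nu> w)"
    by (intro nn_integral_cong thinned_moments_void_moment moments_P vimage_Re_sets_borel_H C) (simp add:
        space_\<nu>)
  finally show ?thesis .
qed

text \<open>For every order the moments of the two measures differ by the same factor
  \<open>r\<close>, and so do their void probabilities, as limits of the same alternating
  series.\<close>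

lemma campbell_eq_projected_law:
  assumes Z: "determinantal upper_half_plane K_H Z" and B: "B \<in> sets borel" "emeasure lborel B \<noteq> \<infinity>"
  shows "campbell (X_law w Z) B = scale_measure (ennreal (measure lborel B * intensity w)) projected_law"
proof -
  let ?M = "campbell (X_law w Z) B"
  define r where "r = measure lborel B * intensity w"
  have r: "0 \<le> r" using intensity_pos by (simp add: r_def)
  interpret L: prob_space projected_law by (rule prob_space_projected_law)
  interpret \<nu>: prob_space "\<nu> w" by (rule prob_space_\<nu>)
  have moment: "(\<integral>\<^sup>+\<mu>. tuple_sum k (indicator ({..<k} \<rightarrow>\<^sub>E C)) (points \<mu>) \<partial>?M) =
      ennreal r * (\<integral>\<^sup>+\<mu>. tuple_sum k (indicator ({..<k} \<rightarrow>\<^sub>E C)) (points \<mu>) \<partial>projected_law)"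
    if "C \<in> sets borel" for k C
    using B intensity_pos
    by (simp add: campbell_void_moment[OF Z B(1) that] nn_integral_height_density_\<nu>[OF that]
        projected_law_void_moment[OF that]
        r_def ennreal_mult' emeasure_eq_ennreal_measure mult.assoc)
  \<comment> \<open>The moment of order 0 is the total mass; it shows that the Campbell measure is
    finite, as the series for its void probabilities requires.\<close>
  have "emeasure ?M (space ?M) = (\<integral>\<^sup>+\<mu>. 1 \<partial>?M)" by simp
  also have "\<dots> = ennreal r"
    using moment[of "{}" 0] by (simp add: tuple_sum_0 L.emeasure_space_1)
  finally have "finite_measure ?M" by (intro finite_measureI) simp
  show ?thesis
    unfolding r_def[symmetric]
  proof (rule RL.config_measure_eqI[OF \<open>finite_measure ?M\<close>])
    fix C :: "real set" assume C: "C \<in> bounded_sets UNIV"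
    have Cb: "C \<in> sets borel" using C by (rule RL.bounded_sets_borel)
    define m where "m k = (\<integral>\<^sup>+\<mu>. tuple_sum k (indicator ({..<k} \<rightarrow>\<^sub>E C)) (points \<mu>) \<partial>projected_law)" for k
    define a where "a k = enn2real (m k) / fact k" for k
    obtain c where c: "c \<ge> 0" "\<And>k y. y \<in> {\<alpha>..\<beta>} \<Longrightarrow>
        void_moment (palm_K y) k (slab C) \<le> ennreal ((c * sqrt k) ^ k)"
      using palm_void_moment_growth[OF C] by metis
    have m_le: "m k \<le> ennreal ((c * sqrt k) ^ k)" for k
    proof -
      have "AE y in \<nu> w. void_moment (palm_K y) k (slab C) \<le> ennreal ((c * sqrt k) ^ k)"
        using AE_\<nu> by eventually_elim (rule c(2))
      then have "m k \<le> (\<integral>\<^sup>+y. ennreal ((c * sqrt k) ^ k) \<partial>\<nu> w)"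
        unfolding m_def projected_law_void_moment[OF Cb] by (rule nn_integral_mono_AE)
      then show ?thesis by (simp add: \<nu>.emeasure_space_1)
    qed
    have m: "m k = ennreal (fact k * a k)" for k
    proof -
      have "m k < \<infinity>" using m_le[of k] by (rule le_less_trans) simp
      then show ?thesis by (simp add: a_def)
    qed
    have a0: "0 \<le> a k" for k by (simp add: a_def)
    have "a k \<le> (c * sqrt k) ^ k / fact k" for k
      unfolding a_def using m_le[of k] c(1) by (intro divide_right_mono enn2real_leI) auto
    then have up: "\<forall>\<^sub>F k in sequentially. a k \<le> (c * sqrt (real k)) ^ k / fact k" by simp
    have low: "\<forall>\<^sub>F k in sequentially. 0 \<le> a k" using a0 by simp
    have lim: "a \<longlonglongrightarrow> 0"
      by (rule tendsto_sandwich[OF low up tendsto_const Hadamard_growth[OF c(1)]])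
    have 1: "(\<lambda>n. \<Sum>k\<le>n. (-1) ^ k * a k) \<longlonglongrightarrow> measure projected_law (RL.void C)"
      by (rule RL.void_probability_limit[OF L.finite_measure_axioms sets_projected_law C _ a0 lim])
         (simp add: m[symmetric] m_def)
    have 2: "(\<lambda>n. \<Sum>k\<le>n. (-1) ^ k * (r * a k)) \<longlonglongrightarrow> measure ?M (RL.void C)"
    proof (rule RL.void_probability_limit[OF \<open>finite_measure ?M\<close> sets_campbell C])
      show "(\<integral>\<^sup>+\<mu>. tuple_sum k (indicator ({..<k} \<rightarrow>\<^sub>E C)) (points \<mu>) \<partial>?M) =
          ennreal (fact k * (r * a k))" for k
        unfolding moment[OF Cb] m_def[symmetric] m using r by (simp add: ennreal_mult'[symmetric] mult_ac)
      show "0 \<le> r * a k" for k using r a0 by simp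
      show "(\<lambda>k. r * a k) \<longlonglongrightarrow> 0" using tendsto_mult_right_zero[OF lim, of r] .
    qed
    have "(\<lambda>n. \<Sum>k\<le>n. (-1) ^ k * (r * a k)) \<longlonglongrightarrow> r * measure projected_law (RL.void C)"
      using tendsto_mult_left[OF 1, of r] by (simp add: sum_distrib_left mult_ac)
    with 2 have eq: "measure ?M (RL.void C) = r * measure projected_law (RL.void C)"
      by (rule LIMSEQ_unique)
    interpret M: finite_measure ?M by fact
    show "emeasure ?M (RL.void C) = emeasure (scale_measure (ennreal r) projected_law) (RL.void C)"
      using r by (simp add: M.emeasure_eq_measure eq L.emeasure_eq_measure ennreal_mult')
  qed (simp_all add: sets_projected_law)
qed

text \<open>For nonnegative \<open>G\<close> the sums can be integrated in \<open>ennreal\<close>,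
  where the equality of measures applies; the bound \<open>b\<close> yields integrability under the
  projected law and with it the return to real integrals.\<close>

lemma has_bochner_integral_palm_sum:
  assumes Z: "determinantal upper_half_plane K_H Z" and B: "B \<in> sets borel" "bounded B"
    and G: "G \<in> borel_measurable (config_space UNIV)" "\<And>\<mu>. \<mu> \<in> configs UNIV \<Longrightarrow> 0 \<le> G \<mu>" "\<And>\<mu>. \<mu> \<in> configs UNIV \<Longrightarrow>
        G \<mu> \<le> b"
  shows "has_bochner_integral (X_law w Z) (\<lambda>\<mu>. \<Sum>x\<in>points \<mu> \<inter> B. G (translate x (remove_point x \<mu>)))
    (measure lborel B * intensity w * (\<integral>\<mu>. G \<mu> \<partial>projected_law))"
proof -
  interpret L: prob_space projected_law by (rule prob_space_projected_law)
  have spL: "space projected_law = configs UNIV"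
    using sets_eq_imp_space_eq[OF sets_projected_law] by simp
  have spX: "space (X_law w Z) = configs UNIV"
    using sets_eq_imp_space_eq[OF X_law_sets] by simp
  have g: "(\<lambda>\<mu>. ennreal (G \<mu>)) \<in> borel_measurable (config_space UNIV)" using G(1) by measurable
  let ?S = "\<lambda>\<mu>. \<Sum>x\<in>points \<mu> \<inter> B. G (translate x (remove_point x \<mu>))"
  have Gpos: "0 \<le> G (translate x (remove_point x \<mu>))" if "\<mu> \<in> configs UNIV" "x \<in> points \<mu>" for \<mu> x
    using translate_remove_point[OF that] reduced_in_configs[OF that(1)] G(2) by simp
  have S0: "0 \<le> ?S \<mu>" if "\<mu> \<in> configs UNIV" for \<mu>
    using Gpos[OF that] by (intro sum_nonneg) auto
  have S: "palm_sum B (\<lambda>\<mu>. ennreal (G \<mu>)) \<mu> = ennreal (?S \<mu>)" if "\<mu> \<in> configs UNIV" for \<mu>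
    unfolding palm_sum_eq(2)[OF B g that] using Gpos[OF that] by (intro sum_ennreal) auto
  have Gint: "integrable projected_law G"
    using G by (intro L.integrable_const_bound[of _ b] AE_I2) (auto simp: spL measurable_cong_sets[OF
        sets_projected_law refl])
  show ?thesis
  proof (rule has_bochner_integral_nn_integral)
    have "(\<lambda>\<mu>. enn2real (palm_sum B (\<lambda>\<mu>. ennreal (G \<mu>)) \<mu>)) \<in> borel_measurable (X_law w Z)"
      using measurable_palm_sum[OF B(1) g] by (simp add: measurable_cong_sets[OF X_law_sets refl])
    then show "?S \<in> borel_measurable (X_law w Z)"
      by (subst measurable_cong[where g="\<lambda>\<mu>. enn2real (palm_sum B (\<lambda>\<mu>. ennreal (G \<mu>)) \<mu>)"]) (simp_all add:
          spX S S0)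
    show "AE \<mu> in X_law w Z. 0 \<le> ?S \<mu>" using S0 by (intro AE_I2) (simp add: spX)
    have int0: "0 \<le> (\<integral>\<mu>. G \<mu> \<partial>projected_law)"
      using G(2) by (intro Bochner_Integration.integral_nonneg) (simp add: spL)
    then show "0 \<le> measure lborel B * intensity w * (\<integral>\<mu>. G \<mu> \<partial>projected_law)"
      using intensity_pos by simp
    have "emeasure lborel B \<noteq> \<infinity>"
      using emeasure_bounded_finite[OF B(2)] by simp
    have "(\<integral>\<^sup>+\<mu>. ennreal (?S \<mu>) \<partial>X_law w Z) = (\<integral>\<^sup>+\<mu>. palm_sum B (\<lambda>\<mu>. ennreal (G \<mu>)) \<mu> \<partial>X_law w Z)"
      by (intro nn_integral_cong) (simp add: spX S)
    also have "\<dots> = (\<integral>\<^sup>+\<mu>. ennreal (G \<mu>) \<partial>campbell (X_law w Z) B)"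
      by (rule nn_integral_campbell[OF X_law_sets B(1) g, symmetric])
    also have "\<dots> = ennreal (measure lborel B * intensity w) * (\<integral>\<^sup>+\<mu>. ennreal (G \<mu>) \<partial>projected_law)"
      unfolding campbell_eq_projected_law[OF Z B(1) \<open>emeasure lborel B \<noteq> \<infinity>\<close>]
      using g by (intro nn_integral_scale_measure) (simp add: measurable_cong_sets[OF sets_projected_law
          refl])
    also have "(\<integral>\<^sup>+\<mu>. ennreal (G \<mu>) \<partial>projected_law) = ennreal (\<integral>\<mu>. G \<mu> \<partial>projected_law)"
      using G(2) by (intro nn_integral_eq_integral Gint AE_I2) (simp add: spL)
    finally show "(\<integral>\<^sup>+\<mu>. ennreal (?S \<mu>) \<partial>X_law w Z) =
        ennreal (measure lborel B * intensity w * (\<integral>\<mu>. G \<mu> \<partial>projected_law))"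
      using intensity_pos by (simp add: ennreal_mult')
  qed
qed

lemma projected_law_is_reduced_palm:
  assumes Z: "determinantal upper_half_plane K_H Z"
  shows "is_reduced_palm (X_law w Z) (intensity w) projected_law"
  unfolding is_reduced_palm_def
proof (intro conjI allI impI prob_space_projected_law sets_projected_law)
  fix B :: "real set" and F :: "real measure \<Rightarrow> real"
  assume *: "B \<in> sets borel \<and> bounded B \<and> 0 < measure lborel B \<and>
    F \<in> borel_measurable (config_space UNIV) \<and> bounded (F ` configs UNIV)"
  then obtain b where b: "\<And>\<mu>. \<mu> \<in> configs UNIV \<Longrightarrow> \<bar>F \<mu>\<bar> \<le> b"
    by (auto simp: bounded_iff)
  have F: "F \<in> borel_measurable (config_space UNIV)" using * by simp
  interpret L: prob_space projected_law by (rule prob_space_projected_law)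
  have spL: "space projected_law = configs UNIV"
    using sets_eq_imp_space_eq[OF sets_projected_law] by simp
  \<comment> \<open>The empty configuration witnesses that the bound \<open>b\<close> is
    nonnegative.\<close>
  have "dirac_sum UNIV {} \<in> configs (UNIV :: real set)"
    by (rule dirac_sum_in_configs) (simp add: locally_finite_def)
  from order_trans[OF abs_ge_zero b[OF this]] have "b \<ge> 0" .
  have Fint: "integrable projected_law F"
    using F b by (intro L.integrable_const_bound[of _ b] AE_I2) (auto simp: spL measurable_cong_sets[OF
        sets_projected_law refl])
  let ?c = "measure lborel B * intensity w"
  let ?R = "\<lambda>x \<mu>. translate x (remove_point x \<mu>)"
  \<comment> \<open>A signed \<open>F\<close> is raised by its bound to a function between 0 and
    \<open>2 * b\<close>; afterwards the contribution of the constant \<open>b\<close> is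
    subtracted.\<close>
  have "has_bochner_integral (X_law w Z) (\<lambda>\<mu>. \<Sum>x\<in>points \<mu> \<inter> B. F (?R x \<mu>) + b) (?c * (\<integral>\<mu>. F \<mu> + b
      \<partial>projected_law))"
    using * F b by (intro has_bochner_integral_palm_sum[OF Z, where b="2 *
        b"]) (auto simp: abs_le_iff, smt (verit))
  moreover have "has_bochner_integral (X_law w Z) (\<lambda>\<mu>. \<Sum>x\<in>points \<mu> \<inter> B. b) (?c * (\<integral>\<mu>. b \<partial>projected_law))"
    using * \<open>b \<ge> 0\<close> by (intro has_bochner_integral_palm_sum[OF Z, where b=b and G="\<lambda>_. b"]) auto
  ultimately have "has_bochner_integral (X_law w Z)
      (\<lambda>\<mu>. (\<Sum>x\<in>points \<mu> \<inter> B. F (?R x \<mu>) + b) - (\<Sum>x\<in>points \<mu> \<inter> B. b))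
      (?c * (\<integral>\<mu>. F \<mu> + b \<partial>projected_law) - ?c * (\<integral>\<mu>. b \<partial>projected_law))"
    by (rule has_bochner_integral_diff)
  moreover have "(\<integral>\<mu>. F \<mu> + b \<partial>projected_law) = (\<integral>\<mu>. F \<mu> \<partial>projected_law) + (\<integral>\<mu>. b \<partial>projected_law)"
    by (intro Bochner_Integration.integral_add Fint) simp
  ultimately show "has_bochner_integral (X_law w Z) (\<lambda>\<mu>. \<Sum>x\<in>points \<mu> \<inter> B. F (?R x \<mu>)) (?c * (\<integral>\<mu>. F \<mu>
      \<partial>projected_law))"
    by (simp add: sum.distrib distrib_left)
qed

text \<open>Indicators as test functions over the window \<open>{0..1}\<close> of length 1 express
  the mass of every event through the law of \<open>X_w\<close>, since the positive intensity
  cancels.\<close>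

lemma reduced_palm_unique:
  assumes Z: "determinantal upper_half_plane K_H Z" and P0: "is_reduced_palm (X_law w Z) (intensity w) P0"
  shows "projected_law = P0"
proof (rule measure_eqI)
  show "sets projected_law = sets P0"
    using P0 by (simp add: is_reduced_palm_def sets_projected_law)
  interpret P0: prob_space P0 using P0 by (simp add: is_reduced_palm_def)
  interpret L: prob_space projected_law by (rule prob_space_projected_law)
  fix A assume "A \<in> sets projected_law"
  then have A: "A \<in> sets (config_space UNIV)" "A \<in> sets P0"
    using P0 by (simp_all add: is_reduced_palm_def sets_projected_law)
  let ?S = "\<lambda>\<mu>. \<Sum>x\<in>points \<mu> \<inter> {0..1}. indicator A (translate x (remove_point x \<mu>)) :: real"
  have palm: "has_bochner_integral (X_law w Z) ?S (measure lborel {0..1::real} * intensity w *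
      (\<integral>\<mu>. indicator A \<mu> \<partial>Q))"
    if "is_reduced_palm (X_law w Z) (intensity w) Q" for Q
  proof -
    have "bounded (indicator A ` configs UNIV :: real set)"
      by (rule bounded_subset[of "{0, 1}"]) (auto simp: indicator_def)
    moreover have "(indicator A :: _ \<Rightarrow> real) \<in> borel_measurable (config_space UNIV)" using A(1) by simp
    ultimately have "{0..1::real} \<in> sets borel \<and> bounded {0..1::real} \<and> 0 < measure lborel {0..1::real} \<and>
        (indicator A :: _ \<Rightarrow> real) \<in> borel_measurable (config_space UNIV) \<and> bounded (indicator A ` configs
            UNIV :: real set)"
      by simp
    from that[unfolded is_reduced_palm_def, THEN conjunct2, THEN conjunct2, rule_format, OF this]
    show ?thesis .
  qed
  have "intensity w * measure projected_law A = intensity w * measure P0 A"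
    using has_bochner_integral_eq[OF palm[OF projected_law_is_reduced_palm[OF Z]] palm[OF P0]] A \<open>A
        \<in> sets projected_law\<close>
    by simp
  then show "emeasure projected_law A = emeasure P0 A"
    using intensity_pos by (simp add: L.emeasure_eq_measure P0.emeasure_eq_measure)
qed

end

theorem corollary3p3:
  fixes \<alpha> \<beta> :: real and w :: "real \<Rightarrow> real"
    and Z :: "complex measure measure"
    and P :: "real \<Rightarrow> complex measure measure"
  assumes "0 < \<alpha>" and "\<alpha> < \<beta>" and "w \<in> weights \<alpha> \<beta>"
    and "determinantal upper_half_plane K_H Z"
    and "\<And>y. 0 < y \<Longrightarrow> determinantal upper_half_plane (thinned_palm_kernel w y) (P y)"
  shows "prob_space (palm_mixture w P)
    \<and> sets (palm_mixture w P) = sets (height_space \<Otimes>\<^sub>M config_space upper_half_plane)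
    \<and> distr (palm_mixture w P) height_space fst = \<nu> w
    \<and> conditional_law (palm_mixture w P) snd (config_space upper_half_plane) fst height_space P
    \<and> (AE (y, \<xi>) in palm_mixture w P. distr \<xi> borel Re \<in> configs UNIV)
    \<and> (\<lambda>(y, \<xi>). proj \<xi>) \<in> palm_mixture w P \<rightarrow>\<^sub>M config_space UNIV
    \<and> (\<forall>P0. is_reduced_palm (X_law w Z) (intensity w) P0
          \<longleftrightarrow> distr (palm_mixture w P) (config_space UNIV) (\<lambda>(y, \<xi>). proj \<xi>) = P0)"
proof -
  interpret palm_family \<alpha> \<beta> w P
    by unfold_locales (fact assms)+
  show ?thesis
    using prob_space_mixture sets_mixture distr_fst_mixture conditional_law_mixture AE_mixture_configs
      proj_measurable_mixture projected_law_is_reduced_palm[OF assms(4)] reduced_palm_unique[OF assms(4)]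
    unfolding projected_law_def by blast
qed

end
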